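(* Let $\mathcal{A}=\{H_1,\dots,H_n\}$ be a central hyperplane arrangement in $\mathbb{Q}^l$, with $H_i=\alpha_i^{-1}(0)$, where the linear forms $\alpha_i\in\mathbb{Z}[x_1,\dots,x_l]$ are chosen so that no prime number divides any $\alpha_i$, and let $p$ be a large prime number. Then $\mathcal{A}_p$ is free in $\mathbb{F}_p^l$ with exponents $(e_1,\dots,e_l)$ if and only if $\mathcal{A}$ is free in $\mathbb{Q}^l$ with exponents $(e_1,\dots,e_l)$.
   Context: "Let $p$ be a large prime number" means: there is an integer $N$ depending only on $\mathcal{A}$ (and the chosen $\alpha_i$) such that the statement holds for every prime $p>N$ (and every tuple $(e_1,\dots,e_l)$ of non-negative integers); $N$ is taken large enough that all such $p$ are good for $\mathcal{A}$ (only finitely many primes are not good), so that $\mathcal{A}_p$ is defined. Let $K$ be a field and $S=K[x_1,\dots,x_l]$. A central hyperplane arrangement $\mathcal{B}$ in $K^l$ is a finite set of (distinct) hyperplanes through the origin, each given as $H=\beta_H^{-1}(0)$ with $\beta_H\in S$ a nonzero linear form. Let $\mathrm{Der}_{K^l}=\{\sum_{i=1}^l f_i\partial_{x_i}\mid f_i\in S\}$. A derivation $\delta=\sum_i f_i\partial_{x_i}$ is homogeneous of polynomial degree $d$, written $\mathrm{pdeg}(\delta)=d$, if all $f_i$ are homogeneous of degree $d$. The module of logarithmic vector fields is $D(\mathcal{B})=\{\delta\in\mathrm{Der}_{K^l}\mid \delta(\beta_H)\in(\beta_H)S \text{ for all } H\in\mathcal{B}\}$. The arrangement $\mathcal{B}$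 is free with exponents $(e_1,\dots,e_l)$ if $D(\mathcal{B})$ is a free $S$-module having a basis $\delta_1,\dots,\delta_l$ of homogeneous derivations with $\mathrm{pdeg}(\delta_i)=e_i$ (exponents are considered up to order). For the arrangement $\mathcal{A}$ in $\mathbb{Q}^l$: after clearing denominators and common factors, each $H_i$ is given by a linear form $\alpha_i$ with integer coefficients such that no prime divides $\alpha_i$; put $Q(\mathcal{A})=\prod_{i=1}^n\alpha_i\in\mathbb{Z}[x_1,\dots,x_l]$. For a prime $p$ let $\pi_p\colon\mathbb{Z}[x_1,\dots,x_l]\to\mathbb{F}_p[x_1,\dots,x_l]$ be the canonical homomorphism (reduction modulo $p$). The prime $p$ is good for $\mathcal{A}$ if $\pi_p(Q(\mathcal{A}))$ is reduced (square-free). For a good prime $p$, $\mathcal{A}_p$ is the central arrangement in $\mathbb{F}_p^l$ defined by $\pi_p(Q(\mathcal{A}))$, i.e. consisting of the hyperplanes $\pi_p(\alpha_i)=0$, $i=1,\dots,n$. *)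

theory Defs
  imports
    "HOL-Algebra.Algebra"
    "HOL-Algebra.Indexed_Polynomials"
    "HOL-Algebra.Algebraic_Closure_Type"
    "HOL-Number_Theory.Residues"
begin

text \<open>
  Since the prime \<open>p\<close> is a bound variable, \<open>\<rat>\<close> and \<open>\<F>\<^sub>p\<close> are ring records
  (\<open>ring_of_type_algebra :: rat ring\<close> and \<open>residue_ring p\<close>), and polynomials, derivations and
  arrangements are defined over an arbitrary ring record \<open>R\<close>.  Variables and coordinates are
  indexed by \<open>{..<l}\<close>.
\<close>

text \<open>
  The ring \<open>R[x\<^sub>0, \<dots>, x\<^bsub>l-1\<^esub>]\<close> on the carrier of \<^theory>\<open>HOL-Algebra.Indexed_Polynomials\<close>: a
  polynomial maps each monomial, a multiset of variables, to its coefficient.  That theory only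
  multiplies by single variables; here multiplication is convolution.
\<close>

definition mpoly_ring :: "('a, 'm) ring_scheme \<Rightarrow> nat \<Rightarrow> (nat multiset \<Rightarrow> 'a) ring" where
  "mpoly_ring R l =
    \<lparr>carrier = ring.indexed_pset R {..<l} (carrier R),
     monoid.mult = (\<lambda>f g m. \<Oplus>\<^bsub>R\<^esub>a\<in>{a. a \<subseteq># m}. f a \<otimes>\<^bsub>R\<^esub> g (m - a)),
     one = ring.indexed_const R \<one>\<^bsub>R\<^esub>,
     ring.zero = ring.indexed_const R \<zero>\<^bsub>R\<^esub>,
     add = ring.indexed_padd R\<rparr>"

definition mpoly_eval :: "('a, 'm) ring_scheme \<Rightarrow> (nat multiset \<Rightarrow> 'a) \<Rightarrow> (nat \<Rightarrow> 'a) \<Rightarrow> 'a" where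
  "mpoly_eval R f v =
    (\<Oplus>\<^bsub>R\<^esub>m\<in>{m. f m \<noteq> \<zero>\<^bsub>R\<^esub>}. f m \<otimes>\<^bsub>R\<^esub> (\<Otimes>\<^bsub>R\<^esub>i\<in>set_mset m. v i [^]\<^bsub>R\<^esub> count m i))"

text \<open>The zero polynomial is homogeneous of every degree.\<close>

definition homogeneous :: "('a, 'm) ring_scheme \<Rightarrow> nat \<Rightarrow> (nat multiset \<Rightarrow> 'a) \<Rightarrow> bool" where
  "homogeneous R d f \<longleftrightarrow> (\<forall>m. f m \<noteq> \<zero>\<^bsub>R\<^esub> \<longrightarrow> size m = d)"

definition nonzero_linear_form :: "('a, 'm) ring_scheme \<Rightarrow> nat \<Rightarrow> (nat multiset \<Rightarrow> 'a) \<Rightarrow> bool" where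
  "nonzero_linear_form R l f \<longleftrightarrow>
    f \<in> carrier (mpoly_ring R l) \<and> homogeneous R 1 f \<and> f \<noteq> \<zero>\<^bsub>mpoly_ring R l\<^esub>"

definition hyperplane :: "('a, 'm) ring_scheme \<Rightarrow> nat \<Rightarrow> (nat multiset \<Rightarrow> 'a) \<Rightarrow> (nat \<Rightarrow> 'a) set" where
  "hyperplane R l f = {v \<in> {..<l} \<rightarrow>\<^sub>E carrier R. mpoly_eval R f v = \<zero>\<^bsub>R\<^esub>}"

definition central_arrangement :: "('a, 'm) ring_scheme \<Rightarrow> nat \<Rightarrow> (nat \<Rightarrow> 'a) set set \<Rightarrow> bool" where
  "central_arrangement R l B \<longleftrightarrow>
    finite B \<and> (\<forall>H\<in>B. \<exists>\<beta>. nonzero_linear_form R l \<beta> \<and> H = hyperplane R l \<beta>)"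

text \<open>The coefficient of \<open>m\<close> in \<open>\<partial>f/\<partial>x\<^sub>i\<close> is the one of \<open>m x\<^sub>i\<close> in \<open>f\<close>, times its exponent of \<open>x\<^sub>i\<close>.\<close>

definition partial_deriv ::
    "('a, 'm) ring_scheme \<Rightarrow> nat \<Rightarrow> (nat multiset \<Rightarrow> 'a) \<Rightarrow> (nat multiset \<Rightarrow> 'a)" where
  "partial_deriv R i f = (\<lambda>m. [Suc (count m i)] \<cdot>\<^bsub>R\<^esub> f (add_mset i m))"

text \<open>
  The derivation \<open>\<Sum>\<^sub>i f\<^sub>i \<partial>/\<partial>x\<^sub>i\<close> is represented by its coefficient tuple \<open>f\<close>, with
  \<open>f\<^sub>i \<in> R[x\<^sub>0, \<dots>, x\<^bsub>l-1\<^esub>]\<close>.  The fields \<open>mult\<close> and \<open>one\<close> of the module record carry no meaning.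
\<close>

definition der_module ::
    "('a, 'm) ring_scheme \<Rightarrow> nat \<Rightarrow> (nat multiset \<Rightarrow> 'a, nat \<Rightarrow> nat multiset \<Rightarrow> 'a) module" where
  "der_module R l =
    \<lparr>carrier = {..<l} \<rightarrow>\<^sub>E carrier (mpoly_ring R l),
     monoid.mult = undefined,
     one = undefined,
     ring.zero = (\<lambda>i\<in>{..<l}. \<zero>\<^bsub>mpoly_ring R l\<^esub>),
     add = (\<lambda>\<delta> \<epsilon>. \<lambda>i\<in>{..<l}. \<delta> i \<oplus>\<^bsub>mpoly_ring R l\<^esub> \<epsilon> i),
     module.smult = (\<lambda>f \<delta>. \<lambda>i\<in>{..<l}. f \<otimes>\<^bsub>mpoly_ring R l\<^esub> \<delta> i)\<rparr>"

definition der_apply ::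
    "('a, 'm) ring_scheme \<Rightarrow> nat \<Rightarrow> (nat \<Rightarrow> nat multiset \<Rightarrow> 'a) \<Rightarrow> (nat multiset \<Rightarrow> 'a)
      \<Rightarrow> (nat multiset \<Rightarrow> 'a)" where
  "der_apply R l \<delta> g =
    (\<Oplus>\<^bsub>mpoly_ring R l\<^esub>i\<in>{..<l}. \<delta> i \<otimes>\<^bsub>mpoly_ring R l\<^esub> partial_deriv R i g)"

definition der_homogeneous ::
    "('a, 'm) ring_scheme \<Rightarrow> nat \<Rightarrow> nat \<Rightarrow> (nat \<Rightarrow> nat multiset \<Rightarrow> 'a) \<Rightarrow> bool" where
  "der_homogeneous R l d \<delta> \<longleftrightarrow> (\<forall>i<l. homogeneous R d (\<delta> i))"

text \<open>
  The condition at a hyperplane is required for every linear form defining it; over a field these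
  are scalar multiples of each other, so one of them suffices.
\<close>

definition log_derivations ::
    "('a, 'm) ring_scheme \<Rightarrow> nat \<Rightarrow> (nat \<Rightarrow> 'a) set set \<Rightarrow> (nat \<Rightarrow> nat multiset \<Rightarrow> 'a) set" where
  "log_derivations R l B =
    {\<delta> \<in> carrier (der_module R l).
      \<forall>\<beta>. nonzero_linear_form R l \<beta> \<and> hyperplane R l \<beta> \<in> B \<longrightarrow>
        der_apply R l \<delta> \<beta> \<in> PIdl\<^bsub>mpoly_ring R l\<^esub> \<beta>}"

definition log_module ::
    "('a, 'm) ring_scheme \<Rightarrow> nat \<Rightarrow> (nat \<Rightarrow> 'a) set set
      \<Rightarrow> (nat multiset \<Rightarrow> 'a, nat \<Rightarrow> nat multiset \<Rightarrow> 'a) module" where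
  "log_module R l B = (der_module R l)\<lparr>carrier := log_derivations R l B\<rparr>"

definition is_module_basis ::
    "('s, 'm) ring_scheme \<Rightarrow> ('s, 'v, 'n) module_scheme \<Rightarrow> 'i set \<Rightarrow> ('i \<Rightarrow> 'v) \<Rightarrow> bool" where
  "is_module_basis S M I b \<longleftrightarrow>
    b \<in> I \<rightarrow> carrier M \<and>
    (\<forall>x\<in>carrier M. \<exists>!c. c \<in> I \<rightarrow>\<^sub>E carrier S \<and> x = (\<Oplus>\<^bsub>M\<^esub>i\<in>I. c i \<odot>\<^bsub>M\<^esub> b i))"

text \<open>The exponents are \<open>e 0, \<dots>, e (l - 1)\<close>; other values of \<open>e\<close> are irrelevant.\<close>

definition free_with_exponents ::
    "('a, 'm) ring_scheme \<Rightarrow> nat \<Rightarrow> (nat \<Rightarrow> 'a) set set \<Rightarrow> (nat \<Rightarrow> nat) \<Rightarrow> bool" where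
  "free_with_exponents R l B e \<longleftrightarrow>
    (\<exists>\<delta>. is_module_basis (mpoly_ring R l) (log_module R l B) {..<l} \<delta> \<and>
         (\<forall>i<l. der_homogeneous R l (e i) (\<delta> i)))"

definition square_free :: "('s, 'm) monoid_scheme \<Rightarrow> 's \<Rightarrow> bool" where
  "square_free S f \<longleftrightarrow>
    (\<forall>g\<in>carrier S. (g \<otimes>\<^bsub>S\<^esub> g) divides\<^bsub>S\<^esub> f \<longrightarrow> g \<in> Units S)"

abbreviation rat_field :: "rat ring" where
  "rat_field \<equiv> ring_of_type_algebra"

abbreviation prime_field :: "nat \<Rightarrow> int ring" where
  "prime_field p \<equiv> residue_ring (int p)"

definition rat_poly :: "(nat multiset \<Rightarrow> int) \<Rightarrow> (nat multiset \<Rightarrow> rat)" where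
  "rat_poly f = (\<lambda>m. of_int (f m))"

definition reduce_poly :: "nat \<Rightarrow> (nat multiset \<Rightarrow> int) \<Rightarrow> (nat multiset \<Rightarrow> int)" where
  "reduce_poly p f = (\<lambda>m. f m mod int p)"

definition defining_poly ::
    "nat \<Rightarrow> nat \<Rightarrow> (nat \<Rightarrow> nat multiset \<Rightarrow> int) \<Rightarrow> (nat multiset \<Rightarrow> int)" where
  "defining_poly l n \<alpha> = (\<Otimes>\<^bsub>mpoly_ring int_ring l\<^esub>i\<in>{..<n}. \<alpha> i)"

definition good_prime :: "nat \<Rightarrow> nat \<Rightarrow> (nat \<Rightarrow> nat multiset \<Rightarrow> int) \<Rightarrow> nat \<Rightarrow> bool" where
  "good_prime l n \<alpha> p \<longleftrightarrow>
    square_free (mpoly_ring (prime_field p) l) (reduce_poly p (defining_poly l n \<alpha>))"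

definition arrangement_mod ::
    "nat \<Rightarrow> nat \<Rightarrow> (nat \<Rightarrow> nat multiset \<Rightarrow> int) \<Rightarrow> nat \<Rightarrow> (nat \<Rightarrow> int) set set" where
  "arrangement_mod l n \<alpha> p =
    (\<lambda>i. hyperplane (prime_field p) l (reduce_poly p (\<alpha> i))) ` {..<n}"

end

theory Submission
  imports
    Defs
    "HOL-Library.Poly_Mapping"
    "HOL-Library.Multiset_Order"
    "Jordan_Normal_Form.Determinant"
begin

text \<open>
  By Saito's criterion, homogeneous logarithmic derivations \<open>\<delta>\<^sub>1, \<dots>, \<delta>\<^sub>l\<close> of degrees
  \<open>e\<^sub>1, \<dots>, e\<^sub>l\<close> form a basis iff their coefficient determinant is nonzero and \<open>\<Sum>\<^sub>i e\<^sub>i = n\<close>.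
  Hence only finitely many exponents and only degrees at most \<open>n\<close> matter.  A basis over \<open>\<rat>\<close>,
  cleared of denominators, stays a basis modulo every prime that does not divide its determinant.
  Conversely, logarithmic derivations of degree \<open>d\<close> are the solutions of an integer linear system,
  so for large \<open>p\<close> each solution modulo \<open>p\<close> lifts to an integral one; the determinant of lifted
  derivations is congruent to the original one, hence nonzero.

  Since \<open>\<F>\<^sub>p\<close> is not a type, computations take place in \<open>\<int>[x]\<close> modulo \<open>p\<close> and in \<open>\<rat>[x]\<close>
  modulo \<open>0\<close>, which makes the determinants of commutative rings available for both.
\<close>

section \<open>Congruences and prime elements modulo a fixed element\<close>

text \<open>The hard half of Saito's criterion is that the determinant of a basis divides
  \<open>Q\<close>, and not merely a power of \<open>Q\<close>. Writing the determinant as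
  \<open>Q * g\<close> and expressing \<open>Q\<close> times the coordinate derivations in the basis
  only shows that \<open>g\<close> divides \<open>Q ^ l\<close>. To see that no form divides
  \<open>g\<close>, the basis is tested, for each form, against a second family of derivations whose
  determinant contains this form just once. With divisibility in both directions, comparing degrees
  yields the condition on the exponents. Neither unique factorization nor fraction fields enter: it
  is enough that each form is prime modulo \<open>q\<close>, has a coefficient invertible modulo
  \<open>q\<close>, and divides no other form. This allows representatives in a larger ring to be
  compared by congruence. A second obstacle is that hyperplanes are sets of points. Over a finite
  field, too, equal zero sets must be shown to come from proportional forms, and distinct rational
  hyperplanes must stay distinct modulo large primes; both are read off 2 x 2 minors.\<close>

definition cong_mod :: "'r::comm_ring_1 \<Rightarrow> 'r \<Rightarrow> 'r \<Rightarrow> bool" where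
  "cong_mod q x y \<longleftrightarrow> q dvd x - y"

text \<open>Divisibility in the quotient ring by \<open>q\<close>, expressed on representatives; for
  \<open>q = 0\<close> it is ordinary divisibility.\<close>

definition dvd_mod :: "'r::comm_ring_1 \<Rightarrow> 'r \<Rightarrow> 'r \<Rightarrow> bool" where
  "dvd_mod q a b \<longleftrightarrow> (\<exists>h. cong_mod q b (a * h))"

lemma cong_mod_refl [simp]: "cong_mod q x x"
  by (simp add: cong_mod_def)

lemma cong_mod_sym: "cong_mod q x y \<Longrightarrow> cong_mod q y x"
  unfolding cong_mod_def by (metis dvd_minus_iff minus_diff_eq)

lemma cong_mod_trans [trans]: "cong_mod q x y \<Longrightarrow> cong_mod q y z \<Longrightarrow> cong_mod q x z"
  unfolding cong_mod_def by (metis dvd_add diff_add_cancel add_diff_eq)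

lemma cong_mod_add: "cong_mod q x y \<Longrightarrow> cong_mod q x' y' \<Longrightarrow> cong_mod q (x + x') (y + y')"
  unfolding cong_mod_def by (metis add_diff_add dvd_add)

lemma cong_mod_mult:
  assumes "cong_mod q x y" "cong_mod q x' y'"
  shows "cong_mod q (x * x') (y * y')"
proof -
  have "x * x' - y * y' = (x - y) * x' + y * (x' - y')" by (simp add: algebra_simps)
  with assms show ?thesis unfolding cong_mod_def by simp
qed

lemma cong_mod_sum: "(\<And>i. i \<in> I \<Longrightarrow> cong_mod q (f i) (g i)) \<Longrightarrow> cong_mod q (sum f I) (sum g I)"
  by (induction I rule: infinite_finite_induct) (auto intro: cong_mod_add)

lemma cong_mod_prod: "(\<And>i. i \<in> I \<Longrightarrow> cong_mod q (f i) (g i)) \<Longrightarrow> cong_mod q (prod f I) (prod g I)"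
  by (induction I rule: infinite_finite_induct) (auto intro: cong_mod_mult)

text \<open>By the Leibniz formula the determinant is a polynomial in the entries.\<close>

lemma cong_mod_det:
  assumes "\<And>i j. i < l \<Longrightarrow> j < l \<Longrightarrow> cong_mod q (f i j) (g i j)"
  shows "cong_mod q (det (mat l l (\<lambda>(i, j). f i j))) (det (mat l l (\<lambda>(i, j). g i j)))"
proof -
  have "f i (\<pi> i) = mat l l (\<lambda>(i, j). f i j) $$ (i, \<pi> i)" if "\<pi> permutes {0..<l}" "i < l" for f :: "nat \<Rightarrow> nat \<Rightarrow> 'a" and \<pi> i
    using that permutes_in_image[of \<pi> "{0..<l}" i] by auto
  then have *: "det (mat l l (\<lambda>(i, j). f i j)) =
      (\<Sum>\<pi> | \<pi> permutes {0..<l}. signof \<pi> * (\<Prod>i = 0..<l. f i (\<pi> i)))" for f :: "nat \<Rightarrow> nat \<Rightarrow> 'a"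
    unfolding det_def by (auto intro!: sum.cong prod.cong)
  show ?thesis
    unfolding * using assms
    by (auto intro!: cong_mod_sum cong_mod_mult cong_mod_prod simp: permutes_def)
qed

lemma cong_mod_imp_dvd_mod: "cong_mod q b (a * h) \<Longrightarrow> dvd_mod q a b"
  by (auto simp: dvd_mod_def)

lemma dvd_mod_cong: "cong_mod q b b' \<Longrightarrow> dvd_mod q a b \<Longrightarrow> dvd_mod q a b'"
  unfolding dvd_mod_def by (meson cong_mod_sym cong_mod_trans)

lemma dvd_mod_mult_left [simp]: "dvd_mod q a (a * b)"
  unfolding dvd_mod_def by (rule exI[of _ b]) simp

lemma dvd_mod_0 [simp]: "dvd_mod q a 0"
  unfolding dvd_mod_def by (rule exI[of _ 0]) simp

lemma dvd_mod_add: "dvd_mod q a b \<Longrightarrow> dvd_mod q a c \<Longrightarrow> dvd_mod q a (b + c)"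
  unfolding dvd_mod_def by (metis cong_mod_add distrib_left)

lemma dvd_mod_mult: "dvd_mod q a b \<Longrightarrow> dvd_mod q a (c * b)"
  unfolding dvd_mod_def by (metis cong_mod_mult cong_mod_refl mult.left_commute)

lemma dvd_mod_sum: "(\<And>i. i \<in> I \<Longrightarrow> dvd_mod q a (f i)) \<Longrightarrow> dvd_mod q a (sum f I)"
  by (induction I rule: infinite_finite_induct) (auto intro: dvd_mod_add)

definition prime_like :: "'r::comm_ring_1 \<Rightarrow> bool" where
  "prime_like q \<longleftrightarrow> \<not> q dvd 1 \<and> (\<forall>a b. q dvd a * b \<longrightarrow> q dvd a \<or> q dvd b)"

text \<open>The class of \<open>\<pi>\<close> is a prime element of the quotient ring by
  \<open>q\<close>: nonzero, no unit, and prime with respect to products.\<close>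

definition prime_mod :: "'r::comm_ring_1 \<Rightarrow> 'r \<Rightarrow> bool" where
  "prime_mod q \<pi> \<longleftrightarrow> \<not> q dvd \<pi> \<and> \<not> dvd_mod q \<pi> 1 \<and>
    (\<forall>a b. dvd_mod q \<pi> (a * b) \<longrightarrow> dvd_mod q \<pi> a \<or> dvd_mod q \<pi> b)"

lemma prime_modD:
  "prime_mod q \<pi> \<Longrightarrow> dvd_mod q \<pi> (a * b) \<Longrightarrow> dvd_mod q \<pi> a \<or> dvd_mod q \<pi> b"
  by (auto simp: prime_mod_def)

lemma prime_mod_prod:
  assumes "prime_mod q \<pi>" "dvd_mod q \<pi> (prod f I)" "finite I"
  shows "\<exists>i\<in>I. dvd_mod q \<pi> (f i)"
  using assms(3,2)
proof induction
  case empty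
  with assms(1) show ?case by (simp add: prime_mod_def)
next
  case (insert i I)
  with prime_modD[OF assms(1)] show ?case by auto
qed

lemma prime_mod_power:
  assumes "prime_mod q \<pi>" "dvd_mod q \<pi> (a ^ k)"
  shows "dvd_mod q \<pi> a"
  using assms prime_mod_prod[of q \<pi> "\<lambda>_. a" "{..<k}"] by auto

text \<open>The quotient ring by \<open>q\<close> is an integral domain.\<close>

lemma cong_mod_cancel:
  assumes "prime_like q" "\<not> q dvd a" "cong_mod q (a * x) (a * y)"
  shows "cong_mod q x y"
  using assms unfolding prime_like_def cong_mod_def right_diff_distrib[symmetric] by blast

lemma prime_like_prod:
  assumes "prime_like q" "\<And>i. i \<in> I \<Longrightarrow> \<not> q dvd f i"
  shows "\<not> q dvd prod f I"
  using assms(2)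
  by (induction I rule: infinite_finite_induct) (use assms(1) in \<open>auto simp: prime_like_def\<close>)

lemma prime_like_power:
  assumes "prime_like q" "\<not> q dvd a"
  shows "\<not> q dvd a ^ k"
  using prime_like_prod[OF assms(1), of "{..<k}" "\<lambda>_. a"] assms(2) by simp

text \<open>The primes are collected one at a time: a new \<open>\<alpha> i\<close> divides
  \<open>prod \<alpha> I * h\<close> but no factor of the product, hence it divides the cofactor
  \<open>h\<close>.\<close>

lemma prod_dvd_mod:
  assumes q: "prime_like q" and "finite I"
    and "\<And>i. i \<in> I \<Longrightarrow> prime_mod q (\<alpha> i)"
    and "\<And>i j. i \<in> I \<Longrightarrow> j \<in> I \<Longrightarrow> i \<noteq> j \<Longrightarrow> \<not> dvd_mod q (\<alpha> i) (\<alpha> j)"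
    and "\<And>i. i \<in> I \<Longrightarrow> dvd_mod q (\<alpha> i) F"
  shows "dvd_mod q (prod \<alpha> I) F"
  using assms(2-)
proof induction
  case empty
  then show ?case using dvd_mod_mult_left[of q 1 F] by simp
next
  case (insert i I)
  then obtain h where h: "cong_mod q F (prod \<alpha> I * h)" by (auto simp: dvd_mod_def)
  have "dvd_mod q (\<alpha> i) (prod \<alpha> I * h)"
    using dvd_mod_cong[OF h] insert.prems(3)[of i] by simp
  moreover have "\<not> dvd_mod q (\<alpha> i) (prod \<alpha> I)"
    using prime_mod_prod[of q "\<alpha> i" \<alpha> I] insert by (metis insert_iff)
  ultimately have "dvd_mod q (\<alpha> i) h"
    using prime_modD insert.prems(1) by blast
  then obtain h' where "cong_mod q h (\<alpha> i * h')" by (auto simp: dvd_mod_def)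
  then have "cong_mod q F (prod \<alpha> I * (\<alpha> i * h'))"
    using h cong_mod_mult cong_mod_refl cong_mod_trans by blast
  then show ?case
    using insert.hyps by (auto simp: dvd_mod_def mult_ac)
qed

text \<open>If \<open>\<alpha> i * (prod \<alpha> I * R)\<close> is \<open>g * h\<close>, the prime
  \<open>\<alpha> i\<close> must divide \<open>h\<close> because it does not divide
  \<open>g\<close>; it is then cancelled on both sides.\<close>

lemma coprime_prod_cancel:
  assumes q: "prime_like q" and "finite I"
    and "\<And>i. i \<in> I \<Longrightarrow> prime_mod q (\<alpha> i)"
    and "\<And>i. i \<in> I \<Longrightarrow> \<not> dvd_mod q (\<alpha> i) g"
    and "dvd_mod q g (prod \<alpha> I * R)"
  shows "dvd_mod q g R"
  using assms(2-)
proof induction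
  case (insert i I)
  then obtain h where h: "cong_mod q (\<alpha> i * (prod \<alpha> I * R)) (g * h)"
    by (auto simp: dvd_mod_def mult_ac)
  then have "dvd_mod q (\<alpha> i) (g * h)"
    using dvd_mod_cong dvd_mod_mult_left by blast
  then have "dvd_mod q (\<alpha> i) h"
    using insert.prems prime_modD by blast
  then obtain h' where "cong_mod q h (\<alpha> i * h')" by (auto simp: dvd_mod_def)
  then have "cong_mod q (\<alpha> i * (prod \<alpha> I * R)) (\<alpha> i * (g * h'))"
    using h cong_mod_mult[of q g g h "\<alpha> i * h'"] cong_mod_trans by (fastforce simp: mult_ac)
  then have "cong_mod q (prod \<alpha> I * R) (g * h')"
    using cong_mod_cancel[OF q] insert.prems(1) by (auto simp: prime_mod_def)
  then show ?case
    using insert by (auto intro: cong_mod_imp_dvd_mod)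
qed simp

lemma coprime_prod_power_cancel:
  assumes "prime_like q" "finite I"
    and "\<And>i. i \<in> I \<Longrightarrow> prime_mod q (\<alpha> i)"
    and "\<And>i. i \<in> I \<Longrightarrow> \<not> dvd_mod q (\<alpha> i) g"
    and "dvd_mod q g (prod \<alpha> I ^ k)"
  shows "dvd_mod q g 1"
  using assms(5)
proof (induction k)
  case (Suc k)
  then show ?case using coprime_prod_cancel[OF assms(1-4), where R = "prod \<alpha> I ^ k"] by simp
qed simp

text \<open>If \<open>\<alpha> i\<close> divided \<open>g\<close>, it would occur twice in the
  product; cancelling it once, it would divide the product of the other primes. So no
  \<open>\<alpha> i\<close> divides \<open>g\<close>, and a divisor of the product without any of
  these factors is a unit.\<close>

lemma square_free_prod_mod:
  assumes q: "prime_like q" and "finite I"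
    and "\<And>i. i \<in> I \<Longrightarrow> prime_mod q (\<alpha> i)"
    and nd: "\<And>i j. i \<in> I \<Longrightarrow> j \<in> I \<Longrightarrow> i \<noteq> j \<Longrightarrow> \<not> dvd_mod q (\<alpha> i) (\<alpha> j)"
    and h: "cong_mod q (prod \<alpha> I) (g * g * h)"
  shows "dvd_mod q g 1"
proof (rule coprime_prod_cancel[OF assms(1-3), where g = g])
  show "dvd_mod q g (prod \<alpha> I * 1)"
    using h by (auto simp: dvd_mod_def mult.assoc)
next
  fix i assume i: "i \<in> I"
  show "\<not> dvd_mod q (\<alpha> i) g"
  proof
    assume "dvd_mod q (\<alpha> i) g"
    then obtain g' where g': "cong_mod q g (\<alpha> i * g')" by (auto simp: dvd_mod_def)
    have "cong_mod q (\<alpha> i * prod \<alpha> (I - {i})) (g * g * h)"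
      using h i \<open>finite I\<close> by (simp add: prod.remove)
    also have "cong_mod q (g * g * h) (\<alpha> i * g' * (\<alpha> i * g') * h)"
      using g' by (intro cong_mod_mult) auto
    finally have "cong_mod q (\<alpha> i * prod \<alpha> (I - {i})) (\<alpha> i * (\<alpha> i * (g' * g' * h)))"
      by (simp add: mult_ac)
    then have "cong_mod q (prod \<alpha> (I - {i})) (\<alpha> i * (g' * g' * h))"
      using cong_mod_cancel[OF q] assms(3)[OF i] by (auto simp: prime_mod_def)
    then have "dvd_mod q (\<alpha> i) (prod \<alpha> (I - {i}))"
      by (rule cong_mod_imp_dvd_mod)
    then show False
      using prime_mod_prod[OF assms(3)[OF i]] \<open>finite I\<close> nd i by blast
  qed
qed

section \<open>Determinants and Saito's criterion\<close>

definition det_of :: "nat \<Rightarrow> (nat \<Rightarrow> nat \<Rightarrow> 'r::comm_ring_1) \<Rightarrow> 'r" where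
  "det_of l \<delta> = det (mat l l (\<lambda>(i, j). \<delta> i j))"

lemma det_of_cong: "(\<And>i j. i < l \<Longrightarrow> j < l \<Longrightarrow> \<delta> i j = \<epsilon> i j) \<Longrightarrow> det_of l \<delta> = det_of l \<epsilon>"
  unfolding det_of_def by (intro arg_cong[where f = det] eq_matI) auto

definition adj_of :: "nat \<Rightarrow> (nat \<Rightarrow> nat \<Rightarrow> 'r::comm_ring_1) \<Rightarrow> nat \<Rightarrow> nat \<Rightarrow> 'r" where
  "adj_of l \<delta> i j = adj_mat (mat l l (\<lambda>(i, j). \<delta> i j)) $$ (i, j)"

lemma
  shows mult_adj_of: "\<And>i k. i < l \<Longrightarrow> k < l \<Longrightarrow>
      (\<Sum>j<l. \<delta> i j * adj_of l \<delta> j k) = (if i = k then det_of l \<delta> else 0)"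
    and adj_of_mult: "\<And>i k. i < l \<Longrightarrow> k < l \<Longrightarrow>
      (\<Sum>j<l. adj_of l \<delta> i j * \<delta> j k) = (if i = k then det_of l \<delta> else 0)"
    and det_of_replace_row: "\<And>\<eta> i. i < l \<Longrightarrow>
      det_of l (\<delta>(i := \<eta>)) = (\<Sum>j<l. \<eta> j * adj_of l \<delta> j i)"
proof -
  let ?M = "mat l l (\<lambda>(i, j). \<delta> i j)"
  let ?B = "\<lambda>i j. adj_mat ?M $$ (i, j)"
  have M: "?M \<in> carrier_mat l l" by simp
  note A = adj_mat[OF M]
  have 1: "(\<Sum>j<l. \<delta> i j * ?B j k) = (if i = k then det_of l \<delta> else 0)" if "i < l" "k < l" for i k
  proof -
    have "(\<Sum>j<l. \<delta> i j * ?B j k) = (?M * adj_mat ?M) $$ (i, k)"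
      using that A(1) by (auto simp: scalar_prod_def lessThan_atLeast0 intro!: sum.cong)
    then show ?thesis using that by (simp add: A(2) det_of_def)
  qed
  have 2: "(\<Sum>j<l. ?B i j * \<delta> j k) = (if i = k then det_of l \<delta> else 0)" if "i < l" "k < l" for i k
  proof -
    have "(\<Sum>j<l. ?B i j * \<delta> j k) = (adj_mat ?M * ?M) $$ (i, k)"
      using that A(1) by (auto simp: scalar_prod_def lessThan_atLeast0 intro!: sum.cong)
    then show ?thesis using that by (simp add: A(3) det_of_def)
  qed
  have 3: "det_of l (\<delta>(i := \<eta>)) = (\<Sum>j<l. \<eta> j * ?B j i)" if "i < l" for \<eta> i
  proof -
    let ?N = "mat l l (\<lambda>(r, j). (\<delta>(i := \<eta>)) r j)"
    have "det ?N = (\<Sum>j<l. ?N $$ (i, j) * cofactor ?N i j)"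
      using that by (intro laplace_expansion_row) auto
    also have "\<dots> = (\<Sum>j<l. \<eta> j * ?B j i)"
    proof (intro sum.cong refl arg_cong2[where f = "(*)"])
      fix j assume "j \<in> {..<l}"
      \<comment> \<open>The matrices differ only in row \<open>i\<close>, which the minors of the
        expansion along row \<open>i\<close> omit.\<close>
      then have "mat_delete ?N i j = mat_delete ?M i j"
        using that by (intro eq_matI) (auto simp: mat_delete_def)
      then show "cofactor ?N i j = ?B j i"
        using that \<open>j \<in> {..<l}\<close> by (simp add: cofactor_def adj_mat_def)
    qed (use that in auto)
    finally show ?thesis by (simp add: det_of_def)
  qed
  show "\<And>i k. i < l \<Longrightarrow> k < l \<Longrightarrow>
      (\<Sum>j<l. \<delta> i j * adj_of l \<delta> j k) = (if i = k then det_of l \<delta> else 0)"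
    and "\<And>i k. i < l \<Longrightarrow> k < l \<Longrightarrow>
      (\<Sum>j<l. adj_of l \<delta> i j * \<delta> j k) = (if i = k then det_of l \<delta> else 0)"
    and "\<And>\<eta> i. i < l \<Longrightarrow>
      det_of l (\<delta>(i := \<eta>)) = (\<Sum>j<l. \<eta> j * adj_of l \<delta> j i)"
    unfolding adj_of_def by (fact 1 2 3)+
qed

text \<open>Cramer's rule without division: up to the factor \<open>det_of l \<delta>\<close>, the
  tuple \<open>\<eta>\<close> is a combination of the rows whose coefficients are the determinants
  with one row replaced by \<open>\<eta>\<close>.\<close>

lemma cramer_rows:
  assumes "k < l"
  shows "(\<Sum>i<l. det_of l (\<delta>(i := \<eta>)) * \<delta> i k) = det_of l \<delta> * \<eta> k"
proof -
  have "(\<Sum>i<l. det_of l (\<delta>(i := \<eta>)) * \<delta> i k) = (\<Sum>i<l. \<Sum>j<l. \<eta> j * (adj_of l \<delta> j i * \<delta> i k))"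
    by (simp add: det_of_replace_row sum_distrib_right mult.assoc)
  also have "\<dots> = (\<Sum>j<l. \<eta> j * (\<Sum>i<l. adj_of l \<delta> j i * \<delta> i k))"
    by (subst sum.swap) (simp add: sum_distrib_left)
  also have "\<dots> = (\<Sum>j<l. if j = k then \<eta> j * det_of l \<delta> else 0)"
    using assms by (intro sum.cong) (auto simp: adj_of_mult)
  finally show ?thesis using assms by (simp add: mult.commute)
qed

lemma det_of_mult:
  "det_of l (\<lambda>i j. \<Sum>k<l. c i k * \<delta> k j) = det_of l c * det_of l \<delta>"
proof -
  let ?C = "mat l l (\<lambda>(i, j). c i j)" and ?D = "mat l l (\<lambda>(i, j). \<delta> i j)"
  have "det_of l (\<lambda>i j. \<Sum>k<l. c i k * \<delta> k j) = det (?C * ?D)"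
    unfolding det_of_def
    by (intro arg_cong[where f = det] eq_matI)
       (auto simp: scalar_prod_def lessThan_atLeast0 intro!: sum.cong)
  then show ?thesis
    by (simp add: det_of_def det_mult[of ?C l ?D])
qed

lemma det_of_diag: "det_of l (\<lambda>i j. if i = j then d i else 0) = (\<Prod>i<l. d i)"
proof -
  let ?M = "mat l l (\<lambda>(i, j). if i = j then d i else 0)"
  have "det ?M = prod_list (diag_mat ?M)"
    by (rule det_upper_triangular[of _ l]) auto
  also have "\<dots> = prod_list (map d [0..<l])"
    by (auto simp: diag_mat_def intro!: arg_cong[where f = prod_list])
  also have "\<dots> = (\<Prod>i<l. d i)"
    by (simp add: prod.distinct_set_conv_list[symmetric] lessThan_atLeast0)
  finally show ?thesis by (simp add: det_of_def)
qed

lemma det_of_scale: "det_of l (\<lambda>i j. s * \<delta> i j) = s ^ l * det_of l \<delta>"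
proof -
  have "det_of l (\<lambda>i j. s * \<delta> i j) = det (s \<cdot>\<^sub>m mat l l (\<lambda>(i, j). \<delta> i j))"
    unfolding det_of_def by (intro arg_cong[where f = det] eq_matI) auto
  then show ?thesis by (simp add: det_of_def)
qed

lemma cong_mod_det_of:
  assumes "\<And>i j. i < l \<Longrightarrow> j < l \<Longrightarrow> cong_mod q (f i j) (g i j)"
  shows "cong_mod q (det_of l f) (det_of l g)"
  unfolding det_of_def using assms by (rule cong_mod_det)

text \<open>
  \<open>\<Sum>\<^sub>j a i j x j\<close> plays the role of the linear form \<open>\<alpha>\<^sub>i\<close>; everything is taken modulo \<open>q\<close>, so that
  \<open>q = 0\<close> and \<open>q = p\<close> are treated together.
\<close>

locale linear_forms_mod =
  fixes q :: "'r::comm_ring_1" and l n :: nat and a :: "nat \<Rightarrow> nat \<Rightarrow> 'r" and x :: "nat \<Rightarrow> 'r"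
    and \<alpha> :: "nat \<Rightarrow> 'r" and Q :: 'r
  assumes \<alpha>_def: "\<alpha> i = (\<Sum>j<l. a i j * x j)"
    and Q_def: "Q = (\<Prod>i<n. \<alpha> i)"
    and prime_like: "prime_like q"
    and prime: "i < n \<Longrightarrow> prime_mod q (\<alpha> i)"
    and non_assoc: "i < n \<Longrightarrow> j < n \<Longrightarrow> i \<noteq> j \<Longrightarrow> \<not> dvd_mod q (\<alpha> i) (\<alpha> j)"
    and pivot: "i < n \<Longrightarrow> \<exists>k<l. \<exists>u. cong_mod q (a i k * u) 1"
begin

text \<open>The sum is the derivation \<open>\<delta>\<close> applied to \<open>\<alpha> i\<close>,
  since the partial derivatives of a linear form are its coefficients.\<close>

definition logarithmic :: "(nat \<Rightarrow> 'r) \<Rightarrow> bool" where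
  "logarithmic \<delta> \<longleftrightarrow> (\<forall>i<n. dvd_mod q (\<alpha> i) (\<Sum>j<l. a i j * \<delta> j))"

lemma Q_not_dvd: "\<not> q dvd Q"
  unfolding Q_def using prime by (intro prime_like_prod[OF prime_like]) (auto simp: prime_mod_def)

text \<open>The matrix \<open>\<delta>\<close> sends the coefficient vector of
  \<open>\<alpha> i\<close> to a vector with all entries divisible by \<open>\<alpha> i\<close>.
  Applying the adjugate shows that \<open>\<alpha> i\<close> divides
  \<open>a i k * det_of l \<delta>\<close> for each \<open>k\<close>, and for the pivot
  \<open>k\<close> the factor \<open>a i k\<close> is a unit.\<close>

lemma dvd_det_of_logarithmic:
  assumes "\<And>i. i < l \<Longrightarrow> logarithmic (\<delta> i)"
  shows "dvd_mod q Q (det_of l \<delta>)"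
  unfolding Q_def
proof (rule prod_dvd_mod[OF prime_like])
  fix i assume i: "i \<in> {..<n}"
  then obtain k u where k: "k < l" and u: "cong_mod q (a i k * u) 1" using pivot[of i] by auto
  have "(\<Sum>r<l. adj_of l \<delta> k r * (\<Sum>j<l. a i j * \<delta> r j)) = (\<Sum>j<l. a i j * (\<Sum>r<l. adj_of l \<delta> k r * \<delta> r j))"
    unfolding sum_distrib_left by (subst sum.swap) (simp add: mult_ac)
  also have "\<dots> = (\<Sum>j<l. if k = j then a i j * det_of l \<delta> else 0)"
    using k by (intro sum.cong) (auto simp: adj_of_mult)
  also have "\<dots> = a i k * det_of l \<delta>" using k by simp
  finally have "a i k * det_of l \<delta> = (\<Sum>r<l. adj_of l \<delta> k r * (\<Sum>j<l. a i j * \<delta> r j))" ..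
  moreover have "dvd_mod q (\<alpha> i) \<dots>"
    using assms i by (intro dvd_mod_sum, intro dvd_mod_mult) (auto simp: logarithmic_def)
  ultimately have "dvd_mod q (\<alpha> i) (a i k * det_of l \<delta>)" by simp
  then have "dvd_mod q (\<alpha> i) (u * (a i k * det_of l \<delta>))" by (rule dvd_mod_mult)
  moreover have "cong_mod q (u * (a i k * det_of l \<delta>)) (det_of l \<delta>)"
    using cong_mod_mult[OF u cong_mod_refl[of q "det_of l \<delta>"]] by (simp add: mult_ac)
  ultimately show "dvd_mod q (\<alpha> i) (det_of l \<delta>)" using dvd_mod_cong by blast
qed (use prime non_assoc in auto)

text \<open>Multiplication by the adjugate turns each side into the determinant times the
  \<open>k\<close>-th coefficient, and the nonzero determinant cancels.\<close>

lemma coefficients_unique: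
  assumes "\<not> q dvd det_of l \<delta>"
    and "\<And>j. j < l \<Longrightarrow> cong_mod q (\<Sum>i<l. f i * \<delta> i j) (\<Sum>i<l. g i * \<delta> i j)" and "k < l"
  shows "cong_mod q (f k) (g k)"
proof -
  have *: "(\<Sum>j<l. (\<Sum>i<l. f i * \<delta> i j) * adj_of l \<delta> j k) = det_of l \<delta> * f k" for f
  proof -
    have "(\<Sum>j<l. (\<Sum>i<l. f i * \<delta> i j) * adj_of l \<delta> j k) = (\<Sum>i<l. f i * (\<Sum>j<l. \<delta> i j * adj_of l \<delta> j k))"
      unfolding sum_distrib_left sum_distrib_right by (subst sum.swap) (simp add: mult_ac)
    also have "\<dots> = (\<Sum>i<l. if i = k then f i * det_of l \<delta> else 0)"
      using assms(3) by (intro sum.cong) (auto simp: mult_adj_of)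
    finally show ?thesis using assms(3) by (simp add: mult.commute)
  qed
  have "cong_mod q (det_of l \<delta> * f k) (det_of l \<delta> * g k)"
    unfolding *[symmetric] using assms(2)
    by (intro cong_mod_sum, intro cong_mod_mult[OF _ cong_mod_refl]) auto
  then show ?thesis using cong_mod_cancel[OF prime_like assms(1)] by blast
qed

text \<open>In Cramer's rule every determinant with a replaced row is again one of logarithmic
  tuples, hence a multiple of \<open>Q\<close>; so is \<open>det_of l \<delta>\<close>, with the
  unit \<open>c\<close> as cofactor. Cancelling \<open>Q\<close> and multiplying by \<open>u\<close>
  leaves the desired combination.\<close>

theorem saito_sufficient:
  assumes "\<And>i. i < l \<Longrightarrow> logarithmic (\<delta> i)" and "logarithmic \<eta>"
    and c: "cong_mod q (det_of l \<delta>) (Q * c)" and u: "cong_mod q (c * u) 1"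
  obtains f where "\<And>j. j < l \<Longrightarrow> cong_mod q (\<eta> j) (\<Sum>i<l. f i * \<delta> i j)"
proof -
  have "dvd_mod q Q (det_of l (\<delta>(i := \<eta>)))" for i
    using assms by (intro dvd_det_of_logarithmic) auto
  then obtain f where f: "\<And>i. cong_mod q (det_of l (\<delta>(i := \<eta>))) (Q * f i)"
    unfolding dvd_mod_def by metis
  show thesis
  proof (rule that[of "\<lambda>i. u * f i"])
    fix j assume j: "j < l"
    have "cong_mod q (Q * c * \<eta> j) (det_of l \<delta> * \<eta> j)"
      using c by (intro cong_mod_mult) (auto intro: cong_mod_sym)
    also have "det_of l \<delta> * \<eta> j = (\<Sum>i<l. det_of l (\<delta>(i := \<eta>)) * \<delta> i j)"
      using j by (simp add: cramer_rows)
    also have "cong_mod q \<dots> (\<Sum>i<l. Q * f i * \<delta> i j)"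
      using f by (intro cong_mod_sum cong_mod_mult) auto
    also have "\<dots> = Q * (\<Sum>i<l. f i * \<delta> i j)"
      by (simp add: sum_distrib_left mult_ac)
    finally have "cong_mod q (c * \<eta> j) (\<Sum>i<l. f i * \<delta> i j)"
      using cong_mod_cancel[OF prime_like Q_not_dvd] by (simp add: mult.assoc)
    then have "cong_mod q (u * (c * \<eta> j)) (u * (\<Sum>i<l. f i * \<delta> i j))"
      by (intro cong_mod_mult) auto
    moreover have "cong_mod q (\<eta> j) (u * (c * \<eta> j))"
      using cong_mod_mult[OF cong_mod_sym[OF u] cong_mod_refl[of q "\<eta> j"]] by (simp add: mult_ac)
    ultimately show "cong_mod q (\<eta> j) (\<Sum>i<l. u * f i * \<delta> i j)"
      using cong_mod_trans by (fastforce simp: sum_distrib_left mult_ac)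
  qed
qed

text \<open>\<open>T\<close> is a subring containing the coefficients and variables of the forms. It
  stands for the polynomials in the given \<open>l\<close> variables: only derivations with such
  entries are known to be combinations of the basis, so all test derivations have to stay in
  \<open>T\<close>.\<close>

theorem saito_necessary:
  assumes "\<And>i. i < l \<Longrightarrow> logarithmic (\<delta> i)"
    and T: "1 \<in> T" "\<And>y z. y \<in> T \<Longrightarrow> z \<in> T \<Longrightarrow> y + z \<in> T" "\<And>y z. y \<in> T \<Longrightarrow> z \<in> T \<Longrightarrow> y * z \<in> T"
      "\<And>y. y \<in> T \<Longrightarrow> - y \<in> T" "\<And>i j. i < n \<Longrightarrow> j < l \<Longrightarrow> a i j \<in> T" "\<And>j. j < l \<Longrightarrow> x j \<in> T"
    and gen: "\<And>\<eta>. logarithmic \<eta> \<Longrightarrow> (\<And>j. j < l \<Longrightarrow> \<eta> j \<in> T) \<Longrightarrow>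
      \<exists>f. \<forall>j<l. cong_mod q (\<eta> j) (\<Sum>i<l. f i * \<delta> i j)"
  shows "\<not> q dvd det_of l \<delta> \<and> dvd_mod q (det_of l \<delta>) Q"
proof -
  have T0: "0 \<in> T" using T(2)[OF T(1) T(4)[OF T(1)]] by simp
  have T_sum: "sum f I \<in> T" if "\<And>i. i \<in> I \<Longrightarrow> f i \<in> T" for f :: "nat \<Rightarrow> 'r" and I
    using that by (induction I rule: infinite_finite_induct) (auto intro: T T0)
  have T_prod: "prod f I \<in> T" if "\<And>i. i \<in> I \<Longrightarrow> f i \<in> T" for f :: "nat \<Rightarrow> 'r" and I
    using that by (induction I rule: infinite_finite_induct) (auto intro: T T0)
  have T_\<alpha>: "\<alpha> i \<in> T" if "i < n" for i
    unfolding \<alpha>_def using that by (auto intro!: T_sum T)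
  have T_Q: "Q \<in> T"
    unfolding Q_def by (auto intro!: T_prod T_\<alpha>)
  \<comment> \<open>Expressing \<open>l\<close> test derivations by the rows of
    \<open>\<delta>\<close> is a matrix product, so the determinant of the test matrix is a multiple
    of \<open>det_of l \<delta>\<close>.\<close>
  have gen_matrix: "\<exists>C. cong_mod q (det_of l \<theta>) (C * det_of l \<delta>)"
    if "\<And>r. r < l \<Longrightarrow> logarithmic (\<theta> r)" "\<And>r j. r < l \<Longrightarrow> j < l \<Longrightarrow> \<theta> r j \<in> T" for \<theta>
  proof -
    have "\<forall>r. \<exists>f. r < l \<longrightarrow> (\<forall>j<l. cong_mod q (\<theta> r j) (\<Sum>i<l. f i * \<delta> i j))"
      using gen that by metis
    then obtain C where C: "\<And>r j. r < l \<Longrightarrow> j < l \<Longrightarrow> cong_mod q (\<theta> r j) (\<Sum>i<l. C r i * \<delta> i j)"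
      by metis
    have "cong_mod q (det_of l \<theta>) (det_of l (\<lambda>r j. \<Sum>i<l. C r i * \<delta> i j))"
      using C by (rule cong_mod_det_of)
    then show ?thesis unfolding det_of_mult by blast
  qed
  have log_Q: "logarithmic (\<lambda>j. Q * \<eta> j)" for \<eta>
    unfolding logarithmic_def
  proof (intro allI impI)
    fix i assume "i < n"
    then have "(\<Sum>j<l. a i j * (Q * \<eta> j)) = \<alpha> i * ((\<Prod>i\<in>{..<n}-{i}. \<alpha> i) * (\<Sum>j<l. a i j * \<eta> j))"
      by (simp add: Q_def prod.remove[of "{..<n}" i] sum_distrib_left mult_ac)
    then show "dvd_mod q (\<alpha> i) (\<Sum>j<l. a i j * (Q * \<eta> j))" by simp
  qed
  \<comment> \<open>First test: \<open>Q\<close> times the coordinate derivations, with determinant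
    \<open>Q ^ l\<close>.\<close>
  have "\<exists>C. cong_mod q (det_of l (\<lambda>r j. Q * (if r = j then 1 else 0))) (C * det_of l \<delta>)"
    by (rule gen_matrix) (auto intro!: log_Q T T0 T_Q)
  then obtain C where C: "cong_mod q (Q ^ l) (C * det_of l \<delta>)"
    by (auto simp: det_of_scale det_of_diag)
  have nz: "\<not> q dvd det_of l \<delta>"
    using C prime_like_power[OF prime_like Q_not_dvd, of l]
    unfolding cong_mod_def by (metis dvd_diff_right_iff dvd_mult dvd_minus_iff diff_add_cancel dvd_add)
  obtain g where g: "cong_mod q (det_of l \<delta>) (Q * g)"
    using dvd_det_of_logarithmic[of \<delta>] assms(1) by (auto simp: dvd_mod_def)
  \<comment> \<open>If \<open>\<alpha> i\<close> divided \<open>g\<close>, it would occur twice in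
    \<open>det_of l \<delta>\<close> and thus in every test determinant. The rows
    \<open>Q' * \<theta> r\<close> constructed here have a determinant in which it occurs only
    once.\<close>
  have not_dvd: "\<not> dvd_mod q (\<alpha> i) g" if i: "i < n" for i
  proof
    assume dvd: "dvd_mod q (\<alpha> i) g"
    define Q' where "Q' = prod \<alpha> ({..<n} - {i})"
    have Q: "Q = \<alpha> i * Q'" using i by (simp add: Q_def Q'_def prod.remove[of "{..<n}" i])
    obtain k u where k: "k < l" and u: "cong_mod q (a i k * u) 1" using pivot[OF i] by blast
    \<comment> \<open>\<open>Q' \<theta>\<^sub>k\<close> is a multiple of \<open>Q\<close>, and the other \<open>\<theta>\<^sub>r\<close> kill \<open>\<alpha>\<^sub>i\<close>.\<close>
    define \<theta> where "\<theta> r j = (if r = k then if j = k then \<alpha> i else 0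
      else if j = r then a i k else if j = k then - a i r else 0)" for r j
    \<comment> \<open>Column \<open>k\<close> of \<open>N\<close> is the coefficient vector of
      \<open>\<alpha> i\<close>, the other columns are unit vectors. This makes the product of
      \<open>\<theta>\<close> and \<open>N\<close> diagonal, so that
      \<open>det_of l \<theta>\<close> need not be expanded.\<close>
    define N where "N j c = (if c = k then a i j else if j = c then 1 else 0)" for j c
    have log: "logarithmic (\<lambda>j. Q' * \<theta> r j)" if r: "r < l" for r
    proof (cases "r = k")
      case True
      then have "(\<lambda>j. Q' * \<theta> r j) = (\<lambda>j. Q * (if j = k then 1 else 0))"
        by (auto simp: \<theta>_def Q mult_ac)
      then show ?thesis using log_Q by simp
    next
      case False
      have kill: "(\<Sum>j<l. a i j * \<theta> r j) = 0"
      proof -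
        have "(\<Sum>j<l. a i j * \<theta> r j) = (\<Sum>j\<in>{r, k}. a i j * \<theta> r j)"
          using r k False by (intro sum.mono_neutral_right) (auto simp: \<theta>_def)
        then show ?thesis using False by (simp add: \<theta>_def mult.commute)
      qed
      show ?thesis unfolding logarithmic_def
      proof (intro allI impI)
        fix i' assume i': "i' < n"
        show "dvd_mod q (\<alpha> i') (\<Sum>j<l. a i' j * (Q' * \<theta> r j))"
        proof (cases "i' = i")
          case True
          have "(\<Sum>j<l. a i j * (Q' * \<theta> r j)) = Q' * (\<Sum>j<l. a i j * \<theta> r j)"
            by (simp add: sum_distrib_left mult_ac)
          then show ?thesis using True kill by simp
        next
          case False
          then have "Q' = \<alpha> i' * prod \<alpha> ({..<n} - {i} - {i'})"
            unfolding Q'_def using i' by (subst prod.remove[of _ i']) auto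
          then have "(\<Sum>j<l. a i' j * (Q' * \<theta> r j)) =
              \<alpha> i' * (prod \<alpha> ({..<n} - {i} - {i'}) * (\<Sum>j<l. a i' j * \<theta> r j))"
            by (simp add: sum_distrib_left sum_distrib_right mult_ac)
          then show ?thesis by simp
        qed
      qed
    qed
    have "\<exists>C. cong_mod q (det_of l (\<lambda>r j. Q' * \<theta> r j)) (C * det_of l \<delta>)"
      by (rule gen_matrix) (use log i k in \<open>auto simp: Q'_def \<theta>_def intro!: T T0 T_prod T_\<alpha>\<close>)
    then obtain C' where C': "cong_mod q (Q' ^ l * det_of l \<theta>) (C' * det_of l \<delta>)"
      by (auto simp: det_of_scale)
    have "det_of l \<theta> * det_of l N = det_of l (\<lambda>r c. \<Sum>j<l. \<theta> r j * N j c)"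
      by (rule det_of_mult[symmetric])
    also have "\<dots> = det_of l (\<lambda>r c. if r = c then if r = k then \<alpha> i * a i k else a i k else 0)"
    proof (rule det_of_cong)
      fix r c assume rc: "r < l" "c < l"
      have "(\<Sum>j<l. \<theta> r j * N j c) = (\<Sum>j\<in>{r, k}. \<theta> r j * N j c)"
        using rc k by (intro sum.mono_neutral_right) (auto simp: \<theta>_def)
      then show "(\<Sum>j<l. \<theta> r j * N j c) = (if r = c then if r = k then \<alpha> i * a i k else a i k else 0)"
        by (cases "r = k") (auto simp: \<theta>_def N_def mult.commute)
    qed
    also have "\<dots> = (\<alpha> i * a i k) * a i k ^ (l - 1)"
      using k by (simp add: det_of_diag prod.remove[of "{..<l}" k] card_Diff_singleton)
    finally have det_\<theta>: "det_of l \<theta> * det_of l N = \<alpha> i * (a i k * a i k ^ (l - 1))"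
      by (simp add: mult_ac)
    have "cong_mod q (Q' ^ l * det_of l \<theta> * det_of l N) (C' * (\<alpha> i * Q' * g) * det_of l N)"
    proof (rule cong_mod_mult[OF _ cong_mod_refl], rule cong_mod_trans[OF C'])
      show "cong_mod q (C' * det_of l \<delta>) (C' * (\<alpha> i * Q' * g))"
        using g unfolding Q by (intro cong_mod_mult) auto
    qed
    then have "cong_mod q (\<alpha> i * (a i k ^ l * Q' ^ l)) (\<alpha> i * (C' * Q' * det_of l N * g))"
      using k by (simp add: mult.assoc det_\<theta> power_eq_if[of _ l]) (simp add: mult_ac)
    \<comment> \<open>The single \<open>\<alpha> i\<close> is now cancelled. The remaining factor
      \<open>g\<close> would make \<open>\<alpha> i\<close> divide
      \<open>a i k ^ l * Q' ^ l\<close>, although \<open>a i k\<close> is a unit modulo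
      \<open>q\<close> and \<open>Q'\<close> is the product of the other forms.\<close>
    then have "cong_mod q (C' * Q' * det_of l N * g) (a i k ^ l * Q' ^ l)"
      using cong_mod_cancel[OF prime_like] prime[OF i] cong_mod_sym unfolding prime_mod_def by blast
    then have "dvd_mod q (\<alpha> i) (a i k ^ l * Q' ^ l)"
      using dvd dvd_mod_mult dvd_mod_cong by blast
    then have "dvd_mod q (\<alpha> i) (a i k) \<or> dvd_mod q (\<alpha> i) Q'"
      using prime_modD[OF prime[OF i]] prime_mod_power[OF prime[OF i]] by blast
    moreover have "\<not> dvd_mod q (\<alpha> i) Q'"
      using prime_mod_prod[OF prime[OF i]] non_assoc i unfolding Q'_def by blast
    moreover have "\<not> dvd_mod q (\<alpha> i) (a i k)"
      using dvd_mod_mult[of q "\<alpha> i" "a i k" u] u dvd_mod_cong prime[OF i]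
      unfolding prime_mod_def by (metis mult.commute)
    ultimately show False by blast
  qed
  \<comment> \<open>As a factor of the determinant, \<open>g\<close> divides \<open>Q ^ l\<close>;
    having none of the forms as a factor, it is a unit, and \<open>Q\<close> becomes a multiple of
    the determinant.\<close>
  have "cong_mod q (C * det_of l \<delta>) (C * (Q * g))"
    using g by (intro cong_mod_mult) auto
  with C have "dvd_mod q g (prod \<alpha> {..<n} ^ l)"
    unfolding dvd_mod_def Q_def using cong_mod_trans by (metis mult.commute mult.left_commute)
  then have "dvd_mod q g 1"
    using coprime_prod_power_cancel[OF prime_like, of "{..<n}" \<alpha> g l] prime not_dvd by auto
  then obtain h where "cong_mod q 1 (g * h)" by (auto simp: dvd_mod_def)
  then have "cong_mod q (Q * 1) (Q * (g * h))" by (intro cong_mod_mult) auto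
  moreover have "cong_mod q (Q * g * h) (det_of l \<delta> * h)"
    using cong_mod_sym[OF g] by (intro cong_mod_mult) auto
  ultimately have "cong_mod q Q (det_of l \<delta> * h)"
    using cong_mod_trans by (fastforce simp: mult.assoc)
  with nz show ?thesis by (auto simp: dvd_mod_def)
qed

end

section \<open>Polynomials modulo a coefficient\<close>

type_synonym 'c mpoly = "nat multiset \<Rightarrow>\<^sub>0 'c"

abbreviation Const :: "'c::zero \<Rightarrow> 'c mpoly" where
  "Const \<equiv> Poly_Mapping.single {#}"

abbreviation Var :: "nat \<Rightarrow> 'c::zero_neq_one mpoly" where
  "Var i \<equiv> Poly_Mapping.single {#i#} 1"

abbreviation (input) coeff_at :: "'c::zero mpoly \<Rightarrow> nat multiset \<Rightarrow> 'c" where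
  "coeff_at \<equiv> Poly_Mapping.lookup"

lemma finite_submultisets: "finite {a. a \<subseteq># (m :: 'b multiset)}"
proof (rule finite_subset)
  show "{a. a \<subseteq># m} \<subseteq> mset ` {xs. set xs \<subseteq> set_mset m \<and> length xs \<le> size m}"
  proof
    fix a assume "a \<in> {a. a \<subseteq># m}"
    moreover obtain xs where "a = mset xs" using ex_mset by metis
    ultimately show "a \<in> mset ` {xs. set xs \<subseteq> set_mset m \<and> length xs \<le> size m}"
      using size_mset_mono set_mset_mono by fastforce
  qed
  show "finite (mset ` {xs. set xs \<subseteq> set_mset m \<and> length xs \<le> size m})"
    by (intro finite_imageI finite_lists_length_le) simp
qed

text \<open>The same convolution over submultisets as in \<open>mpoly_ring\<close>, so that products
  transfer coefficient by coefficient.\<close>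

lemma lookup_mult_mset:
  fixes f g :: "'c::comm_ring_1 mpoly"
  shows "coeff_at (f * g) m = (\<Sum>a | a \<subseteq># m. coeff_at f a * coeff_at g (m - a))"
proof -
  have *: "(\<Sum>b. coeff_at g b when m = a + b) = (if a \<subseteq># m then coeff_at g (m - a) else 0)" for a
  proof (cases "a \<subseteq># m")
    case True
    then have "(m = a + b) \<longleftrightarrow> (b = m - a)" for b by auto
    with True show ?thesis by simp
  next
    case False
    then have "\<not> m = a + b" for b by auto
    with False show ?thesis by simp
  qed
  have "coeff_at (f * g) m = (\<Sum>a. coeff_at f a * (if a \<subseteq># m then coeff_at g (m - a) else 0))"
    unfolding lookup_mult * ..
  also have "\<dots> = (\<Sum>a | a \<subseteq># m. coeff_at f a * (if a \<subseteq># m then coeff_at g (m - a) else 0))"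
    by (rule Sum_any.expand_superset) (auto simp: finite_submultisets)
  finally show ?thesis by simp
qed

lemma lookup_Const_mult [simp]: "coeff_at (Const c * f) m = c * coeff_at f (m :: nat multiset)"
  for f :: "'c::comm_ring_1 mpoly"
proof -
  have "coeff_at (Const c * f) m = (\<Sum>a\<in>{{#}}. coeff_at (Const c) a * coeff_at f (m - a))"
    unfolding lookup_mult_mset
    by (rule sum.mono_neutral_right) (auto simp: finite_submultisets lookup_single)
  then show ?thesis by simp
qed

lemma Const_dvd_iff: "Const p dvd f \<longleftrightarrow> (\<forall>m. p dvd coeff_at f m)" for f :: "'c::comm_ring_1 mpoly"
proof
  assume "\<forall>m. p dvd coeff_at f m"
  \<comment> \<open>A quotient need not be unique, for instance if \<open>p = 0\<close>. Choosing
    \<open>0\<close> wherever the coefficient of \<open>f\<close> is \<open>0\<close> gives the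
    quotients finite support.\<close>
  then have "\<forall>m. \<exists>c. coeff_at f m = p * c \<and> (coeff_at f m = 0 \<longrightarrow> c = 0)"
    by (metis dvd_def mult_zero_right)
  then obtain c where c: "\<And>m. coeff_at f m = p * c m" "\<And>m. coeff_at f m = 0 \<Longrightarrow> c m = 0" by metis
  have "finite {m. c m \<noteq> 0}"
    by (rule finite_subset[OF _ finite_lookup[of f]]) (use c(2) in auto)
  then have "f = Const p * Abs_poly_mapping c"
    by (intro poly_mapping_eqI) (simp add: c(1))
  then show "Const p dvd f" by simp
qed auto

text \<open>Gauss's lemma. The multiset order serves as a monomial order: let \<open>M f\<close> and
  \<open>M g\<close> be the largest monomials whose coefficients \<open>p\<close> does not divide.
  Among the products contributing to the coefficient of \<open>M f + M g\<close>, only the one from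
  \<open>M f\<close> and \<open>M g\<close> is not divisible by \<open>p\<close>.\<close>

lemma prime_like_Const:
  assumes "prime_like (p :: 'c::comm_ring_1)"
  shows "prime_like (Const p :: 'c mpoly)"
  unfolding prime_like_def
proof (intro conjI allI impI)
  have "coeff_at (1 :: 'c mpoly) {#} = 1" by (simp add: lookup_one)
  then show "\<not> Const p dvd (1 :: 'c mpoly)"
    using assms unfolding Const_dvd_iff prime_like_def by metis
next
  fix f g :: "'c mpoly" assume fg: "Const p dvd f * g"
  show "Const p dvd f \<or> Const p dvd g"
  proof (rule ccontr)
    assume "\<not> (Const p dvd f \<or> Const p dvd g)"
    then have ne: "\<exists>m. \<not> p dvd coeff_at f m" "\<exists>m. \<not> p dvd coeff_at g m" by (auto simp: Const_dvd_iff)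
    have fin: "finite {m. \<not> p dvd coeff_at f m}" for f :: "'c mpoly"
      by (rule finite_subset[OF _ finite_lookup[of f]]) auto
    define M where "M f = Max {m. \<not> p dvd coeff_at f m}" for f :: "'c mpoly"
    have M: "\<not> p dvd coeff_at h (M h)" "\<And>m. M h < m \<Longrightarrow> p dvd coeff_at h m"
      if "\<exists>m. \<not> p dvd coeff_at h m" for h
    proof -
      show "\<not> p dvd coeff_at h (M h)"
        using Max_in[OF fin[of h]] that by (auto simp: M_def)
      show "p dvd coeff_at h m" if "M h < m" for m
      proof (rule ccontr)
        assume "\<not> p dvd coeff_at h m"
        then have "m \<le> M h" unfolding M_def by (intro Max_ge fin) auto
        with that show False by simp
      qed
    qed
    let ?s = "M f + M g"
    have "p dvd coeff_at f a * coeff_at g (?s - a)" if "a \<subseteq># ?s" "a \<noteq> M f" for a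
    proof (cases "M f < a")
      case True
      then show ?thesis using M(2)[OF ne(1)] by simp
    next
      case False
      with that have "a < M f" by auto
      moreover have "a + (?s - a) = M f + M g" using that by simp
      ultimately have "M g < ?s - a"
        by (metis add_less_le_mono not_le_imp_less order_less_irrefl)
      then show ?thesis using M(2)[OF ne(2)] by simp
    qed
    then have rest: "p dvd (\<Sum>a\<in>{a. a \<subseteq># ?s} - {M f}. coeff_at f a * coeff_at g (?s - a))"
      by (intro dvd_sum) auto
    have "p dvd coeff_at (f * g) ?s" using fg by (simp add: Const_dvd_iff)
    moreover have "coeff_at (f * g) ?s = coeff_at f (M f) * coeff_at g (M g) +
        (\<Sum>a\<in>{a. a \<subseteq># ?s} - {M f}. coeff_at f a * coeff_at g (?s - a))"
      unfolding lookup_mult_mset by (subst sum.remove[of _ "M f"]) (auto simp: finite_submultisets)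
    ultimately have "p dvd coeff_at f (M f) * coeff_at g (M g)"
      using dvd_add_left_iff[OF rest] by simp
    then show False using M(1)[OF ne(1)] M(1)[OF ne(2)] assms by (auto simp: prime_like_def)
  qed
qed

lemma mpoly_induct_single [case_names zero single add]:
  fixes f :: "'c::comm_ring_1 mpoly"
  assumes "P 0" "\<And>m c. P (Poly_Mapping.single m c)" "\<And>f g. P f \<Longrightarrow> P g \<Longrightarrow> P (f + g)"
  shows "P f"
proof (induction f rule: update_induct)
  case (update f a b)
  have "Poly_Mapping.update a b f = f + Poly_Mapping.single a b"
    using update(1) by (intro poly_mapping_eqI) (auto simp: lookup_update lookup_add lookup_single in_keys_iff)
  then show ?case using update assms by simp
qed (use assms in auto)

lemma mpoly_induct [case_names Const add Var]:
  fixes f :: "'c::comm_ring_1 mpoly"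
  assumes "\<And>c. P (Const c)" "\<And>f g. P f \<Longrightarrow> P g \<Longrightarrow> P (f + g)" "\<And>i f. P f \<Longrightarrow> P (Var i * f)"
  shows "P f"
proof (induction f rule: mpoly_induct_single)
  case zero
  then show ?case using assms(1)[of 0] by simp
next
  case (single m c)
  show ?case
  proof (induction m)
    case (add i m)
    have "Poly_Mapping.single (add_mset i m) c = Var i * Poly_Mapping.single m c"
      by (simp add: mult_single)
    then show ?case using assms(3) add by simp
  qed (rule assms(1))
qed (rule assms)

section \<open>Substitution and linear forms\<close>

definition poly_subst :: "(nat \<Rightarrow> 'c::comm_ring_1 mpoly) \<Rightarrow> 'c mpoly \<Rightarrow> 'c mpoly" where
  "poly_subst s f = (\<Sum>m\<in>Poly_Mapping.keys f. Const (coeff_at f m) * (\<Prod>i\<in>#m. s i))"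

lemma poly_subst_superset:
  assumes "finite A" "Poly_Mapping.keys f \<subseteq> A"
  shows "poly_subst s f = (\<Sum>m\<in>A. Const (coeff_at f m) * (\<Prod>i\<in>#m. s i))"
  unfolding poly_subst_def using assms by (intro sum.mono_neutral_left) (auto simp: in_keys_iff)

lemma poly_subst_add: "poly_subst s (f + g) = poly_subst s f + poly_subst s g"
proof -
  let ?A = "Poly_Mapping.keys f \<union> Poly_Mapping.keys g"
  have "Poly_Mapping.keys (f + g) \<subseteq> ?A" by (rule keys_add)
  then show ?thesis
    by (simp add: poly_subst_superset[of ?A] lookup_add single_add distrib_right sum.distrib)
qed

lemma poly_subst_single: "poly_subst s (Poly_Mapping.single m c) = Const c * (\<Prod>i\<in>#m. s i)"
  by (subst poly_subst_superset[of "{m}"]) auto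

lemma poly_subst_0 [simp]: "poly_subst s 0 = 0"
  by (simp add: poly_subst_def)

lemma poly_subst_Const [simp]: "poly_subst s (Const c) = Const c"
  by (simp add: poly_subst_single)

lemma poly_subst_Var [simp]: "poly_subst s (Var i) = s i"
  by (simp add: poly_subst_single)

lemma poly_subst_mult: "poly_subst s (f * g) = poly_subst s f * poly_subst s g"
proof (induction f rule: mpoly_induct_single)
  case (single m c)
  show ?case
  proof (induction g rule: mpoly_induct_single)
    case (single n d)
    have *: "Const (c * d) = Const c * Const d" by (simp add: mult_single)
    show ?case
      unfolding mult_single poly_subst_single unfolding * by (simp add: mult_ac)
  qed (simp_all add: distrib_left poly_subst_add)
qed (simp_all add: distrib_right poly_subst_add)

lemma poly_subst_sum: "poly_subst s (sum f I) = (\<Sum>i\<in>I. poly_subst s (f i))"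
  by (induction I rule: infinite_finite_induct) (auto simp: poly_subst_add)

lemma poly_subst_cong_0:
  assumes "Const p dvd f"
  shows "Const p dvd poly_subst s f"
  using assms by (auto simp: poly_subst_mult elim!: dvdE)

definition linear_poly :: "nat \<Rightarrow> (nat \<Rightarrow> 'c::comm_ring_1) \<Rightarrow> 'c mpoly" where
  "linear_poly l a = (\<Sum>j<l. Const (a j) * Var j)"

lemma lookup_linear_poly: "coeff_at (linear_poly l a) m = (\<Sum>j<l. if m = {#j#} then a j else 0)"
  unfolding linear_poly_def lookup_sum by (intro sum.cong) (auto simp: lookup_single when_def)

lemma lookup_linear_poly_Var [simp]: "k < l \<Longrightarrow> coeff_at (linear_poly l a) {#k#} = a k"
  unfolding lookup_linear_poly by (subst sum.cong[OF refl, where h = "\<lambda>j. if j = k then a j else 0"]) auto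

text \<open>Modulo \<open>p\<close>, divisibility by \<open>\<Sum>\<^sub>j a j X\<^sub>j\<close> means vanishing after solving it for \<open>X\<^sub>k\<close>.\<close>

lemma linear_poly_dvd_mod_iff:
  fixes a :: "nat \<Rightarrow> 'c::comm_ring_1"
  assumes k: "k < l" and u: "cong_mod p (a k * u) 1"
  shows "\<exists>s. \<forall>f. dvd_mod (Const p) (linear_poly l a) f \<longleftrightarrow> Const p dvd poly_subst s f"
proof -
  let ?\<alpha> = "linear_poly l a"
  define r where "r = (\<Sum>j\<in>{..<l} - {k}. Const (a j) * Var j)"
  \<comment> \<open>Modulo \<open>p\<close> the form equals
    \<open>Const (a k) * (Var k + Const u * r)\<close>, so this is the value of \<open>Var k\<close>
    at which it vanishes.\<close>
  define s where "s i = (if i = k then - (Const u * r) else Var i)" for i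
  have \<alpha>: "?\<alpha> = Const (a k) * Var k + r"
    unfolding linear_poly_def r_def using k by (subst sum.remove[of _ k]) auto
  have u': "Const p dvd Const (a k) * Const u - (1 :: 'c mpoly)"
  proof -
    have "Const (a k) * Const u - (1 :: 'c mpoly) = Const (a k * u - 1)"
      by (simp add: mult_single single_diff)
    then show ?thesis using u by (simp add: cong_mod_def Const_dvd_iff lookup_single when_def)
  qed
  have "poly_subst s r = r"
    by (simp add: r_def poly_subst_sum poly_subst_mult s_def)
  then have "poly_subst s ?\<alpha> = (Const (a k) * Const u - 1) * (- r)"
    by (simp add: \<alpha> poly_subst_add poly_subst_mult s_def algebra_simps)
  then have \<alpha>0: "Const p dvd poly_subst s ?\<alpha>" using u' by simp
  \<comment> \<open>It is enough that each variable agrees with its substitute modulo the form; this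
    passes to sums and products.\<close>
  have reduce: "dvd_mod (Const p) ?\<alpha> (f - poly_subst s f)" for f
  proof (induction f rule: mpoly_induct)
    case (add f g)
    then show ?case using dvd_mod_add by (fastforce simp: poly_subst_add algebra_simps)
  next
    case (Var i f)
    have "dvd_mod (Const p) ?\<alpha> (Var i - s i)"
    proof (cases "i = k")
      case True
      have "Var k - s k - ?\<alpha> * Const u = - ((Const (a k) * Const u - 1) * Var k)"
        by (simp add: s_def \<alpha> algebra_simps)
      then have "cong_mod (Const p) (Var k - s k) (?\<alpha> * Const u)"
        using u' by (simp add: cong_mod_def)
      then show ?thesis using True by (auto simp: dvd_mod_def)
    qed (simp add: s_def)
    moreover have "Var i * f - poly_subst s (Var i * f) =
        Var i * (f - poly_subst s f) + poly_subst s f * (Var i - s i)"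
      by (simp add: poly_subst_mult algebra_simps)
    ultimately show ?case
      using Var by (simp add: dvd_mod_add dvd_mod_mult)
  qed simp
  have "dvd_mod (Const p) ?\<alpha> f \<longleftrightarrow> Const p dvd poly_subst s f" for f
  proof
    assume "dvd_mod (Const p) ?\<alpha> f"
    then obtain h where "Const p dvd f - ?\<alpha> * h" by (auto simp: dvd_mod_def cong_mod_def)
    then have "Const p dvd poly_subst s (f - ?\<alpha> * h)" by (rule poly_subst_cong_0)
    moreover have "poly_subst s f = poly_subst s (f - ?\<alpha> * h) + poly_subst s ?\<alpha> * poly_subst s h"
      by (simp add: poly_subst_mult[symmetric] poly_subst_add[symmetric])
    ultimately show "Const p dvd poly_subst s f" using \<alpha>0 by simp
  next
    assume "Const p dvd poly_subst s f"
    then have "cong_mod (Const p) (f - poly_subst s f) f"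
      by (simp add: cong_mod_def)
    then show "dvd_mod (Const p) ?\<alpha> f" using reduce dvd_mod_cong by blast
  qed
  then show ?thesis by blast
qed

text \<open>Divisibility by the form is the kernel of a substitution homomorphism into a ring that
  is a domain modulo \<open>p\<close>, and such a kernel is prime.\<close>

lemma prime_mod_linear_poly:
  fixes a :: "nat \<Rightarrow> 'c::comm_ring_1"
  assumes "prime_like p" and k: "k < l" and u: "cong_mod p (a k * u) 1"
  shows "prime_mod (Const p) (linear_poly l a)"
proof -
  obtain s where s: "\<And>f. dvd_mod (Const p) (linear_poly l a) f \<longleftrightarrow> Const p dvd poly_subst s f"
    using linear_poly_dvd_mod_iff[where a = a and p = p, OF k u] by blast
  note prime = prime_like_Const[OF assms(1)]
  have "\<not> p dvd a k"
  proof
    assume "p dvd a k"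
    then have "p dvd a k * u - (a k * u - 1)"
      using u unfolding cong_mod_def by (rule dvd_diff[OF dvd_mult2])
    then show False using assms(1) by (simp add: prime_like_def)
  qed
  then have "\<not> Const p dvd linear_poly l a"
    using k by (metis Const_dvd_iff lookup_linear_poly_Var)
  moreover have "poly_subst s 1 = 1" using poly_subst_Const[of s 1] by simp
  ultimately show ?thesis
    using prime unfolding prime_mod_def s by (simp add: poly_subst_mult prime_like_def)
qed

section \<open>Homogeneous polynomials\<close>

definition homog :: "nat \<Rightarrow> 'c::zero mpoly \<Rightarrow> bool" where
  "homog d f \<longleftrightarrow> (\<forall>m. coeff_at f m \<noteq> 0 \<longrightarrow> size m = d)"

lemma homog_0 [simp]: "homog d 0"
  by (simp add: homog_def)

lemma homog_1 [simp]: "homog 0 1"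
  by (auto simp: homog_def lookup_one when_def)

lemma homog_add: "homog d f \<Longrightarrow> homog d g \<Longrightarrow> homog d (f + g)"
  by (auto simp: homog_def lookup_add) (metis add.right_neutral)

lemma homog_sum: "(\<And>i. i \<in> I \<Longrightarrow> homog d (f i)) \<Longrightarrow> homog d (sum f I)"
  by (induction I rule: infinite_finite_induct) (auto intro: homog_add)

lemma homog_mult: "homog d f \<Longrightarrow> homog e g \<Longrightarrow> homog (d + e) (f * g)"
  for f g :: "'c::comm_ring_1 mpoly"
  unfolding homog_def
proof (intro allI impI)
  fix m assume f: "\<forall>m. coeff_at f m \<noteq> 0 \<longrightarrow> size m = d" and g: "\<forall>m. coeff_at g m \<noteq> 0 \<longrightarrow> size m = e"
    and "coeff_at (f * g) m \<noteq> 0"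
  then obtain a where "a \<subseteq># m" "coeff_at f a * coeff_at g (m - a) \<noteq> 0"
    unfolding lookup_mult_mset by (metis (mono_tags, lifting) mem_Collect_eq sum.neutral)
  then have "size a = d" "size (m - a) = e" using f g by (metis mult_zero_left, metis mult_zero_right)
  then show "size m = d + e" using \<open>a \<subseteq># m\<close> by (metis size_union subset_mset.add_diff_inverse)
qed

lemma homog_prod: "(\<And>i. i \<in> I \<Longrightarrow> homog (d i) (f i)) \<Longrightarrow> homog (sum d I) (prod f I)"
  for f :: "'i \<Rightarrow> 'c::comm_ring_1 mpoly"
  by (induction I rule: infinite_finite_induct) (auto intro: homog_mult)

lemma homog_linear_poly: "homog 1 (linear_poly l a)"
  unfolding homog_def lookup_linear_poly
  by (auto elim!: sum.not_neutral_contains_not_neutral split: if_splits)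

text \<open>Degrees are constant along rows, and each summand of the determinant takes one entry
  from every row.\<close>

lemma homog_det_of:
  fixes \<delta> :: "nat \<Rightarrow> nat \<Rightarrow> 'c::comm_ring_1 mpoly"
  assumes "\<And>i j. i < l \<Longrightarrow> j < l \<Longrightarrow> homog (e i) (\<delta> i j)"
  shows "homog (\<Sum>i<l. e i) (det_of l \<delta>)"
proof -
  have sign: "homog 0 (signof \<pi> :: 'c mpoly)" for \<pi> :: "nat \<Rightarrow> nat"
    by (auto simp: sign_def homog_def lookup_one when_def)
  have "homog (0 + (\<Sum>i = 0..<l. e i)) (signof \<pi> * (\<Prod>i = 0..<l. \<delta> i (\<pi> i)))"
    if "\<pi> permutes {0..<l}" for \<pi>
  proof (intro homog_mult homog_prod sign)
    fix i assume i: "i \<in> {0..<l}"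
    then have "\<pi> i \<in> {0..<l}" using that permutes_in_image by metis
    with i show "homog (e i) (\<delta> i (\<pi> i))" using assms by simp
  qed
  moreover have "det_of l \<delta> = (\<Sum>\<pi> | \<pi> permutes {0..<l}. signof \<pi> * (\<Prod>i = 0..<l. \<delta> i (\<pi> i)))"
    unfolding det_of_def
  proof (subst det_def'[of _ l], simp, intro sum.cong refl arg_cong2[where f = "(*)"] prod.cong)
    fix \<pi> i assume "\<pi> \<in> {\<pi>. \<pi> permutes {0..<l}}" and i: "i \<in> {0..<l}"
    then have "\<pi> i \<in> {0..<l}" using permutes_in_image by (metis mem_Collect_eq)
    with i show "mat l l (\<lambda>(i, j). \<delta> i j) $$ (i, \<pi> i) = \<delta> i (\<pi> i)" by simp
  qed
  ultimately show ?thesis by (auto intro!: homog_sum simp: lessThan_atLeast0)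
qed

text \<open>A monomial of \<open>F\<close> whose coefficient is nonzero modulo \<open>p\<close> also
  occurs in \<open>A * g\<close>, hence is a multiple of a monomial of \<open>A\<close>.\<close>

lemma homog_factor_le:
  fixes F A g :: "'c::comm_ring_1 mpoly"
  assumes "homog s F" "homog n A" "cong_mod (Const p) F (A * g)" "\<not> Const p dvd F"
  shows "n \<le> s"
proof -
  obtain m where m: "\<not> p dvd coeff_at F m" using assms(4) by (auto simp: Const_dvd_iff)
  then have "size m = s" using assms(1) by (metis dvd_0_right homog_def)
  have "coeff_at (A * g) m \<noteq> 0"
    using m assms(3) by (auto simp: cong_mod_def Const_dvd_iff lookup_minus) (metis diff_zero)
  then obtain a where "a \<subseteq># m" "coeff_at A a * coeff_at g (m - a) \<noteq> 0"
    unfolding lookup_mult_mset by (metis (mono_tags, lifting) mem_Collect_eq sum.neutral)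
  then show ?thesis
    using assms(2) \<open>size m = s\<close> unfolding homog_def by (metis mult_zero_left size_mset_mono)
qed

text \<open>In degree \<open>n\<close> only the constant term of \<open>g\<close> contributes to
  \<open>A * g\<close>, and in other degrees \<open>F\<close> and \<open>A\<close> vanish. The
  cofactor thereby becomes a scalar, invertible over a field once it is nonzero.\<close>

lemma homog_factor_eq:
  fixes F A g :: "'c::comm_ring_1 mpoly"
  assumes "homog n F" "homog n A" "cong_mod (Const p) F (A * g)"
  shows "cong_mod (Const p) F (A * Const (coeff_at g {#}))"
  unfolding cong_mod_def Const_dvd_iff
proof
  fix m
  show "p dvd coeff_at (F - A * Const (coeff_at g {#})) m"
  proof (cases "size m = n")
    case True
    have "coeff_at (A * g) m = (\<Sum>a\<in>{m}. coeff_at A a * coeff_at g (m - a))"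
      unfolding lookup_mult_mset
    proof (rule sum.mono_neutral_right)
      show "\<forall>a\<in>{a. a \<subseteq># m} - {m}. coeff_at A a * coeff_at g (m - a) = 0"
      proof
        fix a assume "a \<in> {a. a \<subseteq># m} - {m}"
        then have "size a < size m" by (intro mset_subset_size) (auto simp: subset_mset_def)
        then have "coeff_at A a = 0" using assms(2) True unfolding homog_def by (metis less_irrefl)
        then show "coeff_at A a * coeff_at g (m - a) = 0" by simp
      qed
    qed (auto simp: finite_submultisets)
    then have "coeff_at (F - A * Const (coeff_at g {#})) m = coeff_at (F - A * g) m"
      by (simp add: lookup_minus mult.commute[of A])
    then show ?thesis using assms(3) by (simp add: cong_mod_def Const_dvd_iff)
  next
    case False
    then have "coeff_at F m = 0" "coeff_at A m = 0" using assms(1,2) by (auto simp: homog_def)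
    then show ?thesis by (simp add: lookup_minus mult.commute[of A])
  qed
qed

section \<open>Polynomials in the first \<open>l\<close> variables\<close>

definition vars_below :: "nat \<Rightarrow> 'c::zero mpoly set" where
  "vars_below l = {f. \<forall>m. coeff_at f m \<noteq> 0 \<longrightarrow> set_mset m \<subseteq> {..<l}}"

lemma vars_below_0 [simp]: "0 \<in> vars_below l"
  by (simp add: vars_below_def)

lemma vars_below_Const [simp]: "Const c \<in> vars_below l"
  by (auto simp: vars_below_def lookup_single when_def)

lemma vars_below_1 [simp]: "1 \<in> vars_below l"
  by (auto simp: vars_below_def lookup_one when_def)

lemma vars_below_Var [simp]: "j < l \<Longrightarrow> Var j \<in> vars_below l"
  by (auto simp: vars_below_def lookup_single when_def)

lemma vars_below_add: "f \<in> vars_below l \<Longrightarrow> g \<in> vars_below l \<Longrightarrow> f + g \<in> vars_below l"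
  unfolding vars_below_def by (clarsimp simp: lookup_add) (metis add.right_neutral lessThan_iff subsetD)

lemma vars_below_uminus: "f \<in> vars_below l \<Longrightarrow> - f \<in> vars_below l"
  for f :: "'c::comm_ring_1 mpoly"
  by (simp add: vars_below_def)

lemma vars_below_mult:
  fixes f g :: "'c::comm_ring_1 mpoly"
  assumes "f \<in> vars_below l" "g \<in> vars_below l"
  shows "f * g \<in> vars_below l"
  unfolding vars_below_def mem_Collect_eq
proof (intro allI impI)
  fix m assume "coeff_at (f * g) m \<noteq> 0"
  then obtain a where a: "a \<subseteq># m" "coeff_at f a * coeff_at g (m - a) \<noteq> 0"
    unfolding lookup_mult_mset by (metis (mono_tags, lifting) mem_Collect_eq sum.neutral)
  then have "coeff_at f a \<noteq> 0" "coeff_at g (m - a) \<noteq> 0" by auto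
  then have "set_mset a \<subseteq> {..<l}" "set_mset (m - a) \<subseteq> {..<l}"
    using assms unfolding vars_below_def by blast+
  then show "set_mset m \<subseteq> {..<l}" using a(1) by (metis Un_least set_mset_union subset_mset.add_diff_inverse)
qed

lemma vars_below_sum: "(\<And>i. i \<in> I \<Longrightarrow> f i \<in> vars_below l) \<Longrightarrow> sum f I \<in> vars_below l"
  by (induction I rule: infinite_finite_induct) (auto intro: vars_below_add)

lemma vars_below_linear_poly [simp]: "linear_poly l a \<in> vars_below l"
  unfolding linear_poly_def by (intro vars_below_sum vars_below_mult) auto

text \<open>The type \<open>'c mpoly\<close> has a variable for every natural number, so cofactors
  found in it may leave \<open>vars_below l\<close>. Setting the variables from \<open>l\<close> on
  to \<open>0\<close> is linear over \<open>vars_below l\<close> and brings them back.\<close>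

definition restrict_vars :: "nat \<Rightarrow> 'c::comm_ring_1 mpoly \<Rightarrow> 'c mpoly" where
  "restrict_vars l f = Abs_poly_mapping (\<lambda>m. if set_mset m \<subseteq> {..<l} then coeff_at f m else 0)"

lemma lookup_restrict_vars:
  "coeff_at (restrict_vars l f) m = (if set_mset m \<subseteq> {..<l} then coeff_at f m else 0)"
proof -
  have "finite {m. (if set_mset m \<subseteq> {..<l} then coeff_at f m else 0) \<noteq> 0}"
    by (rule finite_subset[OF _ finite_lookup[of f]]) auto
  then show ?thesis by (simp add: restrict_vars_def)
qed

lemma restrict_vars_in [simp]: "restrict_vars l f \<in> vars_below l"
  by (auto simp: vars_below_def lookup_restrict_vars split: if_splits)

lemma restrict_vars_id: "f \<in> vars_below l \<Longrightarrow> restrict_vars l f = f"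
  by (intro poly_mapping_eqI) (auto simp: vars_below_def lookup_restrict_vars)

lemma restrict_vars_diff: "restrict_vars l (f - g) = restrict_vars l f - restrict_vars l g"
  by (intro poly_mapping_eqI) (auto simp: lookup_restrict_vars lookup_minus)

lemma restrict_vars_sum: "restrict_vars l (sum f I) = (\<Sum>i\<in>I. restrict_vars l (f i))"
  by (intro poly_mapping_eqI) (auto simp: lookup_restrict_vars lookup_sum)

lemma restrict_vars_mult:
  assumes "f \<in> vars_below l"
  shows "restrict_vars l (f * g) = f * restrict_vars l g"
proof (rule poly_mapping_eqI)
  fix m
  show "coeff_at (restrict_vars l (f * g)) m = coeff_at (f * restrict_vars l g) m"
  proof (cases "set_mset m \<subseteq> {..<l}")
    case True
    then have "set_mset (m - a) \<subseteq> {..<l}" for a by (meson in_diffD subsetD subsetI)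
    then show ?thesis using True by (simp add: lookup_restrict_vars lookup_mult_mset)
  next
    case False
    have "coeff_at (f * restrict_vars l g) m = 0"
      using vars_below_mult[OF assms restrict_vars_in[of l g]] False by (auto simp: vars_below_def)
    then show ?thesis using False by (simp add: lookup_restrict_vars)
  qed
qed

lemma cong_mod_restrict_vars:
  assumes "cong_mod (Const p) f g"
  shows "cong_mod (Const p) (restrict_vars l f) (restrict_vars l g)"
  using assms unfolding cong_mod_def restrict_vars_diff[symmetric]
  by (auto simp: Const_dvd_iff lookup_restrict_vars)

lemma dvd_mod_vars_below:
  assumes "dvd_mod (Const p) f g" "f \<in> vars_below l" "g \<in> vars_below l"
  obtains h where "h \<in> vars_below l" "cong_mod (Const p) g (f * h)"
proof -
  from assms(1) obtain h where "cong_mod (Const p) g (f * h)" by (auto simp: dvd_mod_def)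
  from cong_mod_restrict_vars[OF this, of l] show thesis
    using assms by (intro that[of "restrict_vars l h"]) (auto simp: restrict_vars_mult restrict_vars_id)
qed

section \<open>Transfer to the polynomial rings of ring records\<close>

lemma lookup_Var_mult:
  "coeff_at (Var i * f) m = (if i \<in># m then coeff_at f (m - {#i#}) else 0)" for f :: "'c::comm_ring_1 mpoly"
proof -
  have "coeff_at (Var i * f) m = (\<Sum>a | a \<subseteq># m. if a = {#i#} then coeff_at f (m - a) else 0)"
    unfolding lookup_mult_mset by (intro sum.cong) (auto simp: lookup_single when_def)
  then show ?thesis by (simp add: finite_submultisets)
qed

text \<open>\<open>R\<close> is presented as the quotient of the type \<open>'c\<close> by
  \<open>p\<close>. The instances are the identity on \<open>int\<close> and on \<open>rat\<close>
  with \<open>p = 0\<close>, and reduction of \<open>int\<close> modulo a prime.\<close>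

locale coeff_hom = cring R for R (structure) +
  fixes \<phi> :: "'c::comm_ring_1 \<Rightarrow> 'a" and p :: 'c
  assumes \<phi>_add: "\<phi> (x + y) = \<phi> x \<oplus> \<phi> y"
    and \<phi>_mult: "\<phi> (x * y) = \<phi> x \<otimes> \<phi> y"
    and \<phi>_1: "\<phi> 1 = \<one>"
    and range_\<phi>: "range \<phi> = carrier R"
    and \<phi>_eq_iff: "\<phi> x = \<phi> y \<longleftrightarrow> cong_mod p x y"
begin

lemma \<phi>_closed [simp]: "\<phi> x \<in> carrier R"
  using range_\<phi> by auto

lemma \<phi>_0: "\<phi> 0 = \<zero>"
  using \<phi>_add[of 0 0] by (metis \<phi>_closed add.l_cancel_one' add_0)

context
  notes \<phi>_0 [simp]
begin

lemma \<phi>_eq_0_iff: "\<phi> x = \<zero> \<longleftrightarrow> p dvd x"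
  using \<phi>_eq_iff[of x 0] by (simp add: cong_mod_def)

lemma finsum_\<phi>: "finite A \<Longrightarrow> (\<Oplus>a\<in>A. \<phi> (f a)) = \<phi> (sum f A)"
  by (induction A rule: finite_induct) (auto simp: \<phi>_add)

definition map_poly_ring :: "'c mpoly \<Rightarrow> nat multiset \<Rightarrow> 'a" where
  "map_poly_ring F = (\<lambda>m. \<phi> (coeff_at F m))"

lemma map_poly_ring_eq_iff: "map_poly_ring F = map_poly_ring G \<longleftrightarrow> cong_mod (Const p) F G"
  by (simp add: map_poly_ring_def fun_eq_iff \<phi>_eq_iff cong_mod_def Const_dvd_iff lookup_minus)

lemma map_poly_ring_in_carrier [simp]: "map_poly_ring F m \<in> carrier R"
  by (simp add: map_poly_ring_def)

lemma map_poly_ring_Const: "map_poly_ring (Const c) = indexed_const (\<phi> c)"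
  by (auto simp: map_poly_ring_def indexed_const_def lookup_single when_def)

lemma map_poly_ring_add: "map_poly_ring (F + G) = indexed_padd (map_poly_ring F) (map_poly_ring G)"
  by (auto simp: map_poly_ring_def indexed_padd_def lookup_add \<phi>_add)

lemma map_poly_ring_Var_mult: "map_poly_ring (Var i * F) = indexed_pmult (map_poly_ring F) i"
  by (auto simp: map_poly_ring_def indexed_pmult_def lookup_Var_mult)

text \<open>The generation rules of the carrier correspond to constants, sums and multiplication by
  variables; conversely a polynomial is the sum of its monomials, each built by these rules.\<close>

lemma carrier_mpoly_ring: "carrier (mpoly_ring R l) = map_poly_ring ` vars_below l"
proof -
  have "indexed_pset {..<l} (carrier R) = map_poly_ring ` vars_below l"
  proof (intro Set.equalityI subsetI)
    fix f assume "f \<in> indexed_pset {..<l} (carrier R)"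
    then show "f \<in> map_poly_ring ` vars_below l"
    proof induction
      case (indexed_const k)
      then obtain c where "k = \<phi> c" using range_\<phi> by blast
      then show ?case by (metis map_poly_ring_Const vars_below_Const image_eqI)
    next
      case (indexed_padd P Q)
      then obtain F G where "F \<in> vars_below l" "P = map_poly_ring F"
        "G \<in> vars_below l" "Q = map_poly_ring G" by auto
      then have "indexed_padd P Q = map_poly_ring (F + G)" "F + G \<in> vars_below l"
        by (auto simp: map_poly_ring_add intro: vars_below_add)
      then show ?case by simp
    next
      case (indexed_pmult P i)
      then obtain F where "F \<in> vars_below l" "P = map_poly_ring F" by auto
      then have "indexed_pmult P i = map_poly_ring (Var i * F)" "Var i * F \<in> vars_below l"
        using indexed_pmult(2) by (auto simp: map_poly_ring_Var_mult intro: vars_below_mult)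
      then show ?case by simp
    qed
  next
    have single: "map_poly_ring (Poly_Mapping.single m c) \<in> indexed_pset {..<l} (carrier R)"
      if "set_mset m \<subseteq> {..<l}" for m c
      using that
    proof (induction m)
      case empty
      show ?case unfolding map_poly_ring_Const by (rule indexed_pset.indexed_const) simp
    next
      case (add i m)
      have "Poly_Mapping.single (add_mset i m) c = Var i * Poly_Mapping.single m c"
        by (simp add: mult_single)
      then show ?case using add by (auto simp: map_poly_ring_Var_mult intro: indexed_pset.indexed_pmult)
    qed
    have sum: "map_poly_ring (\<Sum>m\<in>A. Poly_Mapping.single m (c m)) \<in> indexed_pset {..<l} (carrier R)"
      if "finite A" "\<And>m. m \<in> A \<Longrightarrow> set_mset m \<subseteq> {..<l}" for A c
      using that
    proof (induction A)
      case empty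
      show ?case using single[of "{#}" 0] by simp
    next
      case (insert m A)
      then show ?case by (auto simp: map_poly_ring_add intro: single indexed_pset.indexed_padd)
    qed
    fix f assume "f \<in> map_poly_ring ` vars_below l"
    then obtain F where F: "F \<in> vars_below l" "f = map_poly_ring F" by auto
    have "F = (\<Sum>m\<in>Poly_Mapping.keys F. Poly_Mapping.single m (coeff_at F m))"
      by (intro poly_mapping_eqI) (auto simp: lookup_sum lookup_single when_def in_keys_iff)
    moreover have "set_mset m \<subseteq> {..<l}" if "m \<in> Poly_Mapping.keys F" for m
      using F(1) that by (simp add: vars_below_def in_keys_iff)
    ultimately show "f \<in> indexed_pset {..<l} (carrier R)"
      using sum[OF finite_keys, of F] F(2) by metis
  qed
  then show ?thesis by (simp add: mpoly_ring_def)
qed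

lemma map_poly_ring_closed: "F \<in> vars_below l \<Longrightarrow> map_poly_ring F \<in> carrier (mpoly_ring R l)"
  by (simp add: carrier_mpoly_ring)

lemma mpoly_ring_add [simp]:
  "map_poly_ring F \<oplus>\<^bsub>mpoly_ring R l\<^esub> map_poly_ring G = map_poly_ring (F + G)"
  by (simp add: mpoly_ring_def map_poly_ring_add)

lemma mpoly_ring_mult [simp]:
  "map_poly_ring F \<otimes>\<^bsub>mpoly_ring R l\<^esub> map_poly_ring G = map_poly_ring (F * G)"
  by (auto simp: mpoly_ring_def map_poly_ring_def lookup_mult_mset finsum_\<phi>[symmetric]
      finite_submultisets \<phi>_mult)

lemma mpoly_ring_zero: "\<zero>\<^bsub>mpoly_ring R l\<^esub> = map_poly_ring 0"
  using map_poly_ring_Const[of 0] by (simp add: mpoly_ring_def)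

lemma mpoly_ring_one: "\<one>\<^bsub>mpoly_ring R l\<^esub> = map_poly_ring 1"
  using map_poly_ring_Const[of 1] by (simp add: mpoly_ring_def \<phi>_1)

text \<open>All operations commute with \<open>map_poly_ring\<close>, so the ring laws are inherited
  from the type \<open>'c mpoly\<close>.\<close>

lemma cring_mpoly_ring: "cring (mpoly_ring R l)"
proof (rule cringI)
  show "abelian_group (mpoly_ring R l)"
  proof (rule abelian_groupI)
    fix x assume "x \<in> carrier (mpoly_ring R l)"
    then obtain F where F: "F \<in> vars_below l" "x = map_poly_ring F" by (auto simp: carrier_mpoly_ring)
    then have "map_poly_ring (- F) \<oplus>\<^bsub>mpoly_ring R l\<^esub> x = \<zero>\<^bsub>mpoly_ring R l\<^esub>"
      by (simp add: mpoly_ring_zero)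
    then show "\<exists>y\<in>carrier (mpoly_ring R l). y \<oplus>\<^bsub>mpoly_ring R l\<^esub> x = \<zero>\<^bsub>mpoly_ring R l\<^esub>"
      using F(1) vars_below_uminus carrier_mpoly_ring by blast
  qed (auto simp: carrier_mpoly_ring mpoly_ring_zero add_ac intro!: imageI vars_below_add)
  show "Group.comm_monoid (mpoly_ring R l)"
    by (rule comm_monoidI)
       (auto simp: carrier_mpoly_ring mpoly_ring_one mult_ac intro!: imageI vars_below_mult)
qed (auto simp: carrier_mpoly_ring distrib_right)

lemma finsum_mpoly_ring:
  assumes "finite I" "\<And>i. i \<in> I \<Longrightarrow> F i \<in> vars_below l"
  shows "(\<Oplus>\<^bsub>mpoly_ring R l\<^esub>i\<in>I. map_poly_ring (F i)) = map_poly_ring (sum F I)"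
proof -
  interpret S: cring "mpoly_ring R l" by (rule cring_mpoly_ring)
  show ?thesis
    using assms
    by (induction I) (auto simp: mpoly_ring_zero S.finsum_insert Pi_def map_poly_ring_closed)
qed

lemma finprod_mpoly_ring:
  assumes "finite I" "\<And>i. i \<in> I \<Longrightarrow> F i \<in> vars_below l"
  shows "(\<Otimes>\<^bsub>mpoly_ring R l\<^esub>i\<in>I. map_poly_ring (F i)) = map_poly_ring (prod F I)"
proof -
  interpret S: cring "mpoly_ring R l" by (rule cring_mpoly_ring)
  show ?thesis
    using assms
    by (induction I) (auto simp: mpoly_ring_one S.finprod_insert Pi_def map_poly_ring_closed)
qed

lemma homogeneous_map_poly_ring: "homog d F \<Longrightarrow> homogeneous R d (map_poly_ring F)"
  by (auto simp: homog_def homogeneous_def map_poly_ring_def) (metis \<phi>_0)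

text \<open>An arbitrary representative may contain terms of the wrong degree with coefficients
  divisible by \<open>p\<close>. Erasing all such coefficients makes homogeneity lift.\<close>

lemma mpoly_ring_lift:
  assumes "x \<in> carrier (mpoly_ring R l)"
  obtains F where "F \<in> vars_below l" "x = map_poly_ring F" "\<And>d. homogeneous R d x \<Longrightarrow> homog d F"
proof -
  obtain G where G: "G \<in> vars_below l" "x = map_poly_ring G"
    using assms by (auto simp: carrier_mpoly_ring)
  define F where "F = Abs_poly_mapping (\<lambda>m. if p dvd coeff_at G m then 0 else coeff_at G m)"
  have "finite {m. (if p dvd coeff_at G m then 0 else coeff_at G m) \<noteq> 0}"
    by (rule finite_subset[OF _ finite_lookup[of G]]) auto
  then have F: "coeff_at F m = (if p dvd coeff_at G m then 0 else coeff_at G m)" for m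
    by (simp add: F_def)
  show thesis
  proof (rule that[of F])
    show "F \<in> vars_below l" using G(1) by (auto simp: vars_below_def F)
    show x: "x = map_poly_ring F"
      by (auto simp: G(2) map_poly_ring_eq_iff cong_mod_def Const_dvd_iff lookup_minus F)
    show "homog d F" if "homogeneous R d x" for d
      using that unfolding homog_def homogeneous_def x map_poly_ring_def \<phi>_eq_0_iff F
      by (auto split: if_splits)
  qed
qed

section \<open>Linear forms and hyperplanes over the coefficient ring\<close>

lemma nonzero_linear_form_iff:
  "nonzero_linear_form R l \<beta> \<longleftrightarrow>
    (\<exists>b. \<beta> = map_poly_ring (linear_poly l b) \<and> (\<exists>j<l. \<not> p dvd b j))"
proof
  assume \<beta>: "nonzero_linear_form R l \<beta>"
  then obtain B where B: "B \<in> vars_below l" "\<beta> = map_poly_ring B"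
    by (auto simp: nonzero_linear_form_def carrier_mpoly_ring)
  define b where "b j = coeff_at B {#j#}" for j
  have "\<beta> = map_poly_ring (linear_poly l b)"
  proof
    fix m
    show "\<beta> m = map_poly_ring (linear_poly l b) m"
    proof (cases "\<exists>j<l. m = {#j#}")
      case True
      then show ?thesis by (auto simp: B(2) map_poly_ring_def b_def)
    next
      case False
      then have "coeff_at (linear_poly l b) m = 0" by (auto simp: lookup_linear_poly)
      moreover have "\<beta> m = \<zero>"
      proof (rule ccontr)
        assume "\<beta> m \<noteq> \<zero>"
        then have "size m = 1" "coeff_at B m \<noteq> 0"
          using \<beta> by (auto simp: nonzero_linear_form_def homogeneous_def B(2) map_poly_ring_def)
        then show False
          using False B(1) unfolding vars_below_def by (force simp: size_1_singleton_mset dest!: size_1_singleton_mset)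
      qed
      ultimately show ?thesis by (simp add: map_poly_ring_def)
    qed
  qed
  moreover have "\<exists>j<l. \<not> p dvd b j"
  proof (rule ccontr)
    assume "\<not> (\<exists>j<l. \<not> p dvd b j)"
    then have "map_poly_ring (linear_poly l b) = map_poly_ring 0"
      by (auto simp: map_poly_ring_eq_iff cong_mod_def Const_dvd_iff lookup_linear_poly intro!: dvd_sum)
    then show False
      using \<beta> calculation by (simp add: nonzero_linear_form_def mpoly_ring_zero)
  qed
  ultimately show "\<exists>b. \<beta> = map_poly_ring (linear_poly l b) \<and> (\<exists>j<l. \<not> p dvd b j)" by blast
next
  assume "\<exists>b. \<beta> = map_poly_ring (linear_poly l b) \<and> (\<exists>j<l. \<not> p dvd b j)"
  then obtain b j where b: "\<beta> = map_poly_ring (linear_poly l b)" "j < l" "\<not> p dvd b j" by blast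
  then have "map_poly_ring (linear_poly l b) {#j#} \<noteq> map_poly_ring 0 {#j#}"
    by (simp add: map_poly_ring_def \<phi>_eq_0_iff)
  then show "nonzero_linear_form R l \<beta>"
    unfolding nonzero_linear_form_def b(1) mpoly_ring_zero
    using homogeneous_map_poly_ring[OF homog_linear_poly] by (auto simp: map_poly_ring_closed)
qed

lemma partial_deriv_linear:
  assumes "i < l"
  shows "partial_deriv R i (map_poly_ring (linear_poly l b)) = map_poly_ring (Const (b i))"
proof
  fix m
  show "partial_deriv R i (map_poly_ring (linear_poly l b)) m = map_poly_ring (Const (b i)) m"
  proof (cases "m = {#}")
    case True
    then show ?thesis using assms by (simp add: partial_deriv_def map_poly_ring_def)
  next
    case False
    then have "coeff_at (linear_poly l b) (add_mset i m) = 0" by (auto simp: lookup_linear_poly)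
    then show ?thesis using False
      by (simp add: partial_deriv_def map_poly_ring_def lookup_single_not_eq)
  qed
qed

lemma mpoly_eval_linear:
  "mpoly_eval R (map_poly_ring (linear_poly l b)) (\<lambda>i\<in>{..<l}. \<phi> (w i)) = \<phi> (\<Sum>j<l. b j * w j)"
proof -
  let ?f = "map_poly_ring (linear_poly l b)" and ?v = "\<lambda>i\<in>{..<l}. \<phi> (w i)"
  let ?t = "\<lambda>m. ?f m \<otimes> (\<Otimes>i\<in>set_mset m. ?v i [^] count m i)"
  have supp: "{m. ?f m \<noteq> \<zero>} \<subseteq> (\<lambda>j. {#j#}) ` {..<l}"
  proof
    fix m assume "m \<in> {m. ?f m \<noteq> \<zero>}"
    then have "coeff_at (linear_poly l b) m \<noteq> 0" by (auto simp: map_poly_ring_def)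
    then show "m \<in> (\<lambda>j. {#j#}) ` {..<l}"
      by (auto simp: lookup_linear_poly elim!: sum.not_neutral_contains_not_neutral split: if_splits)
  qed
  have t: "?t {#j#} = \<phi> (b j * w j)" if "j < l" for j
    using that by (simp add: map_poly_ring_def \<phi>_mult)
  \<comment> \<open>Evaluation sums over the monomials with nonzero coefficient; extending the sum
    to all variables only adds zeros.\<close>
  have "mpoly_eval R ?f ?v = (\<Oplus>m\<in>(\<lambda>j. {#j#}) ` {..<l}. ?t m)"
    unfolding mpoly_eval_def
  proof (rule add.finprod_mono_neutral_cong_left)
    show "?t m = \<zero>" if "m \<in> (\<lambda>j. {#j#}) ` {..<l} - {m. ?f m \<noteq> \<zero>}" for m
    proof -
      from that obtain j where "j < l" "m = {#j#}" "?f m = \<zero>" by auto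
      then show ?thesis by simp
    qed
  qed (use supp t in auto)
  also have "\<dots> = (\<Oplus>j\<in>{..<l}. ?t {#j#})"
    by (rule add.finprod_reindex) (auto simp: inj_on_def t)
  also have "\<dots> = (\<Oplus>j\<in>{..<l}. \<phi> (b j * w j))"
    by (rule finsum_cong') (auto simp: map_poly_ring_def \<phi>_mult)
  finally show ?thesis by (simp add: finsum_\<phi>)
qed

lemma mem_hyperplane_iff:
  "(\<lambda>i\<in>{..<l}. \<phi> (w i)) \<in> hyperplane R l (map_poly_ring (linear_poly l b)) \<longleftrightarrow>
    p dvd (\<Sum>j<l. b j * w j)"
  by (simp add: hyperplane_def mpoly_eval_linear \<phi>_eq_0_iff)

lemma hyperplane_eq_iff:
  "hyperplane R l (map_poly_ring (linear_poly l a)) = hyperplane R l (map_poly_ring (linear_poly l b)) \<longleftrightarrow>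
    (\<forall>w. p dvd (\<Sum>j<l. a j * w j) \<longleftrightarrow> p dvd (\<Sum>j<l. b j * w j))"
proof
  assume "\<forall>w. p dvd (\<Sum>j<l. a j * w j) \<longleftrightarrow> p dvd (\<Sum>j<l. b j * w j)"
  moreover have "\<exists>w. v = (\<lambda>i\<in>{..<l}. \<phi> (w i))" if "v \<in> {..<l} \<rightarrow>\<^sub>E carrier R" for v
  proof -
    have "\<forall>i. \<exists>w. i < l \<longrightarrow> v i = \<phi> w"
      using that range_\<phi> by (metis PiE_mem imageE lessThan_iff)
    then obtain w where "\<And>i. i < l \<Longrightarrow> v i = \<phi> (w i)" by metis
    then have "v = (\<lambda>i\<in>{..<l}. \<phi> (w i))" using that by (intro extensionalityI[of _ "{..<l}"]) (auto simp: PiE_def)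
    then show ?thesis by blast
  qed
  ultimately have "v \<in> hyperplane R l (map_poly_ring (linear_poly l a)) \<longleftrightarrow>
      v \<in> hyperplane R l (map_poly_ring (linear_poly l b))" if "v \<in> {..<l} \<rightarrow>\<^sub>E carrier R" for v
    using that mem_hyperplane_iff by metis
  then show "hyperplane R l (map_poly_ring (linear_poly l a)) = hyperplane R l (map_poly_ring (linear_poly l b))"
    unfolding hyperplane_def by blast
qed (metis mem_hyperplane_iff)

section \<open>Derivations over the coefficient ring\<close>

definition map_der :: "nat \<Rightarrow> (nat \<Rightarrow> 'c mpoly) \<Rightarrow> nat \<Rightarrow> nat multiset \<Rightarrow> 'a" where
  "map_der l \<delta> = (\<lambda>i\<in>{..<l}. map_poly_ring (\<delta> i))"

lemma map_der_eq_iff: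
  "map_der l \<delta> = map_der l \<epsilon> \<longleftrightarrow> (\<forall>j<l. cong_mod (Const p) (\<delta> j) (\<epsilon> j))"
proof
  assume eq: "map_der l \<delta> = map_der l \<epsilon>"
  show "\<forall>j<l. cong_mod (Const p) (\<delta> j) (\<epsilon> j)"
    using fun_cong[OF eq] by (auto simp: map_der_def map_poly_ring_eq_iff[symmetric] dest: spec)
      (metis lessThan_iff restrict_apply')
qed (auto simp: map_der_def map_poly_ring_eq_iff[symmetric])

lemma map_der_closed:
  "(\<And>j. j < l \<Longrightarrow> \<delta> j \<in> vars_below l) \<Longrightarrow> map_der l \<delta> \<in> carrier (der_module R l)"
  by (auto simp: map_der_def der_module_def map_poly_ring_closed)

lemma der_lift:
  assumes "x \<in> carrier (der_module R l)"
  obtains \<delta> where "\<And>j. j < l \<Longrightarrow> \<delta> j \<in> vars_below l" "x = map_der l \<delta>"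
    "\<And>d j. der_homogeneous R l d x \<Longrightarrow> j < l \<Longrightarrow> homog d (\<delta> j)"
proof -
  have x: "x \<in> {..<l} \<rightarrow>\<^sub>E carrier (mpoly_ring R l)" using assms by (simp add: der_module_def)
  have "\<forall>j. \<exists>F. j < l \<longrightarrow>
      F \<in> vars_below l \<and> x j = map_poly_ring F \<and> (\<forall>d. homogeneous R d (x j) \<longrightarrow> homog d F)"
    using x mpoly_ring_lift by (metis PiE_mem lessThan_iff)
  then obtain \<delta> where \<delta>: "\<And>j. j < l \<Longrightarrow>
      \<delta> j \<in> vars_below l \<and> x j = map_poly_ring (\<delta> j) \<and> (\<forall>d. homogeneous R d (x j) \<longrightarrow> homog d (\<delta> j))"
    by metis
  have "x = map_der l \<delta>"
    using x \<delta> by (intro extensionalityI[of _ "{..<l}"]) (auto simp: map_der_def PiE_def)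
  then show thesis using \<delta> by (intro that) (auto simp: der_homogeneous_def)
qed

lemma der_module_add [simp]:
  "map_der l \<delta> \<oplus>\<^bsub>der_module R l\<^esub> map_der l \<epsilon> = map_der l (\<lambda>j. \<delta> j + \<epsilon> j)"
  by (auto simp: der_module_def map_der_def)

lemma der_module_zero: "\<zero>\<^bsub>der_module R l\<^esub> = map_der l (\<lambda>_. 0)"
  by (auto simp: der_module_def map_der_def mpoly_ring_zero)

lemma der_module_smult [simp]:
  "map_poly_ring f \<odot>\<^bsub>der_module R l\<^esub> map_der l \<delta> = map_der l (\<lambda>j. f * \<delta> j)"
  by (auto simp: der_module_def map_der_def)

text \<open>The derivation applied to the form is represented by the sum on the right. Membership in
  the principal ideal asks for a cofactor in \<open>l\<close> variables, which
  \<open>dvd_mod_vars_below\<close> supplies.\<close>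

lemma der_apply_mem_PIdl_iff:
  assumes "\<And>j. j < l \<Longrightarrow> \<delta> j \<in> vars_below l"
  shows "der_apply R l (map_der l \<delta>) (map_poly_ring (linear_poly l b)) \<in>
      PIdl\<^bsub>mpoly_ring R l\<^esub> (map_poly_ring (linear_poly l b)) \<longleftrightarrow>
    dvd_mod (Const p) (linear_poly l b) (\<Sum>j<l. Const (b j) * \<delta> j)"
proof -
  interpret S: cring "mpoly_ring R l" by (rule cring_mpoly_ring)
  let ?s = "\<Sum>j<l. Const (b j) * \<delta> j"
  have s: "?s \<in> vars_below l" using assms by (intro vars_below_sum vars_below_mult) auto
  have "der_apply R l (map_der l \<delta>) (map_poly_ring (linear_poly l b)) =
      (\<Oplus>\<^bsub>mpoly_ring R l\<^esub>j\<in>{..<l}. map_poly_ring (Const (b j) * \<delta> j))"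
    unfolding der_apply_def
    using assms
    by (intro S.finsum_cong')
       (auto simp: map_der_def partial_deriv_linear mult.commute intro!: map_poly_ring_closed vars_below_mult)
  also have "\<dots> = map_poly_ring ?s"
    using assms by (intro finsum_mpoly_ring) (auto intro: vars_below_mult)
  finally have eq: "der_apply R l (map_der l \<delta>) (map_poly_ring (linear_poly l b)) = map_poly_ring ?s" .
  have "map_poly_ring ?s \<in> PIdl\<^bsub>mpoly_ring R l\<^esub> (map_poly_ring (linear_poly l b)) \<longleftrightarrow>
      (\<exists>h\<in>vars_below l. map_poly_ring ?s = map_poly_ring (h * linear_poly l b))"
    unfolding cgenideal_def carrier_mpoly_ring
    unfolding mem_Collect_eq mpoly_ring_mult[where l = l, symmetric] by blast
  also have "\<dots> \<longleftrightarrow> dvd_mod (Const p) (linear_poly l b) ?s"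
  proof
    assume "\<exists>h\<in>vars_below l. map_poly_ring ?s = map_poly_ring (h * linear_poly l b)"
    then obtain h where "cong_mod (Const p) ?s (linear_poly l b * h)"
      by (auto simp: map_poly_ring_eq_iff mult.commute)
    then show "dvd_mod (Const p) (linear_poly l b) ?s" by (rule cong_mod_imp_dvd_mod)
  next
    assume "dvd_mod (Const p) (linear_poly l b) ?s"
    then obtain h where "h \<in> vars_below l" "cong_mod (Const p) ?s (linear_poly l b * h)"
      by (rule dvd_mod_vars_below[OF _ vars_below_linear_poly s])
    then show "\<exists>h\<in>vars_below l. map_poly_ring ?s = map_poly_ring (h * linear_poly l b)"
      by (auto simp: map_poly_ring_eq_iff mult.commute intro!: bexI[of _ h])
  qed
  finally show ?thesis by (simp add: eq)
qed

end

end

section \<open>Logarithmic derivations\<close>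

definition homog_log_der ::
    "'c::comm_ring_1 \<Rightarrow> nat \<Rightarrow> nat \<Rightarrow> (nat \<Rightarrow> nat \<Rightarrow> 'c) \<Rightarrow> nat \<Rightarrow> (nat \<Rightarrow> 'c mpoly) \<Rightarrow> bool" where
  "homog_log_der p l n a d \<delta> \<longleftrightarrow> (\<forall>j<l. \<delta> j \<in> vars_below l \<and> homog d (\<delta> j)) \<and>
    (\<forall>k<n. dvd_mod (Const p) (linear_poly l (a k)) (\<Sum>j<l. Const (a k j) * \<delta> j))"

text \<open>Saito's criterion for homogeneous derivations, taken as a substitute for freeness. It
  mentions no ring record, so that it can be compared for different \<open>p\<close>, and it also
  makes sense over the integers with \<open>p = 0\<close>.\<close>

definition saito_free :: "'c::comm_ring_1 \<Rightarrow> nat \<Rightarrow> nat \<Rightarrow> (nat \<Rightarrow> nat \<Rightarrow> 'c) \<Rightarrow> (nat \<Rightarrow> nat) \<Rightarrow> bool" where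
  "saito_free p l n a e \<longleftrightarrow> (\<Sum>i<l. e i) = n \<and>
    (\<exists>\<delta>. (\<forall>i<l. homog_log_der p l n a (e i) (\<delta> i)) \<and> \<not> Const p dvd det_of l \<delta>)"

locale coeff_field = coeff_hom R \<phi> p for R (structure) and \<phi> :: "'c::comm_ring_1 \<Rightarrow> 'a" and p +
  fixes l n :: nat and a :: "nat \<Rightarrow> nat \<Rightarrow> 'c"
  assumes prime_like: "prime_like p"
    and invertible: "\<not> p dvd x \<Longrightarrow> \<exists>u. cong_mod p (x * u) 1"
    and nonzero: "i < n \<Longrightarrow> \<exists>k<l. \<not> p dvd a i k"
    and non_proportional: "i < n \<Longrightarrow> i' < n \<Longrightarrow> i \<noteq> i' \<Longrightarrow> \<not> (\<forall>j<l. cong_mod p (a i' j) (c * a i j))"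
begin

lemma linear_poly_pivot: "i < n \<Longrightarrow> \<exists>k<l. \<exists>u. cong_mod p (a i k * u) 1"
  using nonzero invertible by blast

sublocale forms: linear_forms_mod "Const p" l n "\<lambda>i j. Const (a i j)" Var "\<lambda>i. linear_poly l (a i)"
    "\<Prod>i<n. linear_poly l (a i)"
proof unfold_locales
  show "linear_poly l (a i) = (\<Sum>j<l. Const (a i j) * Var j)" for i
    by (rule linear_poly_def)
  show "prime_like (Const p :: 'c mpoly)"
    using prime_like by (rule prime_like_Const)
  show prime: "prime_mod (Const p) (linear_poly l (a i))" if "i < n" for i
    using prime_mod_linear_poly[OF prime_like] linear_poly_pivot[OF that] by blast
  show "\<not> dvd_mod (Const p) (linear_poly l (a i)) (linear_poly l (a j))"
    if "i < n" "j < n" "i \<noteq> j" for i j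
  proof
    assume "dvd_mod (Const p) (linear_poly l (a i)) (linear_poly l (a j))"
    then obtain h where "cong_mod (Const p) (linear_poly l (a j)) (linear_poly l (a i) * h)"
      by (auto simp: dvd_mod_def)
    \<comment> \<open>Both forms have degree 1, so the cofactor may be replaced by its constant
      term, which would be a factor of proportionality.\<close>
    then have c: "cong_mod (Const p) (linear_poly l (a j))
        (linear_poly l (a i) * Const (coeff_at h {#}))"
      by (rule homog_factor_eq[OF homog_linear_poly homog_linear_poly])
    have "cong_mod p (a j k) (coeff_at h {#} * a i k)" if "k < l" for k
    proof -
      have "p dvd coeff_at (linear_poly l (a j) - linear_poly l (a i) * Const (coeff_at h {#})) {#k#}"
        using c by (auto simp: cong_mod_def Const_dvd_iff)
      then show ?thesis
        using that by (simp add: cong_mod_def lookup_minus mult.commute[of "linear_poly l (a i)"])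
    qed
    then show False using non_proportional that by blast
  qed
  show "\<exists>k<l. \<exists>u. cong_mod (Const p) (Const (a i k) * u) 1" if i: "i < n" for i
  proof -
    obtain k u where "k < l" "cong_mod p (a i k * u) 1" using linear_poly_pivot[OF i] by blast
    moreover from this have "cong_mod (Const p) (Const (a i k) * Const u) (1 :: 'c mpoly)"
      by (auto simp: cong_mod_def Const_dvd_iff lookup_minus mult_single lookup_one lookup_single when_def)
    ultimately show ?thesis by blast
  qed
qed (rule refl)

definition arrangement :: "(nat \<Rightarrow> 'a) set set" where
  "arrangement = (\<lambda>i. hyperplane R l (map_poly_ring (linear_poly l (a i)))) ` {..<n}"

text \<open>Points with at most two nonzero coordinates suffice, so this holds over finite fields
  too. The point with \<open>a i k\<close> at \<open>j\<close> and \<open>- a i j\<close> at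
  \<open>k\<close> lies on the hyperplane of \<open>a i\<close>; on that of \<open>b\<close> it
  gives a vanishing minor, and dividing by the pivot \<open>a i k\<close> yields the factor
  \<open>b k * u\<close>.\<close>

lemma hyperplane_eq_imp_proportional:
  assumes i: "i < n"
    and eq: "hyperplane R l (map_poly_ring (linear_poly l b)) = hyperplane R l (map_poly_ring (linear_poly l (a i)))"
  obtains c where "\<And>j. j < l \<Longrightarrow> cong_mod p (b j) (c * a i j)"
proof -
  obtain k u where k: "k < l" and u: "cong_mod p (a i k * u) 1" using linear_poly_pivot[OF i] by blast
  show thesis
  proof (rule that[of "b k * u"])
    fix j assume j: "j < l"
    have *: "(\<Sum>r<l. f r * (if r = j then a i k else 0)) - (\<Sum>r<l. f r * (if r = k then a i j else 0)) =
      f j * a i k - f k * a i j" for f :: "nat \<Rightarrow> 'c"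
      using j k by (simp add: if_distrib cong: if_cong)
    define w where "w r = (if r = j then a i k else 0) - (if r = k then a i j else 0)" for r
    have sum_w: "(\<Sum>r<l. f r * w r) = f j * a i k - f k * a i j" for f :: "nat \<Rightarrow> 'c"
      unfolding w_def right_diff_distrib sum_subtractf * ..
    have "p dvd (\<Sum>r<l. a i r * w r)" unfolding sum_w by (simp add: mult.commute)
    then have "p dvd b j * a i k - b k * a i j" using eq sum_w by (metis hyperplane_eq_iff)
    then have "p dvd (b j * a i k - b k * a i j) * u" by simp
    moreover have "p dvd b j * (a i k * u - 1)" using u by (simp add: cong_mod_def)
    ultimately have "p dvd (b j * a i k - b k * a i j) * u - b j * (a i k * u - 1)" by (rule dvd_diff)
    then show "cong_mod p (b j) (b k * u * a i j)" by (simp add: cong_mod_def algebra_simps)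
  qed
qed

lemma log_derivations_iff:
  assumes \<delta>: "\<And>j. j < l \<Longrightarrow> \<delta> j \<in> vars_below l"
  shows "map_der l \<delta> \<in> log_derivations R l arrangement \<longleftrightarrow> forms.logarithmic \<delta>"
proof
  assume L: "map_der l \<delta> \<in> log_derivations R l arrangement"
  show "forms.logarithmic \<delta>"
    unfolding forms.logarithmic_def
  proof (intro allI impI)
    fix i assume i: "i < n"
    then have "nonzero_linear_form R l (map_poly_ring (linear_poly l (a i)))"
      using nonzero nonzero_linear_form_iff by blast
    with L i show "dvd_mod (Const p) (linear_poly l (a i)) (\<Sum>j<l. Const (a i j) * \<delta> j)"
      by (auto simp: log_derivations_def arrangement_def der_apply_mem_PIdl_iff[OF \<delta>, symmetric])
  qed
next
  assume log: "forms.logarithmic \<delta>"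
  show "map_der l \<delta> \<in> log_derivations R l arrangement"
    unfolding log_derivations_def mem_Collect_eq
  proof (intro conjI allI impI)
    show "map_der l \<delta> \<in> carrier (der_module R l)" by (rule map_der_closed) (rule \<delta>)
    fix \<beta> assume \<beta>: "nonzero_linear_form R l \<beta> \<and> hyperplane R l \<beta> \<in> arrangement"
    then obtain b where b: "\<beta> = map_poly_ring (linear_poly l b)" and nz: "\<exists>j<l. \<not> p dvd b j"
      using nonzero_linear_form_iff by auto
    from \<beta> b obtain i where i: "i < n"
      "hyperplane R l (map_poly_ring (linear_poly l b)) = hyperplane R l (map_poly_ring (linear_poly l (a i)))"
      by (auto simp: arrangement_def)
    then obtain c where c: "\<And>j. j < l \<Longrightarrow> cong_mod p (b j) (c * a i j)"
      using hyperplane_eq_imp_proportional by blast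
    have "\<not> p dvd c"
    proof
      assume "p dvd c"
      then have "p dvd b j" if "j < l" for j
        using c[OF that] dvd_add[of p "b j - c * a i j" "c * a i j"] by (simp add: cong_mod_def)
      then show False using nz by blast
    qed
    then obtain u where u: "cong_mod p (c * u) 1" using invertible by blast
    have Cc: "cong_mod (Const p) (Const (b j)) (Const c * Const (a i j))" if "j < l" for j
      using c[OF that] by (auto simp: cong_mod_def Const_dvd_iff lookup_minus mult_single lookup_single when_def)
    have Cu: "cong_mod (Const p) (Const c * Const u) (1 :: 'c mpoly)"
      using u by (auto simp: cong_mod_def Const_dvd_iff lookup_minus mult_single lookup_one lookup_single when_def)
    have lin: "cong_mod (Const p) (linear_poly l b) (Const c * linear_poly l (a i))"
      unfolding linear_poly_def sum_distrib_left mult.assoc[symmetric]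
      by (intro cong_mod_sum, intro cong_mod_mult[OF Cc]) auto
    obtain h where h: "cong_mod (Const p) (\<Sum>j<l. Const (a i j) * \<delta> j) (linear_poly l (a i) * h)"
      using log i(1) unfolding forms.logarithmic_def dvd_mod_def by blast
    \<comment> \<open>Both sides of the divisibility scale by \<open>c\<close>, so the cofactor
      \<open>h\<close> found for \<open>a i\<close> serves for \<open>b\<close> as well.\<close>
    have "cong_mod (Const p) (\<Sum>j<l. Const (b j) * \<delta> j) (Const c * (\<Sum>j<l. Const (a i j) * \<delta> j))"
      unfolding sum_distrib_left mult.assoc[symmetric]
      by (intro cong_mod_sum, intro cong_mod_mult[OF Cc]) auto
    also have "cong_mod (Const p) \<dots> (Const c * (linear_poly l (a i) * h))"
      using h by (intro cong_mod_mult) auto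
    also have "\<dots> = Const c * linear_poly l (a i) * h" by (simp add: mult.assoc)
    also have "cong_mod (Const p) \<dots> (linear_poly l b * h)"
      using lin by (intro cong_mod_mult) (auto intro: cong_mod_sym)
    finally have "dvd_mod (Const p) (linear_poly l b) (\<Sum>j<l. Const (b j) * \<delta> j)"
      by (rule cong_mod_imp_dvd_mod)
    then show "der_apply R l (map_der l \<delta>) \<beta> \<in> PIdl\<^bsub>mpoly_ring R l\<^esub> \<beta>"
      unfolding b using der_apply_mem_PIdl_iff \<delta> by blast
  qed
qed

section \<open>The module of logarithmic derivations and its bases\<close>

abbreviation "LM \<equiv> log_module R l arrangement"

lemma carrier_LM: "carrier LM = {map_der l \<delta> |\<delta>. (\<forall>j<l. \<delta> j \<in> vars_below l) \<and> forms.logarithmic \<delta>}"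
proof (intro Set.equalityI subsetI)
  fix x assume x: "x \<in> carrier LM"
  then have "x \<in> carrier (der_module R l)" by (simp add: log_module_def log_derivations_def)
  then obtain \<delta> where "\<And>j. j < l \<Longrightarrow> \<delta> j \<in> vars_below l" "x = map_der l \<delta>"
    by (rule der_lift) blast
  then show "x \<in> {map_der l \<delta> |\<delta>. (\<forall>j<l. \<delta> j \<in> vars_below l) \<and> forms.logarithmic \<delta>}"
    using x log_derivations_iff by (auto simp: log_module_def)
qed (auto simp: log_module_def log_derivations_iff)

lemma LM_ops:
  "add LM = add (der_module R l)" "\<zero>\<^bsub>LM\<^esub> = \<zero>\<^bsub>der_module R l\<^esub>" "module.smult LM = module.smult (der_module R l)"
  by (simp_all add: log_module_def)

lemma logarithmic_0: "forms.logarithmic (\<lambda>_. 0)"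
  by (simp add: forms.logarithmic_def)

lemma logarithmic_add:
  "forms.logarithmic \<delta> \<Longrightarrow> forms.logarithmic \<epsilon> \<Longrightarrow> forms.logarithmic (\<lambda>j. \<delta> j + \<epsilon> j)"
  by (simp add: forms.logarithmic_def distrib_left sum.distrib dvd_mod_add)

lemma logarithmic_mult: "forms.logarithmic \<delta> \<Longrightarrow> forms.logarithmic (\<lambda>j. f * \<delta> j)"
proof -
  have "(\<Sum>j<l. Const (a i j) * (f * \<delta> j)) = f * (\<Sum>j<l. Const (a i j) * \<delta> j)" for i
    by (simp add: sum_distrib_left mult_ac)
  then show "forms.logarithmic \<delta> \<Longrightarrow> forms.logarithmic (\<lambda>j. f * \<delta> j)"
    by (simp add: forms.logarithmic_def dvd_mod_mult)
qed

text \<open>The basis property involves only finite sums in \<open>LM\<close>, for which this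
  structure suffices.\<close>

lemma abelian_monoid_LM: "abelian_monoid LM"
proof (rule abelian_monoidI)
  show "\<zero>\<^bsub>LM\<^esub> \<in> carrier LM"
    by (auto simp: LM_ops der_module_zero carrier_LM intro!: exI[of _ "\<lambda>_. 0"] logarithmic_0)
  fix x y assume "x \<in> carrier LM" "y \<in> carrier LM"
  then obtain \<delta> \<epsilon> where "x = map_der l \<delta>" "\<forall>j<l. \<delta> j \<in> vars_below l" "forms.logarithmic \<delta>"
      "y = map_der l \<epsilon>" "\<forall>j<l. \<epsilon> j \<in> vars_below l" "forms.logarithmic \<epsilon>"
    by (auto simp: carrier_LM)
  then show "x \<oplus>\<^bsub>LM\<^esub> y \<in> carrier LM"
    by (auto simp: LM_ops carrier_LM intro!: exI[of _ "\<lambda>j. \<delta> j + \<epsilon> j"] logarithmic_add vars_below_add)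
qed (auto simp: carrier_LM LM_ops der_module_zero add_ac)

lemma finsum_LM:
  assumes "finite I" "\<And>i j. i \<in> I \<Longrightarrow> j < l \<Longrightarrow> \<delta> i j \<in> vars_below l"
    "\<And>i. i \<in> I \<Longrightarrow> forms.logarithmic (\<delta> i)"
  shows "(\<Oplus>\<^bsub>LM\<^esub>i\<in>I. map_der l (\<delta> i)) = map_der l (\<lambda>j. \<Sum>i\<in>I. \<delta> i j)"
proof -
  interpret M: abelian_monoid LM by (rule abelian_monoid_LM)
  show ?thesis
    using assms
  proof induction
    case empty
    then show ?case by (simp add: LM_ops der_module_zero)
  next
    case (insert i I)
    then have "(\<Oplus>\<^bsub>LM\<^esub>i\<in>insert i I. map_der l (\<delta> i)) =
        map_der l (\<delta> i) \<oplus>\<^bsub>LM\<^esub> (\<Oplus>\<^bsub>LM\<^esub>i\<in>I. map_der l (\<delta> i))"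
      by (intro M.finsum_insert) (auto simp: carrier_LM)
    then show ?case using insert by (simp add: LM_ops)
  qed
qed

lemma linear_combination_LM:
  assumes "\<And>i j. i < l \<Longrightarrow> j < l \<Longrightarrow> \<delta> i j \<in> vars_below l" "\<And>i. i < l \<Longrightarrow> forms.logarithmic (\<delta> i)"
    "\<And>i. i < l \<Longrightarrow> f i \<in> vars_below l" "\<And>i. i < l \<Longrightarrow> b i = map_der l (\<delta> i)"
    "\<And>i. i < l \<Longrightarrow> c i = map_poly_ring (f i)"
  shows "(\<Oplus>\<^bsub>LM\<^esub>i\<in>{..<l}. c i \<odot>\<^bsub>LM\<^esub> b i) = map_der l (\<lambda>j. \<Sum>i<l. f i * \<delta> i j)"
proof -
  interpret M: abelian_monoid LM by (rule abelian_monoid_LM)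
  have *: "forms.logarithmic (\<lambda>j. f i * \<delta> i j) \<and> (\<forall>j<l. f i * \<delta> i j \<in> vars_below l)" if "i < l" for i
    using assms that by (auto intro: logarithmic_mult vars_below_mult)
  have "(\<Oplus>\<^bsub>LM\<^esub>i\<in>{..<l}. c i \<odot>\<^bsub>LM\<^esub> b i) = (\<Oplus>\<^bsub>LM\<^esub>i\<in>{..<l}. map_der l (\<lambda>j. f i * \<delta> i j))"
    using * by (intro M.finsum_cong') (auto simp: LM_ops assms(4,5), auto simp: carrier_LM)
  also have "\<dots> = map_der l (\<lambda>j. \<Sum>i<l. f i * \<delta> i j)"
    using * by (intro finsum_LM) auto
  finally show ?thesis .
qed

lemma PiE_mpoly_ring_lift:
  assumes "c \<in> {..<l} \<rightarrow>\<^sub>E carrier (mpoly_ring R l)"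
  obtains f where "\<And>i. i < l \<Longrightarrow> f i \<in> vars_below l" "\<And>i. i < l \<Longrightarrow> c i = map_poly_ring (f i)"
proof -
  have "\<forall>i. \<exists>F. i < l \<longrightarrow> F \<in> vars_below l \<and> c i = map_poly_ring F"
    using assms by (metis PiE_mem carrier_mpoly_ring imageE lessThan_iff)
  then show thesis using that by metis
qed

text \<open>For a basis, the determinant and \<open>Q\<close> divide each other modulo
  \<open>p\<close>, so their degrees \<open>\<Sum>i<l. e i\<close> and \<open>n\<close> agree.
  Conversely, if the degrees agree, the cofactor of \<open>Q\<close> in the determinant may be taken
  to be a scalar; it is nonzero because the determinant is, hence invertible as
  \<open>saito_sufficient\<close> requires.\<close>

lemma is_module_basis_iff:
  assumes \<delta>: "\<And>i j. i < l \<Longrightarrow> j < l \<Longrightarrow> \<delta> i j \<in> vars_below l" "\<And>i. i < l \<Longrightarrow> forms.logarithmic (\<delta> i)"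
    and b: "\<And>i. i < l \<Longrightarrow> b i = map_der l (\<delta> i)"
    and homog: "\<And>i j. i < l \<Longrightarrow> j < l \<Longrightarrow> homog (e i) (\<delta> i j)"
  shows "is_module_basis (mpoly_ring R l) LM {..<l} b \<longleftrightarrow>
    (\<Sum>i<l. e i) = n \<and> \<not> Const p dvd det_of l \<delta>"
proof
  let ?Q = "\<Prod>i<n. linear_poly l (a i)"
  have homog_Q: "homog n ?Q"
  proof -
    have "homog (\<Sum>i<n. 1) ?Q" by (intro homog_prod homog_linear_poly)
    then show ?thesis by simp
  qed
  have homog_det: "homog (\<Sum>i<l. e i) (det_of l \<delta>)"
    using homog by (intro homog_det_of) auto
  {
    assume basis: "is_module_basis (mpoly_ring R l) LM {..<l} b"
    have "\<not> Const p dvd det_of l \<delta> \<and> dvd_mod (Const p) (det_of l \<delta>) ?Q"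
    proof (rule forms.saito_necessary[where T = "vars_below l"])
      fix \<eta> assume \<eta>: "forms.logarithmic \<eta>" "\<And>j. j < l \<Longrightarrow> \<eta> j \<in> vars_below l"
      then have "map_der l \<eta> \<in> carrier LM" by (auto simp: carrier_LM)
      then obtain c where c: "c \<in> {..<l} \<rightarrow>\<^sub>E carrier (mpoly_ring R l)"
        "map_der l \<eta> = (\<Oplus>\<^bsub>LM\<^esub>i\<in>{..<l}. c i \<odot>\<^bsub>LM\<^esub> b i)"
        using basis unfolding is_module_basis_def by blast
      from PiE_mpoly_ring_lift[OF c(1)] obtain f where
        "\<And>i. i < l \<Longrightarrow> f i \<in> vars_below l" "\<And>i. i < l \<Longrightarrow> c i = map_poly_ring (f i)" by blast
      then have "map_der l \<eta> = map_der l (\<lambda>j. \<Sum>i<l. f i * \<delta> i j)"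
        using c(2) linear_combination_LM[of \<delta> f b c] \<delta> b by simp
      then show "\<exists>f. \<forall>j<l. cong_mod (Const p) (\<eta> j) (\<Sum>i<l. f i * \<delta> i j)"
        by (auto simp: map_der_eq_iff)
    qed (use \<delta>(2) in \<open>auto intro: vars_below_add vars_below_mult vars_below_uminus\<close>)
    moreover from this have "(\<Sum>i<l. e i) \<le> n"
      using homog_factor_le[OF homog_Q homog_det] forms.Q_not_dvd by (auto simp: dvd_mod_def)
    moreover have "n \<le> (\<Sum>i<l. e i)"
      using homog_factor_le[OF homog_det homog_Q] forms.dvd_det_of_logarithmic[of \<delta>] \<delta>(2) calculation
      by (auto simp: dvd_mod_def)
    ultimately show "(\<Sum>i<l. e i) = n \<and> \<not> Const p dvd det_of l \<delta>" by simp
  }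
  {
    assume asm: "(\<Sum>i<l. e i) = n \<and> \<not> Const p dvd det_of l \<delta>"
    obtain g where "cong_mod (Const p) (det_of l \<delta>) (?Q * g)"
      using forms.dvd_det_of_logarithmic[of \<delta>] \<delta>(2) by (auto simp: dvd_mod_def)
    then have det: "cong_mod (Const p) (det_of l \<delta>) (?Q * Const (coeff_at g {#}))"
      using homog_factor_eq homog_det homog_Q asm by blast
    have "\<not> p dvd coeff_at g {#}"
    proof
      assume "p dvd coeff_at g {#}"
      then have "Const p dvd Const (coeff_at g {#})"
        by (auto simp: Const_dvd_iff lookup_single when_def)
      then have "Const p dvd (det_of l \<delta> - ?Q * Const (coeff_at g {#})) + ?Q * Const (coeff_at g {#})"
        using det by (intro dvd_add) (auto simp: cong_mod_def)
      then show False using asm by simp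
    qed
    then obtain u where "cong_mod p (coeff_at g {#} * u) 1" using invertible by blast
    then have u: "cong_mod (Const p) (Const (coeff_at g {#}) * Const u) (1 :: 'c mpoly)"
      by (auto simp: cong_mod_def Const_dvd_iff lookup_minus mult_single lookup_one lookup_single when_def)
    show "is_module_basis (mpoly_ring R l) LM {..<l} b"
      unfolding is_module_basis_def
    proof (intro conjI ballI)
      show "b \<in> {..<l} \<rightarrow> carrier LM" using \<delta> b by (auto simp: carrier_LM)
      fix x assume "x \<in> carrier LM"
      then obtain \<eta> where \<eta>: "x = map_der l \<eta>" "\<And>j. j < l \<Longrightarrow> \<eta> j \<in> vars_below l" "forms.logarithmic \<eta>"
        by (auto simp: carrier_LM)
      obtain f where f: "\<And>j. j < l \<Longrightarrow> cong_mod (Const p) (\<eta> j) (\<Sum>i<l. f i * \<delta> i j)"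
        using forms.saito_sufficient[of \<delta> \<eta>, OF _ \<eta>(3) det u] \<delta>(2) by blast
      \<comment> \<open>The coefficients obtained so far may involve variables from \<open>l\<close>
        on. Setting these to \<open>0\<close> keeps the congruence because \<open>\<eta>\<close> and
        \<open>\<delta>\<close> do not contain them.\<close>
      define f' where "f' i = restrict_vars l (f i)" for i
      have f': "cong_mod (Const p) (\<eta> j) (\<Sum>i<l. f' i * \<delta> i j)" if "j < l" for j
        using cong_mod_restrict_vars[OF f[OF that], of l] that \<eta>(2) \<delta>(1)
        by (simp add: restrict_vars_id restrict_vars_sum f'_def restrict_vars_mult[of "\<delta> _ j" l "f _"]
            mult.commute[of _ "\<delta> _ j"])
      show "\<exists>!c. c \<in> {..<l} \<rightarrow>\<^sub>E carrier (mpoly_ring R l) \<and> x = (\<Oplus>\<^bsub>LM\<^esub>i\<in>{..<l}. c i \<odot>\<^bsub>LM\<^esub> b i)"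
      proof (rule ex1I)
        let ?c = "\<lambda>i\<in>{..<l}. map_poly_ring (f' i)"
        have "(\<Oplus>\<^bsub>LM\<^esub>i\<in>{..<l}. ?c i \<odot>\<^bsub>LM\<^esub> b i) = map_der l (\<lambda>j. \<Sum>i<l. f' i * \<delta> i j)"
          by (rule linear_combination_LM) (use \<delta> b in \<open>auto simp: f'_def\<close>)
        then show "?c \<in> {..<l} \<rightarrow>\<^sub>E carrier (mpoly_ring R l) \<and> x = (\<Oplus>\<^bsub>LM\<^esub>i\<in>{..<l}. ?c i \<odot>\<^bsub>LM\<^esub> b i)"
          using f' by (auto simp: f'_def map_poly_ring_closed \<eta>(1) map_der_eq_iff)
        fix c assume c: "c \<in> {..<l} \<rightarrow>\<^sub>E carrier (mpoly_ring R l) \<and> x = (\<Oplus>\<^bsub>LM\<^esub>i\<in>{..<l}. c i \<odot>\<^bsub>LM\<^esub> b i)"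
        then obtain g where g: "\<And>i. i < l \<Longrightarrow> g i \<in> vars_below l" "\<And>i. i < l \<Longrightarrow> c i = map_poly_ring (g i)"
          using PiE_mpoly_ring_lift by blast
        have "map_der l \<eta> = map_der l (\<lambda>j. \<Sum>i<l. g i * \<delta> i j)"
          using c \<eta>(1) linear_combination_LM[of \<delta> g b c] \<delta> b g by simp
        then have "cong_mod (Const p) (\<Sum>i<l. g i * \<delta> i j) (\<Sum>i<l. f' i * \<delta> i j)" if "j < l" for j
          using f'[OF that] that by (meson cong_mod_sym cong_mod_trans map_der_eq_iff)
        then have "cong_mod (Const p) (g k) (f' k)" if "k < l" for k
          using forms.coefficients_unique asm that by blast
        then show "c = ?c"
          using c g(2) by (intro extensionalityI[of _ "{..<l}"]) (auto simp: PiE_def map_poly_ring_eq_iff)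
      qed
    qed
  }
qed

theorem free_with_exponents_iff:
  "free_with_exponents R l arrangement e \<longleftrightarrow> saito_free p l n a e"
proof
  assume "free_with_exponents R l arrangement e"
  then obtain b where basis: "is_module_basis (mpoly_ring R l) LM {..<l} b"
    and hom: "\<And>i. i < l \<Longrightarrow> der_homogeneous R l (e i) (b i)"
    by (auto simp: free_with_exponents_def)
  have "\<exists>\<delta>. i < l \<longrightarrow> b i = map_der l \<delta> \<and> forms.logarithmic \<delta> \<and>
    (\<forall>j<l. \<delta> j \<in> vars_below l \<and> homog (e i) (\<delta> j))" for i
  proof (cases "i < l")
    case True
    then have "b i \<in> log_derivations R l arrangement"
      using basis by (auto simp: is_module_basis_def log_module_def)
    moreover from this have "b i \<in> carrier (der_module R l)" by (simp add: log_derivations_def)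
    then obtain \<delta> where "\<And>j. j < l \<Longrightarrow> \<delta> j \<in> vars_below l" "b i = map_der l \<delta>"
      "\<And>d j. der_homogeneous R l d (b i) \<Longrightarrow> j < l \<Longrightarrow> homog d (\<delta> j)"
      by (rule der_lift) blast
    ultimately show ?thesis using log_derivations_iff hom[OF True] by metis
  qed simp
  then obtain \<delta> where \<delta>: "\<And>i. i < l \<Longrightarrow> b i = map_der l (\<delta> i) \<and> forms.logarithmic (\<delta> i) \<and>
    (\<forall>j<l. \<delta> i j \<in> vars_below l \<and> homog (e i) (\<delta> i j))" by metis
  have "(\<Sum>i<l. e i) = n \<and> \<not> Const p dvd det_of l \<delta>"
    using is_module_basis_iff[of \<delta> b e] \<delta> basis by blast
  then show "saito_free p l n a e"
    unfolding saito_free_def homog_log_der_def using \<delta> by (auto simp: forms.logarithmic_def)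
next
  assume "saito_free p l n a e"
  then obtain \<delta> where \<delta>: "\<And>i j. i < l \<Longrightarrow> j < l \<Longrightarrow> \<delta> i j \<in> vars_below l \<and> homog (e i) (\<delta> i j)"
    "\<And>i. i < l \<Longrightarrow> forms.logarithmic (\<delta> i)" "(\<Sum>i<l. e i) = n" "\<not> Const p dvd det_of l \<delta>"
    by (auto simp: saito_free_def homog_log_der_def forms.logarithmic_def)
  then have "is_module_basis (mpoly_ring R l) LM {..<l} (\<lambda>i. map_der l (\<delta> i))"
    using is_module_basis_iff[of \<delta> "\<lambda>i. map_der l (\<delta> i)" e] by blast
  moreover have "der_homogeneous R l (e i) (map_der l (\<delta> i))" if "i < l" for i
    using \<delta>(1) that by (auto simp: der_homogeneous_def map_der_def homogeneous_map_poly_ring)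
  ultimately show "free_with_exponents R l arrangement e"
    unfolding free_with_exponents_def by blast
qed

lemma square_free_prod:
  "square_free (mpoly_ring R l) (map_poly_ring (\<Prod>i<n. linear_poly l (a i)))"
  unfolding square_free_def
proof (intro ballI impI)
  let ?Q = "\<Prod>i<n. linear_poly l (a i)"
  fix g assume "g \<in> carrier (mpoly_ring R l)"
    and dvd: "(g \<otimes>\<^bsub>mpoly_ring R l\<^esub> g) divides\<^bsub>mpoly_ring R l\<^esub> map_poly_ring ?Q"
  then obtain G where G: "G \<in> vars_below l" "g = map_poly_ring G" by (auto simp: carrier_mpoly_ring)
  with dvd obtain H where "cong_mod (Const p) ?Q (G * G * H)"
    by (auto simp: factor_def carrier_mpoly_ring map_poly_ring_eq_iff)
  then have "dvd_mod (Const p) G 1"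
    using square_free_prod_mod[OF forms.prime_like, of "{..<n}" "\<lambda>i. linear_poly l (a i)"]
      forms.prime forms.non_assoc by auto
  then obtain h where "h \<in> vars_below l" "cong_mod (Const p) 1 (G * h)"
    using dvd_mod_vars_below[OF _ G(1) vars_below_1] by blast
  then show "g \<in> Units (mpoly_ring R l)"
    unfolding Units_def G(2)
    using G(1) by (auto simp: mpoly_ring_one carrier_mpoly_ring map_poly_ring_eq_iff mult.commute
      intro!: bexI[of _ h] intro: cong_mod_sym)
qed

end

section \<open>Reduction modulo large primes\<close>

declare single_of_nat [simp del] single_of_int [simp del]

lemma prime_like_int: "Factorial_Ring.prime p \<Longrightarrow> prime_like (int p)"
  by (auto simp: prime_like_def prime_dvd_mult_iff)

lemma prime_int_inverse:
  assumes "Factorial_Ring.prime p" "\<not> int p dvd x"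
  obtains u where "int p dvd x * u - 1"
proof -
  have "coprime x (int p)"
    using assms prime_imp_coprime[of "int p" x] by (simp add: coprime_commute)
  then obtain u where "[x * u = 1] (mod int p)" using cong_solve_coprime_int by blast
  then show thesis using that by (simp add: cong_iff_dvd_diff)
qed

text \<open>The only source of bounds on \<open>p\<close>: it has to exceed the absolute values of
  finitely many nonzero integers determined before \<open>p\<close> is chosen.\<close>

lemma eventually_not_dvd_int: "(c :: int) \<noteq> 0 \<Longrightarrow> eventually (\<lambda>p. \<not> int p dvd c) sequentially"
  using eventually_gt_at_top[of "nat \<bar>c\<bar>"]
  by eventually_elim (auto dest: dvd_imp_le_int)

text \<open>
  By elimination of one unknown after another.  The lifted solution is rescaled by an inverse of
  the pivot modulo \<open>p\<close>, so that back substitution stays integral.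
\<close>

lemma lift_solution_mod:
  fixes E :: "('v \<Rightarrow> int) set"
  assumes "finite V" "finite E"
  shows "eventually (\<lambda>p. Factorial_Ring.prime p \<longrightarrow> (\<forall>v. (\<forall>a\<in>E. int p dvd (\<Sum>k\<in>V. a k * v k)) \<longrightarrow>
    (\<exists>w. (\<forall>a\<in>E. (\<Sum>k\<in>V. a k * w k) = 0) \<and> (\<forall>k\<in>V. int p dvd w k - v k)))) sequentially"
  using assms
proof (induction V arbitrary: E rule: finite_induct)
  case (insert x V)
  show ?case
  proof (cases "\<forall>a\<in>E. a x = 0")
    case True
    have sum: "(\<Sum>k\<in>insert x V. a k * v k) = (\<Sum>k\<in>V. a k * v k)" if "a \<in> E" for a v
      using insert.hyps True that by simp
    show ?thesis
      using insert.IH[OF insert.prems]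
    proof eventually_elim
      case (elim p)
      show ?case
      proof (intro impI allI)
        fix v assume "Factorial_Ring.prime p" "\<forall>a\<in>E. int p dvd (\<Sum>k\<in>insert x V. a k * v k)"
        with elim sum obtain w where w: "\<forall>a\<in>E. (\<Sum>k\<in>V. a k * w k) = 0" "\<forall>k\<in>V. int p dvd w k - v k"
          by auto
        \<comment> \<open>No equation involves \<open>x\<close>, so its value can be kept as it
          is.\<close>
        have "(\<Sum>k\<in>V. a k * (w(x := v x)) k) = (\<Sum>k\<in>V. a k * w k)" for a
          using insert.hyps by (intro sum.cong) auto
        then show "\<exists>w. (\<forall>a\<in>E. (\<Sum>k\<in>insert x V. a k * w k) = 0) \<and> (\<forall>k\<in>insert x V. int p dvd w k - v k)"
          using w sum by (intro exI[of _ "w(x := v x)"]) auto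
      qed
    qed
  next
    case False
    then obtain b where b: "b \<in> E" "b x \<noteq> 0" by blast
    \<comment> \<open>Cross-multiplication with the pivot equation \<open>b\<close> eliminates
      \<open>x\<close> without division. The pivot \<open>b x\<close> depends on \<open>E\<close>
      alone, so one bound on \<open>p\<close> serves all right choices of \<open>v\<close>.\<close>
    define E' where "E' = (\<lambda>a k. b x * a k - a x * b k) ` E"
    have "finite E'" using insert.prems by (simp add: E'_def)
    have sum': "(\<Sum>k\<in>V. (b x * a k - a x * b k) * v k) =
        b x * (\<Sum>k\<in>V. a k * v k) - a x * (\<Sum>k\<in>V. b k * v k)" for a v
      by (simp add: sum_distrib_left sum_subtractf left_diff_distrib mult.assoc)
    show ?thesis
      using insert.IH[OF \<open>finite E'\<close>] eventually_not_dvd_int[OF b(2)]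
    proof eventually_elim
      case (elim p)
      show ?case
      proof (intro impI allI)
        fix v assume p: "Factorial_Ring.prime p" and v: "\<forall>a\<in>E. int p dvd (\<Sum>k\<in>insert x V. a k * v k)"
        have v': "int p dvd a x * v x + (\<Sum>k\<in>V. a k * v k)" if "a \<in> E" for a
          using v that insert.hyps by auto
        have "int p dvd (\<Sum>k\<in>V. (b x * a k - a x * b k) * v k)" if "a \<in> E" for a
        proof -
          have "int p dvd b x * (a x * v x + (\<Sum>k\<in>V. a k * v k)) - a x * (b x * v x + (\<Sum>k\<in>V. b k * v k))"
            using v'[OF that] v'[OF b(1)] by (intro dvd_diff dvd_mult) auto
          then show ?thesis unfolding sum' by (simp add: algebra_simps)
        qed
        then have "\<forall>a\<in>E'. int p dvd (\<Sum>k\<in>V. a k * v k)" by (auto simp: E'_def)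
        with elim(1) p obtain w where "\<forall>a\<in>E'. (\<Sum>k\<in>V. a k * w k) = 0" and wv: "\<forall>k\<in>V. int p dvd w k - v k"
          by blast
        then have w: "b x * (\<Sum>k\<in>V. a k * w k) = a x * (\<Sum>k\<in>V. b k * w k)" if "a \<in> E" for a
          using that sum'[of a w] unfolding E'_def by (simp add: ball_simps)
        obtain u where u: "int p dvd b x * u - 1" using prime_int_inverse[OF p elim(2)] .
        \<comment> \<open>The factor \<open>u * b x\<close> is \<open>1\<close> modulo
          \<open>p\<close> and so preserves residues, while it supplies the divisor
          \<open>b x\<close> needed to solve the pivot equation for \<open>x\<close> over the
          integers.\<close>
        define w' where "w' k = (if k = x then - (u * (\<Sum>k\<in>V. b k * w k)) else u * b x * w k)" for k
        have "(\<Sum>k\<in>insert x V. a k * w' k) = 0" if "a \<in> E" for a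
        proof -
          have "(\<Sum>k\<in>V. a k * w' k) = (\<Sum>k\<in>V. u * (b x * (a k * w k)))"
            using insert.hyps by (intro sum.cong) (auto simp: w'_def)
          also have "\<dots> = u * (b x * (\<Sum>k\<in>V. a k * w k))"
            by (simp add: sum_distrib_left)
          also have "\<dots> = u * (a x * (\<Sum>k\<in>V. b k * w k))"
            by (simp only: w[OF that])
          finally show ?thesis using insert.hyps by (simp add: w'_def mult_ac)
        qed
        moreover have "int p dvd w' k - v k" if "k \<in> V" for k
        proof -
          have "int p dvd (b x * u - 1) * w k + (w k - v k)" using u wv that by (intro dvd_add) auto
          moreover have "k \<noteq> x" using that insert.hyps by auto
          ultimately show ?thesis by (simp add: w'_def algebra_simps)
        qed
        moreover have "int p dvd w' x - v x"
        proof -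
          have "int p dvd (\<Sum>k\<in>V. b k * (w k - v k))" using wv by (intro dvd_sum) auto
          then have "int p dvd (\<Sum>k\<in>V. b k * w k) - (\<Sum>k\<in>V. b k * v k)"
            by (simp add: sum_subtractf right_diff_distrib)
          \<comment> \<open>This combines three facts modulo \<open>p\<close>: \<open>u\<close>
            inverts \<open>b x\<close>, the pivot equation holds at \<open>v\<close>, and
            \<open>w\<close> agrees with \<open>v\<close> on \<open>V\<close>.\<close>
          then have "int p dvd (b x * u - 1) * v x - u * ((b x * v x + (\<Sum>k\<in>V. b k * v k)) +
              ((\<Sum>k\<in>V. b k * w k) - (\<Sum>k\<in>V. b k * v k)))"
            by (rule dvd_diff[OF dvd_mult2[OF u] dvd_mult[OF dvd_add[OF v'[OF b(1)]]]])
          moreover have "w' x - v x = (b x * u - 1) * v x - u * ((b x * v x + (\<Sum>k\<in>V. b k * v k)) +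
              ((\<Sum>k\<in>V. b k * w k) - (\<Sum>k\<in>V. b k * v k)))"
            by (simp add: w'_def algebra_simps)
          ultimately show ?thesis by (simp only:)
        qed
        ultimately show "\<exists>w. (\<forall>a\<in>E. (\<Sum>k\<in>insert x V. a k * w k) = 0) \<and> (\<forall>k\<in>insert x V. int p dvd w k - v k)"
          by (intro exI[of _ w']) auto
      qed
    qed
  qed
qed simp

section \<open>Lifting logarithmic derivations of a fixed degree\<close>

definition monomials :: "nat \<Rightarrow> nat \<Rightarrow> nat multiset set" where
  "monomials l d = {m. set_mset m \<subseteq> {..<l} \<and> size m = d}"

lemma finite_monomials: "finite (monomials l d)"
proof (rule finite_subset)
  show "monomials l d \<subseteq> mset ` {xs. set xs \<subseteq> {..<l} \<and> length xs = d}"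
  proof
    fix m assume "m \<in> monomials l d"
    moreover obtain xs where "m = mset xs" using ex_mset by metis
    ultimately show "m \<in> mset ` {xs. set xs \<subseteq> {..<l} \<and> length xs = d}"
      by (auto simp: monomials_def)
  qed
qed (simp add: finite_lists_length_eq)

lemma lookup_sum_single:
  "finite A \<Longrightarrow> coeff_at (\<Sum>m\<in>A. Poly_Mapping.single m (c m)) m' = (if m' \<in> A then c m' else 0)"
  by (simp add: lookup_sum lookup_single when_def)

text \<open>
  A homogeneous derivation modulo \<open>p\<close> of degree \<open>d\<close>, together with the cofactors of the
  \<open>\<alpha>\<^sub>k\<close>, is a solution modulo \<open>p\<close> of a linear system over \<open>\<int>\<close> which does not depend on \<open>p\<close>.
\<close>

lemma lift_homog_log_der:
  fixes a :: "nat \<Rightarrow> nat \<Rightarrow> int"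
  shows "eventually (\<lambda>p. Factorial_Ring.prime p \<longrightarrow> (\<forall>\<delta>. homog_log_der (int p) l n a d \<delta> \<longrightarrow>
    (\<exists>\<delta>'. homog_log_der 0 l n a d \<delta>' \<and> (\<forall>j<l. cong_mod (Const (int p)) (\<delta>' j) (\<delta> j))))) sequentially"
proof -
  \<comment> \<open>The monomials of degree \<open>d - 1\<close>, for the cofactors. Written with
    \<open>Suc\<close>, the set is empty for \<open>d = 0\<close>, where the cofactors must
    vanish.\<close>
  define D where "D = {m. set_mset m \<subseteq> {..<l} \<and> Suc (size m) = d}"
  have D: "finite D"
    by (rule finite_subset[OF _ finite_monomials[of l "d - 1"]]) (auto simp: D_def monomials_def)
  \<comment> \<open>The unknowns: \<open>Inl (j, m)\<close> is the coefficient of \<open>m\<close>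
    in \<open>\<delta> j\<close>, and \<open>Inr (k, m)\<close> that of \<open>m\<close> in the
    \<open>k\<close>-th cofactor. The equation \<open>eq k m\<close> expresses the vanishing of the
    coefficient of \<open>m\<close> in the \<open>k\<close>-th divisibility relation.\<close>
  define V where "V = ({..<l} \<times> monomials l d) <+> ({..<n} \<times> D)"
  define eq where "eq k m z = (case z of Inl (j, m') \<Rightarrow> if m' = m then a k j else 0
    | Inr (k', m') \<Rightarrow> if k' = k then - (\<Sum>j<l. if m = add_mset j m' then a k j else 0) else 0)" for k m z
  define val where "val \<delta> h z = (case z of Inl (j, m) \<Rightarrow> coeff_at (\<delta> j) m | Inr (k, m) \<Rightarrow> coeff_at (h k) m)"
    for \<delta> h :: "nat \<Rightarrow> int mpoly" and z
  \<comment> \<open>For \<open>m\<close> of degree \<open>d\<close>, multiplication of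
    \<open>h k\<close> by a linear form only uses the coefficients of \<open>h k\<close> on
    \<open>D\<close>. Hence any cofactor modulo \<open>p\<close> may be inserted, homogeneous or
    not.\<close>
  have key: "(\<Sum>z\<in>V. eq k m z * val \<delta> h z) =
      coeff_at ((\<Sum>j<l. Const (a k j) * \<delta> j) - linear_poly l (a k) * h k) m"
    if k: "k < n" and m: "m \<in> monomials l d" for k m \<delta> h
  proof -
    have "(\<Sum>z\<in>V. eq k m z * val \<delta> h z) =
        (\<Sum>z\<in>{..<l} \<times> monomials l d. eq k m (Inl z) * val \<delta> h (Inl z)) +
        (\<Sum>z\<in>{..<n} \<times> D. eq k m (Inr z) * val \<delta> h (Inr z))"
      unfolding V_def using D by (subst sum.Plus) (auto simp: finite_monomials)
    also have "(\<Sum>z\<in>{..<l} \<times> monomials l d. eq k m (Inl z) * val \<delta> h (Inl z)) =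
        (\<Sum>j<l. \<Sum>m'\<in>monomials l d. if m' = m then a k j * coeff_at (\<delta> j) m else 0)"
      unfolding sum.cartesian_product by (intro sum.cong) (auto simp: eq_def val_def)
    also have "\<dots> = coeff_at (\<Sum>j<l. Const (a k j) * \<delta> j) m"
      using m by (simp add: finite_monomials lookup_sum)
    also have "(\<Sum>z\<in>{..<n} \<times> D. eq k m (Inr z) * val \<delta> h (Inr z)) =
        (\<Sum>k'<n. if k' = k then \<Sum>m'\<in>D. - (\<Sum>j<l. if m = add_mset j m' then a k j else 0) * coeff_at (h k) m' else 0)"
    proof -
      have "(\<Sum>z\<in>{..<n} \<times> D. eq k m (Inr z) * val \<delta> h (Inr z)) =
          (\<Sum>k'<n. \<Sum>m'\<in>D. eq k m (Inr (k', m')) * val \<delta> h (Inr (k', m')))"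
        by (simp add: sum.cartesian_product case_prod_beta')
      also have "\<dots> = (\<Sum>k'<n. if k' = k then \<Sum>m'\<in>D. - (\<Sum>j<l. if m = add_mset j m' then a k j else 0) * coeff_at (h k) m' else 0)"
        by (intro sum.cong) (auto simp: eq_def val_def)
      finally show ?thesis .
    qed
    also have "\<dots> = - (\<Sum>m'\<in>D. \<Sum>j<l. (if m = add_mset j m' then a k j else 0) * coeff_at (h k) m')"
      using k by (simp add: sum_negf sum_distrib_right)
    also have "\<dots> = - (\<Sum>j<l. \<Sum>m'\<in>D. (if m = add_mset j m' then a k j else 0) * coeff_at (h k) m')"
      by (subst sum.swap) rule
    also have "\<dots> = - coeff_at (linear_poly l (a k) * h k) m"
      unfolding linear_poly_def sum_distrib_right lookup_sum
    proof (intro arg_cong[where f = uminus] sum.cong refl)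
      fix j
      have "(\<Sum>m'\<in>D. (if m = add_mset j m' then a k j else 0) * coeff_at (h k) m') =
          (\<Sum>m'\<in>D. if m' = m - {#j#} then if j \<in># m then a k j * coeff_at (h k) (m - {#j#}) else 0 else 0)"
        by (intro sum.cong) (auto dest: insert_DiffM)
      also have "\<dots> = (if j \<in># m then a k j * coeff_at (h k) (m - {#j#}) else 0)"
      proof -
        have "m - {#j#} \<in> D" if "j \<in># m"
          using m that by (auto simp: D_def monomials_def size_Suc_Diff1 dest: in_diffD)
        then show ?thesis using D by simp
      qed
      finally show "(\<Sum>m'\<in>D. (if m = add_mset j m' then a k j else 0) * coeff_at (h k) m') =
          coeff_at (Const (a k j) * Var j * h k) m"
        by (simp add: mult.assoc lookup_Var_mult del: mult_single)
    qed
    finally show ?thesis by (simp add: lookup_minus)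
  qed
  have "finite V" using D by (auto simp: V_def finite_monomials)
  moreover have "finite ((\<lambda>(k, m). eq k m) ` ({..<n} \<times> monomials l d))"
    by (simp add: finite_monomials)
  ultimately show ?thesis
    using lift_solution_mod[of V "(\<lambda>(k, m). eq k m) ` ({..<n} \<times> monomials l d)"]
  proof (rule_tac eventually_mono)
    fix p assume lift: "Factorial_Ring.prime p \<longrightarrow> (\<forall>v. (\<forall>a\<in>(\<lambda>(k, m). eq k m) ` ({..<n} \<times> monomials l d).
        int p dvd (\<Sum>k\<in>V. a k * v k)) \<longrightarrow>
      (\<exists>w. (\<forall>a\<in>(\<lambda>(k, m). eq k m) ` ({..<n} \<times> monomials l d). (\<Sum>k\<in>V. a k * w k) = 0) \<and>
        (\<forall>k\<in>V. int p dvd w k - v k)))"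
    show "Factorial_Ring.prime p \<longrightarrow> (\<forall>\<delta>. homog_log_der (int p) l n a d \<delta> \<longrightarrow>
      (\<exists>\<delta>'. homog_log_der 0 l n a d \<delta>' \<and> (\<forall>j<l. cong_mod (Const (int p)) (\<delta>' j) (\<delta> j))))"
    proof (intro impI allI)
      fix \<delta> assume p: "Factorial_Ring.prime p" and "homog_log_der (int p) l n a d \<delta>"
      then have \<delta>: "\<forall>j<l. \<delta> j \<in> vars_below l \<and> homog d (\<delta> j)"
        and "\<forall>k<n. dvd_mod (Const (int p)) (linear_poly l (a k)) (\<Sum>j<l. Const (a k j) * \<delta> j)"
        by (auto simp: homog_log_der_def)
      then obtain h where h: "\<And>k. k < n \<Longrightarrow>
          cong_mod (Const (int p)) (\<Sum>j<l. Const (a k j) * \<delta> j) (linear_poly l (a k) * h k)"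
        unfolding dvd_mod_def by metis
      have "int p dvd (\<Sum>z\<in>V. eq k m z * val \<delta> h z)" if "k < n" "m \<in> monomials l d" for k m
        unfolding key[OF that] using h[OF that(1)] by (simp add: cong_mod_def Const_dvd_iff)
      then have "\<forall>b\<in>(\<lambda>(k, m). eq k m) ` ({..<n} \<times> monomials l d). int p dvd (\<Sum>z\<in>V. b z * val \<delta> h z)"
        by auto
      with lift p obtain w
        where "\<forall>b\<in>(\<lambda>(k, m). eq k m) ` ({..<n} \<times> monomials l d). (\<Sum>z\<in>V. b z * w z) = 0"
          and w2: "\<forall>z\<in>V. int p dvd w z - val \<delta> h z"
        by blast
      then have w: "\<And>k m. k < n \<Longrightarrow> m \<in> monomials l d \<Longrightarrow> (\<Sum>z\<in>V. eq k m z * w z) = 0"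
        "\<And>z. z \<in> V \<Longrightarrow> int p dvd w z - val \<delta> h z"
        by auto
      define \<delta>' where "\<delta>' j = (\<Sum>m\<in>monomials l d. Poly_Mapping.single m (w (Inl (j, m))))" for j
      define h' where "h' k = (\<Sum>m\<in>D. Poly_Mapping.single m (w (Inr (k, m))))" for k
      have lookup_\<delta>': "coeff_at (\<delta>' j) m = (if m \<in> monomials l d then w (Inl (j, m)) else 0)" for j m
        unfolding \<delta>'_def by (rule lookup_sum_single) (rule finite_monomials)
      have lookup_h': "coeff_at (h' k) m = (if m \<in> D then w (Inr (k, m)) else 0)" for k m
        unfolding h'_def by (rule lookup_sum_single) (rule D)
      have val': "val \<delta>' h' z = w z" if "z \<in> V" for z
        using that by (auto simp: V_def val_def lookup_\<delta>' lookup_h')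
      have \<delta>': "\<delta>' j \<in> vars_below l \<and> homog d (\<delta>' j)" for j
        by (auto simp: vars_below_def homog_def lookup_\<delta>' monomials_def split: if_splits)
      have h'_vars: "h' k \<in> vars_below l" for k
        by (auto simp: vars_below_def lookup_h' D_def split: if_splits)
      have "cong_mod (Const (int p)) (\<delta>' j) (\<delta> j)" if j: "j < l" for j
        unfolding cong_mod_def Const_dvd_iff
      proof
        fix m
        show "int p dvd coeff_at (\<delta>' j - \<delta> j) m"
        proof (cases "m \<in> monomials l d")
          case True
          then have "Inl (j, m) \<in> V" using j by (auto simp: V_def)
          then show ?thesis using w(2)[of "Inl (j, m)"] True by (simp add: val_def lookup_minus lookup_\<delta>')
        next
          case False
          then have "coeff_at (\<delta> j) m = 0" using \<delta> j by (auto simp: monomials_def vars_below_def homog_def)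
          then show ?thesis using False by (simp add: lookup_minus lookup_\<delta>')
        qed
      qed
      moreover have "(\<Sum>j<l. Const (a k j) * \<delta>' j) = linear_poly l (a k) * h' k" if k: "k < n" for k
      proof (rule poly_mapping_eqI)
        fix m
        show "coeff_at (\<Sum>j<l. Const (a k j) * \<delta>' j) m = coeff_at (linear_poly l (a k) * h' k) m"
        proof (cases "m \<in> monomials l d")
          case True
          have "(\<Sum>z\<in>V. eq k m z * val \<delta>' h' z) = 0"
            using w(1)[OF k True] val' by (simp cong: sum.cong)
          then show ?thesis unfolding key[OF k True] by (simp add: lookup_minus)
        next
          case False
          \<comment> \<open>For \<open>m\<close> outside \<open>monomials l d\<close> the system has
            no equation; there both sides vanish by their degree and variables.\<close>
          have "homog d (linear_poly l (a k) * h' k)"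
          proof (cases d)
            case 0
            then have "h' k = 0" by (intro poly_mapping_eqI) (simp add: lookup_h' D_def)
            then show ?thesis by simp
          next
            case (Suc d')
            then have "homog d' (h' k)" by (auto simp: homog_def lookup_h' D_def split: if_splits)
            then show ?thesis using homog_mult[OF homog_linear_poly[of l "a k"]] Suc by simp
          qed
          moreover have "linear_poly l (a k) * h' k \<in> vars_below l"
            using h'_vars by (intro vars_below_mult) auto
          ultimately have "coeff_at (linear_poly l (a k) * h' k) m = 0"
            using False by (auto simp: monomials_def vars_below_def homog_def)
          moreover have "coeff_at (\<Sum>j<l. Const (a k j) * \<delta>' j) m = 0"
            using False by (simp add: lookup_sum lookup_\<delta>')
          ultimately show ?thesis by simp
        qed
      qed
      ultimately show "\<exists>\<delta>'. homog_log_der 0 l n a d \<delta>' \<and> (\<forall>j<l. cong_mod (Const (int p)) (\<delta>' j) (\<delta> j))"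
        unfolding homog_log_der_def using \<delta>' by (intro exI[of _ \<delta>']) simp
    qed
  qed
qed

section \<open>Comparison of the criterion modulo \<open>p\<close> and modulo
  \<open>0\<close>\<close>

lemma dvd_mod_of_0: "dvd_mod 0 b f \<Longrightarrow> dvd_mod q b f"
  unfolding dvd_mod_def cong_mod_def by (metis dvd_0_left dvd_0_right)

text \<open>Normalising \<open>e\<close> outside \<open>{..<l}\<close> leaves a finite set of
  exponent tuples to consider.\<close>

lemma saito_free_restrict: "saito_free p l n a (restrict e {..<l}) \<longleftrightarrow> saito_free p l n a e"
  unfolding saito_free_def by simp

lemma saito_free_le: "saito_free p l n a e \<Longrightarrow> i < l \<Longrightarrow> e i \<le> n"
  unfolding saito_free_def by (metis finite_lessThan lessThan_iff member_le_sum zero_le)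

lemma saito_free_mod_imp:
  fixes a :: "nat \<Rightarrow> nat \<Rightarrow> int"
  shows "eventually (\<lambda>p. Factorial_Ring.prime p \<longrightarrow>
    (\<forall>e. saito_free (int p) l n a e \<longrightarrow> saito_free 0 l n a e)) sequentially"
proof -
  have "eventually (\<lambda>p. \<forall>d\<in>{..n}. Factorial_Ring.prime p \<longrightarrow> (\<forall>\<delta>. homog_log_der (int p) l n a d \<delta> \<longrightarrow>
      (\<exists>\<delta>'. homog_log_der 0 l n a d \<delta>' \<and> (\<forall>j<l. cong_mod (Const (int p)) (\<delta>' j) (\<delta> j))))) sequentially"
    by (intro eventually_ball_finite ballI lift_homog_log_der) simp
  then show ?thesis
  proof eventually_elim
    case (elim p)
    show ?case
    proof (intro impI allI)
      fix e assume p: "Factorial_Ring.prime p" and sf: "saito_free (int p) l n a e"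
      then obtain \<delta> where \<delta>: "\<forall>i<l. homog_log_der (int p) l n a (e i) (\<delta> i)"
        and det: "\<not> Const (int p) dvd det_of l \<delta>"
        unfolding saito_free_def by blast
      have "\<forall>i. \<exists>\<delta>'. i < l \<longrightarrow> homog_log_der 0 l n a (e i) \<delta>' \<and>
          (\<forall>j<l. cong_mod (Const (int p)) (\<delta>' j) (\<delta> i j))"
        using elim p \<delta> saito_free_le[OF sf] by blast
      then obtain \<delta>' where \<delta>': "\<And>i. i < l \<Longrightarrow> homog_log_der 0 l n a (e i) (\<delta>' i) \<and>
          (\<forall>j<l. cong_mod (Const (int p)) (\<delta>' i j) (\<delta> i j))"
        by metis
      then have "cong_mod (Const (int p)) (det_of l \<delta>) (det_of l \<delta>')"
        by (intro cong_mod_det_of) (auto intro: cong_mod_sym)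
      then have "det_of l \<delta>' \<noteq> 0"
        using det by (auto simp: cong_mod_def)
      then show "saito_free 0 l n a e"
        using sf \<delta>' by (auto simp: saito_free_def)
    qed
  qed
qed

lemma saito_free_imp_mod:
  fixes a :: "nat \<Rightarrow> nat \<Rightarrow> int"
  shows "eventually (\<lambda>p. \<forall>e. saito_free 0 l n a e \<longrightarrow> saito_free (int p) l n a e) sequentially"
proof -
  have "eventually (\<lambda>p. saito_free 0 l n a e \<longrightarrow> saito_free (int p) l n a e) sequentially" for e
  proof (cases "saito_free 0 l n a e")
    case True
    then obtain \<delta> where \<delta>: "\<forall>i<l. homog_log_der 0 l n a (e i) (\<delta> i)" and det: "\<not> Const 0 dvd det_of l \<delta>"
      unfolding saito_free_def by blast
    \<comment> \<open>One nonzero coefficient of the determinant of one fixed choice of derivations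
      bounds \<open>p\<close>; the exact divisibilities survive reduction.\<close>
    from det obtain m where "coeff_at (det_of l \<delta>) m \<noteq> 0"
      unfolding Const_dvd_iff by auto
    from eventually_not_dvd_int[OF this] show ?thesis
    proof eventually_elim
      case (elim p)
      have "homog_log_der (int p) l n a (e i) (\<delta> i)" if "i < l" for i
        using \<delta> that by (auto simp: homog_log_der_def intro: dvd_mod_of_0)
      then show ?case
        using True elim unfolding saito_free_def Const_dvd_iff by blast
    qed
  qed simp
  then have "eventually (\<lambda>p. \<forall>e\<in>{..<l} \<rightarrow>\<^sub>E {..n}. saito_free 0 l n a e \<longrightarrow> saito_free (int p) l n a e) sequentially"
    by (intro eventually_ball_finite) (auto intro: finite_PiE)
  then show ?thesis
  proof eventually_elim
    case (elim p)
    show ?case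
    proof (intro allI impI)
      fix e assume e: "saito_free 0 l n a e"
      then have "restrict e {..<l} \<in> {..<l} \<rightarrow>\<^sub>E {..n}" using saito_free_le by auto
      then show "saito_free (int p) l n a e"
        using elim e saito_free_restrict by metis
    qed
  qed
qed

section \<open>Clearing denominators\<close>

definition rat_mpoly :: "int mpoly \<Rightarrow> rat mpoly" where
  "rat_mpoly F = Poly_Mapping.map of_int F"

lemma lookup_rat_mpoly [simp]: "coeff_at (rat_mpoly F) m = of_int (coeff_at F m)"
  by (simp add: rat_mpoly_def Poly_Mapping.map.rep_eq when_def)

lemma rat_mpoly_eq_iff [simp]: "rat_mpoly F = rat_mpoly G \<longleftrightarrow> F = G"
  by (auto simp: poly_mapping_eq_iff fun_eq_iff)

interpretation rat_mpoly: comm_ring_hom rat_mpoly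
  by standard
     (auto intro!: poly_mapping_eqI simp: lookup_add lookup_mult_mset lookup_one when_def)

lemma rat_mpoly_Const [simp]: "rat_mpoly (Const c) = Const (of_int c)"
  by (intro poly_mapping_eqI) (simp add: lookup_single when_def)

lemma rat_mpoly_linear_poly: "rat_mpoly (linear_poly l a) = linear_poly l (\<lambda>j. of_int (a j))"
  by (intro poly_mapping_eqI) (simp add: lookup_linear_poly if_distrib cong: if_cong)

lemma rat_mpoly_det_of: "rat_mpoly (det_of l \<delta>) = det_of l (\<lambda>i j. rat_mpoly (\<delta> i j))"
proof -
  have "map_mat rat_mpoly (mat l l (\<lambda>(i, j). \<delta> i j)) = mat l l (\<lambda>(i, j). rat_mpoly (\<delta> i j))"
    by (intro eq_matI) auto
  then show ?thesis unfolding det_of_def by (metis rat_mpoly.hom_det)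
qed

lemma vars_below_rat_mpoly [simp]: "rat_mpoly F \<in> vars_below l \<longleftrightarrow> F \<in> vars_below l"
  by (simp add: vars_below_def)

lemma homog_rat_mpoly [simp]: "homog d (rat_mpoly F) \<longleftrightarrow> homog d F"
  by (simp add: homog_def)

lemma common_denominator_rat:
  assumes "finite (A :: rat set)"
  shows "\<exists>D. D > 0 \<and> (\<forall>x\<in>A. of_int D * x \<in> \<int>)"
  using assms
proof induction
  case empty
  show ?case by (intro exI[of _ 1]) simp
next
  case (insert x A)
  then obtain D where D: "D > 0" "\<And>x. x \<in> A \<Longrightarrow> of_int D * x \<in> \<int>" by blast
  obtain r s where rs: "x = of_int r / of_int s" "s > 0" by (cases x) (auto simp: Fract_of_int_quotient)
  have "of_int (D * s) * y \<in> \<int>" if "y \<in> insert x A" for y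
  proof (cases "y = x")
    case True
    then have "of_int (D * s) * y = of_int (D * r)" using rs by simp
    then show ?thesis by (metis Ints_of_int)
  next
    case False
    then have "of_int D * y \<in> \<int>" using D that by auto
    then have "of_int s * (of_int D * y) \<in> \<int>" by (rule Ints_mult[OF Ints_of_int])
    then show ?thesis by (simp add: mult_ac)
  qed
  then show ?case using D(1) rs(2) by (intro exI[of _ "D * s"]) auto
qed

lemma common_denominator_mpoly:
  assumes "finite (S :: rat mpoly set)"
  obtains D where "D > 0" "\<And>f. f \<in> S \<Longrightarrow> \<exists>F. rat_mpoly F = Const (of_int D) * f"
proof -
  have "finite (\<Union>f\<in>S. Poly_Mapping.range f)" using assms by simp
  from common_denominator_rat[OF this] obtain D
    where D: "D > 0" "\<forall>x\<in>(\<Union>f\<in>S. Poly_Mapping.range f). of_int D * x \<in> \<int>" by blast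
  show thesis
  proof (rule that[OF D(1)])
    fix f assume f: "f \<in> S"
    have "rat_mpoly (Poly_Mapping.map (\<lambda>x. \<lfloor>of_int D * x\<rfloor>) f) = Const (of_int D) * f"
    proof (rule poly_mapping_eqI)
      fix m
      have "of_int D * coeff_at f m \<in> \<int>"
      proof (cases "coeff_at f m = 0")
        case False
        then show ?thesis using D(2) f in_keys_lookup_in_range by (metis UN_I in_keys_iff)
      qed simp
      then show "coeff_at (rat_mpoly (Poly_Mapping.map (\<lambda>x. \<lfloor>of_int D * x\<rfloor>) f)) m = coeff_at (Const (of_int D) * f) m"
        by (auto simp: Poly_Mapping.map.rep_eq when_def elim: Ints_cases)
    qed
    then show "\<exists>F. rat_mpoly F = Const (of_int D) * f" by blast
  qed
qed

lemma homog_log_der_0_iff: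
  "homog_log_der 0 l n a d \<delta> \<longleftrightarrow> (\<forall>j<l. \<delta> j \<in> vars_below l \<and> homog d (\<delta> j)) \<and>
    (\<forall>k<n. \<exists>h. (\<Sum>j<l. Const (a k j) * \<delta> j) = linear_poly l (a k) * h)"
  by (simp add: homog_log_der_def dvd_mod_def cong_mod_def)

lemma homog_log_der_rat_mpoly:
  assumes "homog_log_der 0 l n a d \<delta>"
  shows "homog_log_der 0 l n (\<lambda>i j. rat_of_int (a i j)) d (\<lambda>j. rat_mpoly (\<delta> j))"
  unfolding homog_log_der_0_iff
proof (intro conjI allI impI)
  fix k assume "k < n"
  then obtain h where "(\<Sum>j<l. Const (a k j) * \<delta> j) = linear_poly l (a k) * h"
    using assms by (auto simp: homog_log_der_0_iff)
  then have "rat_mpoly (\<Sum>j<l. Const (a k j) * \<delta> j) = rat_mpoly (linear_poly l (a k) * h)" by simp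
  then show "\<exists>h. (\<Sum>j<l. Const (of_int (a k j)) * rat_mpoly (\<delta> j)) = linear_poly l (\<lambda>j. of_int (a k j)) * h"
    by (auto simp: rat_mpoly.hom_sum rat_mpoly.hom_mult rat_mpoly_linear_poly)
qed (use assms in \<open>auto simp: homog_log_der_0_iff\<close>)

text \<open>One denominator \<open>D\<close> is taken for the components and the cofactors together,
  because divisibility by the forms has to hold over the integers.\<close>

lemma homog_log_der_clear_denominators:
  assumes "homog_log_der 0 l n (\<lambda>i j. rat_of_int (a i j)) d \<delta>"
  shows "\<exists>D \<delta>'. D > 0 \<and> homog_log_der 0 l n a d \<delta>' \<and>
    (\<forall>j<l. rat_mpoly (\<delta>' j) = Const (of_int D) * \<delta> j)"
proof -
  obtain h where h: "\<And>k. k < n \<Longrightarrow>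
      (\<Sum>j<l. Const (of_int (a k j)) * \<delta> j) = linear_poly l (\<lambda>j. of_int (a k j)) * h k"
    using assms unfolding homog_log_der_0_iff by metis
  have "finite (\<delta> ` {..<l} \<union> h ` {..<n})" by simp
  then obtain D where "D > 0"
    and D: "\<And>f. f \<in> \<delta> ` {..<l} \<union> h ` {..<n} \<Longrightarrow> \<exists>F. rat_mpoly F = Const (of_int D) * f"
    by (rule common_denominator_mpoly) blast
  have "\<forall>j. \<exists>F. j < l \<longrightarrow> rat_mpoly F = Const (of_int D) * \<delta> j" using D by blast
  then obtain \<delta>' where \<delta>': "\<And>j. j < l \<Longrightarrow> rat_mpoly (\<delta>' j) = Const (of_int D) * \<delta> j" by metis
  have "homog_log_der 0 l n a d \<delta>'"
    unfolding homog_log_der_0_iff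
  proof (intro conjI allI impI)
    fix j assume j: "j < l"
    then have "homog (0 + d) (Const (of_int D) * \<delta> j)"
      using assms by (intro homog_mult) (auto simp: homog_log_der_0_iff homog_def lookup_single when_def)
    then show "homog d (\<delta>' j)" using \<delta>'[OF j] homog_rat_mpoly[of d "\<delta>' j"] by simp
    have "Const (of_int D) * \<delta> j \<in> vars_below l"
      using assms j by (intro vars_below_mult) (auto simp: homog_log_der_0_iff)
    then show "\<delta>' j \<in> vars_below l" using \<delta>'[OF j] vars_below_rat_mpoly[of "\<delta>' j" l] by simp
  next
    fix k assume k: "k < n"
    then obtain h' where h': "rat_mpoly h' = Const (of_int D) * h k" using D[of "h k"] by auto
    have "rat_mpoly (\<Sum>j<l. Const (a k j) * \<delta>' j) = (\<Sum>j<l. Const (of_int (a k j)) * (Const (of_int D) * \<delta> j))"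
      using \<delta>' by (simp add: rat_mpoly.hom_sum rat_mpoly.hom_mult)
    also have "\<dots> = Const (of_int D) * (\<Sum>j<l. Const (of_int (a k j)) * \<delta> j)"
      by (simp add: sum_distrib_left mult.left_commute)
    also have "\<dots> = rat_mpoly (linear_poly l (a k) * h')"
      by (simp add: h[OF k] rat_mpoly.hom_mult h' rat_mpoly_linear_poly mult.left_commute)
    finally show "\<exists>h. (\<Sum>j<l. Const (a k j) * \<delta>' j) = linear_poly l (a k) * h" by auto
  qed
  with \<open>D > 0\<close> \<delta>' show ?thesis by blast
qed

text \<open>Over the integers \<open>saito_free\<close> does not assert freeness: it asks only for
  logarithmic tuples with nonzero determinant, which survive scaling each tuple by its own
  denominator.\<close>

lemma saito_free_rat_iff:
  "saito_free (0 :: rat) l n (\<lambda>i j. rat_of_int (a i j)) e \<longleftrightarrow> saito_free (0 :: int) l n a e"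
proof
  assume sf: "saito_free (0 :: int) l n a e"
  then obtain \<delta> where \<delta>: "\<forall>i<l. homog_log_der 0 l n a (e i) (\<delta> i)" and "det_of l \<delta> \<noteq> 0"
    by (auto simp: saito_free_def)
  then have "det_of l (\<lambda>i j. rat_mpoly (\<delta> i j)) \<noteq> 0"
    using rat_mpoly_eq_iff[of "det_of l \<delta>" 0] by (simp add: rat_mpoly_det_of)
  then show "saito_free (0 :: rat) l n (\<lambda>i j. rat_of_int (a i j)) e"
    using sf \<delta> homog_log_der_rat_mpoly unfolding saito_free_def
    by (auto intro!: exI[of _ "\<lambda>i j. rat_mpoly (\<delta> i j)"])
next
  assume sf: "saito_free (0 :: rat) l n (\<lambda>i j. rat_of_int (a i j)) e"
  then obtain \<delta> where \<delta>: "\<forall>i<l. homog_log_der 0 l n (\<lambda>i j. rat_of_int (a i j)) (e i) (\<delta> i)"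
    and "\<not> Const 0 dvd det_of l \<delta>"
    unfolding saito_free_def by blast
  then have det: "det_of l \<delta> \<noteq> 0" by auto
  have "\<forall>i. \<exists>D \<delta>'. i < l \<longrightarrow> D > 0 \<and> homog_log_der 0 l n a (e i) \<delta>' \<and>
      (\<forall>j<l. rat_mpoly (\<delta>' j) = Const (of_int D) * \<delta> i j)"
    using \<delta> homog_log_der_clear_denominators by blast
  then obtain D \<delta>' where D: "\<And>i. i < l \<Longrightarrow> D i > (0 :: int)"
    and \<delta>': "\<And>i. i < l \<Longrightarrow> homog_log_der 0 l n a (e i) (\<delta>' i)"
    and eq: "\<And>i j. i < l \<Longrightarrow> j < l \<Longrightarrow> rat_mpoly (\<delta>' i j) = Const (of_int (D i)) * \<delta> i j"
    by metis
  \<comment> \<open>Scaling the rows is multiplication by a diagonal matrix with nonzero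
    entries.\<close>
  have "rat_mpoly (det_of l \<delta>') = det_of l (\<lambda>i j. \<Sum>k<l. (if i = k then Const (of_int (D i)) else 0) * \<delta> k j)"
    unfolding rat_mpoly_det_of using eq by (intro det_of_cong) (simp add: if_distrib[of "\<lambda>x. x * _"] cong: if_cong)
  also have "\<dots> = (\<Prod>i<l. Const (of_int (D i))) * det_of l \<delta>"
    unfolding det_of_mult by (simp add: det_of_diag)
  also have "\<dots> \<noteq> 0"
  proof -
    have "Const (of_int (D i)) \<noteq> (0 :: rat mpoly)" if "i < l" for i
    proof
      assume "Const (of_int (D i)) = (0 :: rat mpoly)"
      then have "coeff_at (Const (of_int (D i)) :: rat mpoly) {#} = 0" by simp
      then show False using D[OF that] by simp
    qed
    then show ?thesis using det by simp
  qed
  finally have "det_of l \<delta>' \<noteq> 0" by auto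
  then show "saito_free (0 :: int) l n a e"
    using sf \<delta>' by (auto simp: saito_free_def)
qed

section \<open>The coefficient rings and the choice of the bound\<close>

interpretation int_coeff: coeff_hom int_ring "\<lambda>x. x" "0 :: int"
proof -
  interpret cring int_ring by (rule int_is_cring)
  show "coeff_hom int_ring (\<lambda>x. x) (0 :: int)"
    by unfold_locales (auto simp: cong_mod_def)
qed

interpretation rat_coeff: coeff_hom rat_field "\<lambda>x. x" "0 :: rat"
proof -
  interpret cring rat_field by (rule cring_from_type_algebra)
  show "coeff_hom rat_field (\<lambda>x. x) (0 :: rat)"
    by unfold_locales (auto simp: cong_mod_def ring_of_type_algebra_def)
qed

lemma coeff_hom_prime_field:
  assumes "Factorial_Ring.prime p"
  shows "coeff_hom (prime_field p) (\<lambda>x. x mod int p) (int p)"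
proof -
  have p: "1 < int p" using assms prime_gt_1_nat by auto
  interpret residues "int p" "prime_field p"
    by unfold_locales (rule p Pure.reflexive)+
  show ?thesis
  proof unfold_locales
    fix x y :: int
    show "(x + y) mod int p = x mod int p \<oplus>\<^bsub>prime_field p\<^esub> y mod int p"
      by (simp add: res_add_eq mod_simps)
    show "x * y mod int p = (x mod int p) \<otimes>\<^bsub>prime_field p\<^esub> (y mod int p)"
      by (simp add: res_mult_eq mod_simps)
    show "1 mod int p = \<one>\<^bsub>prime_field p\<^esub>"
      using p by (simp add: res_one_eq)
    show "(x mod int p = y mod int p) = cong_mod (int p) x y"
      by (simp add: cong_mod_def mod_eq_dvd_iff)
  next
    have "x \<in> range (\<lambda>x. x mod int p)" if "x \<in> {0..int p - 1}" for x
      using that by (intro image_eqI[of _ _ x]) auto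
    then show "range (\<lambda>x. x mod int p) = carrier (prime_field p)"
      using p by (auto simp: res_carrier_eq)
  qed
qed

lemma map_poly_ring_int: "int_coeff.map_poly_ring F = coeff_at F"
  by (simp add: int_coeff.map_poly_ring_def)

text \<open>A minor that is nonzero modulo \<open>p\<close> refutes proportionality for every factor
  \<open>c\<close> at once, and a nonzero integer minor stays nonzero modulo all large
  primes.\<close>

lemma proportional_imp_minors:
  assumes "\<forall>j<l. cong_mod p (b j) (c * a j)" "j < l" "k < l"
  shows "p dvd b j * a k - b k * a j"
proof -
  have "p dvd (b j - c * a j) * a k - (b k - c * a k) * a j"
    using assms by (intro dvd_diff[OF dvd_mult2 dvd_mult2]) (auto simp: cong_mod_def)
  then show ?thesis by (simp add: algebra_simps)
qed

theorem corollary6p3: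
  fixes l n :: nat
    and A :: "(nat \<Rightarrow> rat) set set"
    and H :: "nat \<Rightarrow> (nat \<Rightarrow> rat) set"
    and \<alpha> :: "nat \<Rightarrow> nat multiset \<Rightarrow> int"
  assumes arrangement: "central_arrangement rat_field l A"
    and enumeration: "bij_betw H {..<n} A"
    and linear: "\<And>i. i < n \<Longrightarrow> nonzero_linear_form int_ring l (\<alpha> i)"
    and defining: "\<And>i. i < n \<Longrightarrow> H i = hyperplane rat_field l (rat_poly (\<alpha> i))"
    and primitive: "\<And>i q. i < n \<Longrightarrow> Factorial_Ring.prime (q :: nat) \<Longrightarrow>
      \<not> (ring.indexed_const int_ring (int q) divides\<^bsub>mpoly_ring int_ring l\<^esub> \<alpha> i)"
  shows "\<exists>N :: nat. \<forall>p :: nat. Factorial_Ring.prime p \<and> p > N \<longrightarrow>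
    good_prime l n \<alpha> p \<and>
    (\<forall>e :: nat \<Rightarrow> nat.
      free_with_exponents (prime_field p) l (arrangement_mod l n \<alpha> p) e \<longleftrightarrow>
      free_with_exponents rat_field l A e)"
proof -
  have "\<exists>b. \<alpha> i = coeff_at (linear_poly l b) \<and> (\<exists>j<l. b j \<noteq> 0)" if "i < n" for i
    using linear[OF that] unfolding int_coeff.nonzero_linear_form_iff map_poly_ring_int by simp
  then obtain a where \<alpha>: "\<And>i. i < n \<Longrightarrow> \<alpha> i = coeff_at (linear_poly l (a i))"
    and nz: "\<And>i. i < n \<Longrightarrow> \<exists>j<l. a i j \<noteq> 0" by metis
  define ar where "ar i j = rat_of_int (a i j)" for i j
  have H: "H i = hyperplane rat_field l (rat_coeff.map_poly_ring (linear_poly l (ar i)))" if "i < n" for i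
  proof -
    have "rat_poly (\<alpha> i) = rat_coeff.map_poly_ring (linear_poly l (ar i))"
      using lookup_rat_mpoly[of "linear_poly l (a i)"]
      by (auto simp: rat_poly_def rat_coeff.map_poly_ring_def \<alpha>[OF that] ar_def[abs_def] rat_mpoly_linear_poly)
    then show ?thesis using defining[OF that] by simp
  qed
  \<comment> \<open>Proportional nonzero forms have the same zeros, but \<open>H\<close> is
    injective on the indices.\<close>
  have rat_non_proportional: "\<not> (\<forall>j<l. ar i' j = c * ar i j)" if i: "i < n" "i' < n" "i \<noteq> i'" for i i' c
  proof
    assume c: "\<forall>j<l. ar i' j = c * ar i j"
    then have "c \<noteq> 0" using nz[OF i(2)] by (auto simp: ar_def)
    have "(\<Sum>j<l. ar i' j * w j) = c * (\<Sum>j<l. ar i j * w j)" for w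
      using c by (simp add: sum_distrib_left mult.assoc)
    then have "H i = H i'"
      unfolding H[OF i(1)] H[OF i(2)] rat_coeff.hyperplane_eq_iff using \<open>c \<noteq> 0\<close> by simp
    then show False using enumeration i by (auto simp: bij_betw_def inj_on_def)
  qed
  interpret Q: coeff_field rat_field "\<lambda>x. x" "0 :: rat" l n ar
  proof unfold_locales
    show "prime_like (0 :: rat)" by (simp add: prime_like_def)
    show "\<exists>u. cong_mod 0 (x * u) 1" if "\<not> 0 dvd x" for x :: rat
      using that by (intro exI[of _ "inverse x"]) simp
    show "\<exists>k<l. \<not> 0 dvd ar i k" if "i < n" for i
      using nz[OF that] by (auto simp: ar_def)
    show "\<not> (\<forall>j<l. cong_mod 0 (ar i' j) (c * ar i j))" if "i < n" "i' < n" "i \<noteq> i'" for i i' c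
      using rat_non_proportional[OF that, of c] by (simp add: cong_mod_def)
  qed
  have A: "A = Q.arrangement"
    using enumeration H by (auto simp: bij_betw_def Q.arrangement_def)
  have rat_free: "free_with_exponents rat_field l A e \<longleftrightarrow> saito_free 0 l n a e" for e
    unfolding A Q.free_with_exponents_iff unfolding ar_def[abs_def] by (rule saito_free_rat_iff)
  have minor: "\<exists>j<l. \<exists>k<l. a i' j * a i k - a i' k * a i j \<noteq> 0" if i: "i < n" "i' < n" "i \<noteq> i'" for i i'
  proof (rule ccontr)
    assume "\<not> ?thesis"
    \<comment> \<open>If all minors vanish, row \<open>i'\<close> is a multiple of row
      \<open>i\<close>, with the ratio at a nonzero coordinate \<open>k\<close> as factor.\<close>
    then have minors: "a i' j * a i k = a i' k * a i j" if "j < l" "k < l" for j k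
      using that by auto
    obtain k where k: "k < l" "a i k \<noteq> 0" using nz i(1) by blast
    have "ar i' j = (ar i' k / ar i k) * ar i j" if "j < l" for j
    proof -
      have "ar i' j * ar i k = ar i' k * ar i j"
        using minors[OF that k(1)] unfolding ar_def by (metis of_int_mult)
      then show ?thesis using k(2) by (simp add: ar_def field_simps)
    qed
    then show False using rat_non_proportional[OF i] by blast
  qed
  \<comment> \<open>For large \<open>p\<close> each form keeps a nonzero coefficient and each pair
    of forms a nonzero minor, so the reductions define \<open>n\<close> distinct
    hyperplanes.\<close>
  have ev_nz: "eventually (\<lambda>p. \<forall>i\<in>{..<n}. \<exists>k<l. \<not> int p dvd a i k) sequentially"
  proof (intro eventually_ball_finite ballI)
    fix i assume "i \<in> {..<n}"
    then obtain k where "k < l" "a i k \<noteq> 0" using nz by auto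
    then show "eventually (\<lambda>p. \<exists>k<l. \<not> int p dvd a i k) sequentially"
      by (auto intro: eventually_mono[OF eventually_not_dvd_int])
  qed simp
  have ev_minor: "eventually (\<lambda>p. \<forall>i\<in>{..<n}. \<forall>i'\<in>{..<n} - {i}. \<exists>j<l. \<exists>k<l.
      \<not> int p dvd a i' j * a i k - a i' k * a i j) sequentially"
  proof (intro eventually_ball_finite ballI)
    fix i i' assume "i \<in> {..<n}" "i' \<in> {..<n} - {i}"
    then obtain j k where jk: "j < l" "k < l" "a i' j * a i k - a i' k * a i j \<noteq> 0"
      using minor[of i i'] by auto
    from eventually_not_dvd_int[OF jk(3)]
    show "eventually (\<lambda>p. \<exists>j<l. \<exists>k<l. \<not> int p dvd a i' j * a i k - a i' k * a i j) sequentially"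
      by eventually_elim (use jk in blast)
  qed simp_all
  have "eventually (\<lambda>p. Factorial_Ring.prime p \<longrightarrow> good_prime l n \<alpha> p \<and>
    (\<forall>e. free_with_exponents (prime_field p) l (arrangement_mod l n \<alpha> p) e \<longleftrightarrow>
      free_with_exponents rat_field l A e)) sequentially"
    using ev_nz ev_minor saito_free_mod_imp[of l n a] saito_free_imp_mod[of l n a]
  proof eventually_elim
    case (elim p)
    show ?case
    proof
      assume p: "Factorial_Ring.prime p"
      interpret P: coeff_hom "prime_field p" "\<lambda>x. x mod int p" "int p"
        by (rule coeff_hom_prime_field) (rule p)
      interpret P: coeff_field "prime_field p" "\<lambda>x. x mod int p" "int p" l n a
      proof unfold_locales
        show "prime_like (int p)" by (rule prime_like_int) (rule p)
        show "\<exists>u. cong_mod (int p) (x * u) 1" if x: "\<not> int p dvd x" for x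
          unfolding cong_mod_def by (rule prime_int_inverse[OF p x]) (rule exI)
        show "\<exists>k<l. \<not> int p dvd a i k" if "i < n" for i
          using elim(1) that by simp
        show "\<not> (\<forall>j<l. cong_mod (int p) (a i' j) (c * a i j))" if ii: "i < n" "i' < n" "i \<noteq> i'" for i i' c
        proof -
          obtain j k where "j < l" "k < l" "\<not> int p dvd a i' j * a i k - a i' k * a i j"
            using bspec[OF bspec[OF elim(2)], of i i'] ii by auto
          then show ?thesis using proportional_imp_minors[of l "int p" "a i'" c "a i" j k] by blast
        qed
      qed
      have reduce: "reduce_poly p (coeff_at F) = P.map_poly_ring F" for F
        by (simp add: reduce_poly_def P.map_poly_ring_def)
      have "arrangement_mod l n \<alpha> p = P.arrangement"
        unfolding arrangement_mod_def P.arrangement_def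
        by (intro image_cong) (auto simp: \<alpha> reduce)
      \<comment> \<open>The product over \<open>int_ring\<close> is moved to the type
        \<open>int mpoly\<close>, where its reduction is the polynomial known to be
        square-free.\<close>
      moreover have "defining_poly l n \<alpha> = coeff_at (\<Prod>i<n. linear_poly l (a i))"
      proof -
        interpret S: cring "mpoly_ring int_ring l" by (rule int_coeff.cring_mpoly_ring)
        have "defining_poly l n \<alpha> = (\<Otimes>\<^bsub>mpoly_ring int_ring l\<^esub>i\<in>{..<n}. int_coeff.map_poly_ring (linear_poly l (a i)))"
          unfolding defining_poly_def
          by (intro S.finprod_cong') (auto simp: \<alpha> map_poly_ring_int[symmetric] intro: int_coeff.map_poly_ring_closed)
        also have "\<dots> = int_coeff.map_poly_ring (\<Prod>i<n. linear_poly l (a i))"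
          by (rule int_coeff.finprod_mpoly_ring) auto
        finally show ?thesis by (simp add: map_poly_ring_int)
      qed
      ultimately show "good_prime l n \<alpha> p \<and>
        (\<forall>e. free_with_exponents (prime_field p) l (arrangement_mod l n \<alpha> p) e \<longleftrightarrow>
          free_with_exponents rat_field l A e)"
        using P.square_free_prod elim(3,4) p
        by (auto simp: good_prime_def reduce P.free_with_exponents_iff rat_free)
    qed
  qed
  then show ?thesis
    by (auto simp: eventually_sequentially dest: less_imp_le)
qed

end
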